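(* Let $c_4(G)$ denote the number of cycles of length four in a graph $G$. The Acyclic Matching problem and the Induced Matching problem are fixed-parameter tractable with respect to the combined parameter $(k,c_4)$; in fact, they admit a polynomial kernel with $O(k(k^2+c_4)^4)$ edges.
   Context: All graphs are finite and simple. A matching $M$ (set of pairwise nonadjacent edges) is acyclic if the subgraph of $G$ induced on the endpoints of the edges of $M$ is acyclic, and induced if that induced subgraph has exactly $|M|$ edges. Acyclic (resp. Induced) Matching problem: given a graph $G$ and a positive integer $k$, decide whether $G$ has an acyclic (resp. induced) matching of size $k$. *)

theory Defs
  imports Main "HOL-Computational_Algebra.Polynomial"
begin

section \<open>Finite simple graphs, matchings and cycles\<close>

definition simple_graph :: "'a set \<Rightarrow> 'a set set \<Rightarrow> bool" where
  "simple_graph V E \<longleftrightarrow> finite V \<and> (\<forall>e\<in>E. e \<subseteq> V \<and> card e = 2)"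

definition induced_edges :: "'a set set \<Rightarrow> 'a set \<Rightarrow> 'a set set" where
  "induced_edges E S = {e \<in> E. e \<subseteq> S}"

text \<open>A cycle is traversed by a list of its vertices; the edge joining the last vertex to the
  first one is the one at position \<open>length p - 1\<close>.\<close>

definition cycle_edges :: "'a list \<Rightarrow> 'a set set" where
  "cycle_edges p = {{p ! i, p ! (Suc i mod length p)} | i. i < length p}"

definition is_cycle :: "'a set set \<Rightarrow> 'a list \<Rightarrow> bool" where
  "is_cycle E p \<longleftrightarrow> 3 \<le> length p \<and> distinct p \<and> cycle_edges p \<subseteq> E"

definition acyclic_graph :: "'a set set \<Rightarrow> bool" where
  "acyclic_graph E \<longleftrightarrow> (\<nexists>p. is_cycle E p)"

text \<open>Cycles are counted as subgraphs, i.e. by their edge sets, so that neither the starting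
  vertex nor the orientation of a traversal matters.\<close>

definition c4 :: "'a set set \<Rightarrow> nat" where
  "c4 E = card {cycle_edges p | p. is_cycle E p \<and> length p = 4}"

definition matching :: "'a set set \<Rightarrow> 'a set set \<Rightarrow> bool" where
  "matching E M \<longleftrightarrow> M \<subseteq> E \<and> (\<forall>e\<in>M. \<forall>f\<in>M. e \<noteq> f \<longrightarrow> e \<inter> f = {})"

definition acyclic_matching :: "'a set set \<Rightarrow> 'a set set \<Rightarrow> bool" where
  "acyclic_matching E M \<longleftrightarrow> matching E M \<and> acyclic_graph (induced_edges E (\<Union>M))"

definition induced_matching :: "'a set set \<Rightarrow> 'a set set \<Rightarrow> bool" where
  "induced_matching E M \<longleftrightarrow> matching E M \<and> card (induced_edges E (\<Union>M)) = card M"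


section \<open>Problem instances\<close>

text \<open>As an input of an algorithm, a graph has the vertex set \<open>{0..<n}\<close> and is given by
  \<open>n\<close> and its edge set.\<close>

type_synonym graph = "nat \<times> nat set set"
type_synonym inst = "graph \<times> nat"

fun num_edges :: "inst \<Rightarrow> nat" where
  "num_edges ((n, E), k) = card E"

fun valid_inst :: "inst \<Rightarrow> bool" where
  "valid_inst ((n, E), k) \<longleftrightarrow> simple_graph {0..<n} E \<and> 1 \<le> k"

fun Acyclic_Matching :: "inst \<Rightarrow> bool" where
  "Acyclic_Matching ((n, E), k) \<longleftrightarrow> (\<exists>M. acyclic_matching E M \<and> card M = k)"

fun Induced_Matching :: "inst \<Rightarrow> bool" where
  "Induced_Matching ((n, E), k) \<longleftrightarrow> (\<exists>M. induced_matching E M \<and> card M = k)"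

text \<open>The combined parameter \<open>(k, c\<^sub>4)\<close>.\<close>

fun param_k_c4 :: "inst \<Rightarrow> nat \<times> nat" where
  "param_k_c4 ((n, E), k) = (k, c4 E)"


section \<open>The machine model\<close>

text \<open>
  Running times refer to Jones' language WHILE (\<^emph>\<open>Computability and Complexity from a
  Programming Perspective\<close>, MIT Press 1997): imperative programs with finitely many variables
  ranging over binary trees, whose only primitives are building a node, taking it apart and
  testing for the leaf.  An implementation represents trees by pointers, so that every
  primitive takes constant time; Jones proves that polynomial time in this model is polynomial
  time on Turing machines.  The number of primitives in an expression is bounded by a constant
  of the program, so that an assignment or a test is charged one step.
\<close>

datatype tree = Leaf | Node tree tree

fun tree_size :: "tree \<Rightarrow> nat" where
  "tree_size Leaf = 1"
| "tree_size (Node a b) = Suc (tree_size a + tree_size b)"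

datatype expr = Var nat | LeafE | NodeE expr expr | Fst expr | Snd expr

datatype com =
    Skip
  | Assign nat expr
  | Seq com com
  | Cond expr com com
  | While expr com

type_synonym state = "nat \<Rightarrow> tree"

fun tree_fst :: "tree \<Rightarrow> tree" where
  "tree_fst Leaf = Leaf"
| "tree_fst (Node a b) = a"

fun tree_snd :: "tree \<Rightarrow> tree" where
  "tree_snd Leaf = Leaf"
| "tree_snd (Node a b) = b"

fun eval_expr :: "expr \<Rightarrow> state \<Rightarrow> tree" where
  "eval_expr (Var v) s = s v"
| "eval_expr LeafE s = Leaf"
| "eval_expr (NodeE a b) s = Node (eval_expr a s) (eval_expr b s)"
| "eval_expr (Fst a) s = tree_fst (eval_expr a s)"
| "eval_expr (Snd a) s = tree_snd (eval_expr a s)"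

text \<open>\<open>exec c s t s'\<close>: started in state \<open>s\<close>, the program \<open>c\<close> halts after \<open>t\<close> steps in state
  \<open>s'\<close>.  A condition holds if its value is not the leaf.\<close>

inductive exec :: "com \<Rightarrow> state \<Rightarrow> nat \<Rightarrow> state \<Rightarrow> bool" where
  Skip: "exec Skip s 1 s"
| Assign: "exec (Assign v e) s 1 (s(v := eval_expr e s))"
| Seq: "exec c1 s t1 s1 \<Longrightarrow> exec c2 s1 t2 s2 \<Longrightarrow> exec (Seq c1 c2) s (t1 + t2) s2"
| CondTrue: "eval_expr e s \<noteq> Leaf \<Longrightarrow> exec c1 s t s' \<Longrightarrow> exec (Cond e c1 c2) s (Suc t) s'"
| CondFalse: "eval_expr e s = Leaf \<Longrightarrow> exec c2 s t s' \<Longrightarrow> exec (Cond e c1 c2) s (Suc t) s'"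
| WhileFalse: "eval_expr e s = Leaf \<Longrightarrow> exec (While e c) s 1 s"
| WhileTrue: "eval_expr e s \<noteq> Leaf \<Longrightarrow> exec c s t1 s1 \<Longrightarrow> exec (While e c) s1 t2 s2
    \<Longrightarrow> exec (While e c) s (Suc (t1 + t2)) s2"

inductive_cases exec_cases:
  "exec Skip s t s'" "exec (Assign v e) s t s'" "exec (Seq c1 c2) s t s'"
  "exec (Cond e c1 c2) s t s'" "exec (While e c) s t s'"

lemma exec_deterministic:
  "exec c s t s' \<Longrightarrow> exec c s u s'' \<Longrightarrow> t = u \<and> s' = s''"
proof (induction arbitrary: u s'' rule: exec.induct)
  case (Seq c1 s t1 s1 c2 t2 s2)
  from Seq.prems show ?case by (rule exec_cases(3)) (use Seq.IH in blast)
next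
  case (WhileTrue e s c t1 s1 t2 s2)
  from WhileTrue.prems show ?case
    by (rule exec_cases(5)) (use WhileTrue.hyps WhileTrue.IH in blast)+
next
  case (WhileFalse e s c)
  from WhileFalse.prems show ?case by (rule exec_cases(5)) (use WhileFalse.hyps in simp_all)
next
  case (CondTrue e s c1 t s' c2)
  from CondTrue.prems show ?case by (rule exec_cases(4)) (use CondTrue in blast)+
next
  case (CondFalse e s c2 t s' c1)
  from CondFalse.prems show ?case by (rule exec_cases(4)) (use CondFalse in blast)+
next
  case (Skip s)
  then show ?case by (rule exec_cases(1)) simp
next
  case (Assign v e s)
  then show ?case by (rule exec_cases(2)) simp
qed

text \<open>Variable 0 holds the input at the start and the output at the end.\<close>

definition runs :: "com \<Rightarrow> tree \<Rightarrow> nat \<Rightarrow> tree \<Rightarrow> bool" where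
  "runs c x t y \<longleftrightarrow> (\<exists>s'. exec c ((\<lambda>_. Leaf)(0 := x)) t s' \<and> s' 0 = y)"


section \<open>Encodings\<close>

text \<open>Graphs are encoded by adjacency matrices and numbers in unary.  The latter is the usual
  convention for parameterized problems, where the size of \<open>(x, k)\<close> is the length of \<open>x\<close>
  plus \<open>k\<close>.\<close>

fun enc_nat :: "nat \<Rightarrow> tree" where
  "enc_nat 0 = Leaf"
| "enc_nat (Suc n) = Node Leaf (enc_nat n)"

fun enc_bool :: "bool \<Rightarrow> tree" where
  "enc_bool False = Leaf"
| "enc_bool True = Node Leaf Leaf"

fun enc_list :: "tree list \<Rightarrow> tree" where
  "enc_list [] = Leaf"
| "enc_list (x # xs) = Node x (enc_list xs)"

fun enc_graph :: "graph \<Rightarrow> tree" where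
  "enc_graph (n, E) =
     enc_list (map (\<lambda>i. enc_list (map (\<lambda>j. enc_bool ({i, j} \<in> E)) [0..<n])) [0..<n])"

fun enc_inst :: "inst \<Rightarrow> tree" where
  "enc_inst (G, k) = Node (enc_graph G) (enc_nat k)"

fun enc_nat_pair :: "nat \<times> nat \<Rightarrow> tree" where
  "enc_nat_pair (a, b) = Node (enc_nat a) (enc_nat b)"

lemma enc_nat_inject [simp]: "enc_nat m = enc_nat n \<longleftrightarrow> m = n"
proof (induction m arbitrary: n)
  case 0 show ?case by (cases n) auto
next
  case (Suc m) then show ?case by (cases n) auto
qed

lemma enc_bool_inject [simp]: "enc_bool a = enc_bool b \<longleftrightarrow> a = b"
  by (cases a; cases b) auto

lemma enc_list_inject [simp]: "enc_list xs = enc_list ys \<longleftrightarrow> xs = ys"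
proof (induction xs arbitrary: ys)
  case Nil show ?case by (cases ys) auto
next
  case (Cons x xs) then show ?case by (cases ys) auto
qed

lemma enc_inst_inject:
  assumes "valid_inst x" "valid_inst y" "enc_inst x = enc_inst y"
  shows "x = y"
proof -
  obtain n E k where x: "x = ((n, E), k)" by (cases x) (auto split: prod.splits)
  obtain m F l where y: "y = ((m, F), l)" by (cases y) (auto split: prod.splits)
  have kl: "k = l"
    using assms(3) unfolding x y by simp
  have rows:
    "map (\<lambda>i. enc_list (map (\<lambda>j. enc_bool ({i, j} \<in> E)) [0..<n])) [0..<n]
     = map (\<lambda>i. enc_list (map (\<lambda>j. enc_bool ({i, j} \<in> F)) [0..<m])) [0..<m]"
    using assms(3) unfolding x y enc_inst.simps enc_graph.simps tree.inject enc_list_inject by blast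
  have nm: "n = m" using arg_cong[OF rows, of length] by simp
  have adj: "{i, j} \<in> E \<longleftrightarrow> {i, j} \<in> F" if "i < n" "j < n" for i j
    using arg_cong[OF rows, of "\<lambda>r. r ! i"] that nm
    by (simp add: map_eq_conv del: upt_conv_Cons)
  have "e \<in> E \<longleftrightarrow> e \<in> F" for e
  proof -
    have "\<exists>i j. i < n \<and> j < n \<and> e = {i, j}" if "e \<in> E \<or> e \<in> F"
    proof -
      from that assms(1,2) have "card e = 2" "e \<subseteq> {0..<n}"
        using x y nm by (auto simp: simple_graph_def)
      then obtain i j where "e = {i, j}" "{i, j} \<subseteq> {0..<n}" by (metis card_2_iff)
      moreover from this(2) have "i < n" "j < n" by simp_all
      ultimately show ?thesis by blast
    qed
    then show ?thesis using adj by blast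
  qed
  then show ?thesis using x y kl nm by auto
qed


section \<open>Fixed-parameter tractability and kernels\<close>

definition computable :: "(nat \<times> nat \<Rightarrow> nat) \<Rightarrow> bool" where
  "computable f \<longleftrightarrow> (\<exists>c. \<forall>a. \<exists>t. runs c (enc_nat_pair a) t (enc_nat (f a)))"

definition fpt :: "(inst \<Rightarrow> bool) \<Rightarrow> (inst \<Rightarrow> nat \<times> nat) \<Rightarrow> bool" where
  "fpt Q \<kappa> \<longleftrightarrow> (\<exists>c f (p :: nat poly). computable f \<and>
     (\<forall>x. valid_inst x \<longrightarrow>
        (\<exists>t. runs c (enc_inst x) t (enc_bool (Q x)) \<and>
             t \<le> f (\<kappa> x) * poly p (tree_size (enc_inst x)))))"

text \<open>Subtrees of a tree may be shared in memory, so writing down the output is charged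
  separately.\<close>

definition poly_time :: "(inst \<Rightarrow> inst) \<Rightarrow> bool" where
  "poly_time K \<longleftrightarrow> (\<exists>c (p :: nat poly).
     (\<forall>x. valid_inst x \<longrightarrow>
        (\<exists>t. runs c (enc_inst x) t (enc_inst (K x)) \<and>
             t + tree_size (enc_inst (K x)) \<le> poly p (tree_size (enc_inst x)))))"

text \<open>For a combined parameter \<open>(a, b)\<close>, being bounded by a polynomial in \<open>a\<close> and \<open>b\<close> is the
  same as being bounded by a polynomial in \<open>a + b\<close>.\<close>

definition polynomial_kernel ::
  "(inst \<Rightarrow> bool) \<Rightarrow> (inst \<Rightarrow> nat \<times> nat) \<Rightarrow> (inst \<Rightarrow> inst) \<Rightarrow> bool" where
  "polynomial_kernel Q \<kappa> K \<longleftrightarrow>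
     poly_time K \<and>
     (\<forall>x. valid_inst x \<longrightarrow> valid_inst (K x) \<and> (Q (K x) \<longleftrightarrow> Q x)) \<and>
     (\<exists>p :: nat poly. \<forall>x. valid_inst x \<longrightarrow>
        tree_size (enc_inst (K x)) \<le> poly p (fst (\<kappa> x) + snd (\<kappa> x)))"

end

theory Submission imports Defs begin

text \<open>
  Of the degree-one neighbours of a vertex only one needs to be kept.  Afterwards, let \<open>q\<close> be the
  number of 4-cycles.  A vertex \<open>v\<close> of degree at least \<open>C (k\<^sup>2 + q)\<close> yields an induced matching of
  size \<open>k\<close>: most neighbours of \<open>v\<close> lie on no 4-cycle with \<open>v\<close>, so their second neighbours are
  distinct, and a graph with few 4-cycles has large independent sets.  If there is no such vertex,
  an edge is in conflict with \<open>O((k\<^sup>2 + q)\<^sup>2)\<close> others, so that more than \<open>O(k (k\<^sup>2 + q)\<^sup>2)\<close> edges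
  again force an induced matching of size \<open>k\<close>, which is also acyclic.  Hence a reduced graph with
  more edges is a yes-instance, and all others are small.  Fixed-parameter tractability follows by
  exhaustive search in the kernel.

  Running times are obtained from closure properties of the functions on trees computable in
  polynomial time, the main one being iteration along a list with an accumulator of polynomial
  size.
\<close>

section \<open>Programs as combinators on trees\<close>

text \<open>The pendant rule makes large degree useful: a star has no 4-cycle and a centre of
  arbitrary degree, but no matching with two edges. Pendant vertices at the same centre are twins
  and a matching covers at most one of them, so keeping one loses neither acyclic nor induced
  matchings. Removal can make a centre pendant in turn, as in a star; that this does no harm is the
  point of \<open>reduced_pendant\<close>. One kernel serves both problems because the large case
  yields a matching that is induced and acyclic at once. The program tests \<open>small\<close> with
  the number of ordered quadruples tracing a 4-cycle; \<open>c4\<close> enters only when the size is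
  bounded. The exponent obtained for \<open>k\<^sup>2 + c4 E\<close> is 2, and 4 follows since the
  base is at least 1. Two features of the model shape the rest: subtrees may be shared, so running
  time does not control output size, which needs its own bound; and the factor in \<open>fpt\<close>
  must be computable, so the exponential bound on the word list of the exhaustive search has to be
  computed by a program too.\<close>

fun items :: "tree \<Rightarrow> tree list" where
  "items Leaf = []"
| "items (Node a b) = a # items b"

lemma items_enc_list [simp]: "items (enc_list xs) = xs"
  by (induction xs) auto

lemma enc_list_items [simp]: "enc_list (items t) = t"
  by (induction t) auto

lemma enc_nat_eq_enc_list: "enc_nat n = enc_list (replicate n Leaf)"
  by (induction n) auto

lemma items_enc_nat [simp]: "items (enc_nat n) = replicate n Leaf"
  by (simp add: enc_nat_eq_enc_list)

definition nat_of :: "tree \<Rightarrow> nat" where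
  "nat_of t = length (items t)"

lemma nat_of_enc_nat [simp]: "nat_of (enc_nat n) = n"
  by (simp add: nat_of_def)

lemma tree_size_pos: "1 \<le> tree_size t"
  by (cases t) auto

lemma tree_size_enc_list: "tree_size (enc_list xs) = 1 + (\<Sum>x\<leftarrow>xs. 1 + tree_size x)"
  by (induction xs) auto

lemma tree_size_items: "tree_size t = 1 + (\<Sum>x\<leftarrow>items t. 1 + tree_size x)"
  using tree_size_enc_list[of "items t"] by simp

lemma tree_size_enc_nat [simp]: "tree_size (enc_nat n) = 2 * n + 1"
  by (induction n) auto

lemma length_items_le: "length (items t) \<le> tree_size t"
  by (induction t) auto

lemma tree_size_item_le: "y \<in> set (items t) \<Longrightarrow> tree_size y \<le> tree_size t"
  by (induction t) auto

lemma tree_size_fst_le: "tree_size (tree_fst t) \<le> tree_size t"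
  by (cases t) auto

lemma tree_size_snd_le: "tree_size (tree_snd t) \<le> tree_size t"
  by (cases t) auto

text \<open>Programs work on a stack kept in variable 0: they replace its top entry, so that they can be
  composed without renaming variables.\<close>

definition computes_within :: "(tree \<Rightarrow> tree) \<Rightarrow> (tree \<Rightarrow> nat) \<Rightarrow> bool" where
  "computes_within F T \<longleftrightarrow> (\<exists>c. \<forall>s x r. s 0 = Node x r \<longrightarrow>
     (\<exists>t\<le>T x. exec c s t (s(0 := Node (F x) r))))"

lemma computes_within_mono: "computes_within F T \<Longrightarrow> (\<And>x. T x \<le> T' x) \<Longrightarrow> computes_within F T'"
  unfolding computes_within_def by (meson le_trans)

lemma computes_within_assign:
  assumes "\<And>s x r. s 0 = Node x r \<Longrightarrow> eval_expr e s = Node (F x) r"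
  shows "computes_within F (\<lambda>_. 1)"
  unfolding computes_within_def
proof (intro exI[of _ "Assign 0 e"] allI impI)
  fix s :: state and x r assume "s 0 = Node x r"
  then have "exec (Assign 0 e) s 1 (s(0 := Node (F x) r))"
    using exec.Assign[of 0 e s] assms by simp
  then show "\<exists>t\<le>1. exec (Assign 0 e) s t (s(0 := Node (F x) r))" by blast
qed

lemma computes_within_compose:
  assumes "computes_within F T" "computes_within G U"
  shows "computes_within (\<lambda>x. G (F x)) (\<lambda>x. T x + U (F x))"
proof -
  obtain c where c: "\<And>s x r. s 0 = Node x r \<Longrightarrow> \<exists>t\<le>T x. exec c s t (s(0 := Node (F x) r))"
    using assms(1) unfolding computes_within_def by blast
  obtain d where d: "\<And>s x r. s 0 = Node x r \<Longrightarrow> \<exists>t\<le>U x. exec d s t (s(0 := Node (G x) r))"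
    using assms(2) unfolding computes_within_def by blast
  have "\<exists>t\<le>T x + U (F x). exec (Seq c d) s t (s(0 := Node (G (F x)) r))"
    if s: "s 0 = Node x r" for s :: state and x r
  proof -
    obtain t where t: "t \<le> T x" "exec c s t (s(0 := Node (F x) r))" using c[of s x r] s by blast
    obtain u where u: "u \<le> U (F x)"
      "exec d (s(0 := Node (F x) r)) u (s(0 := Node (F x) r, 0 := Node (G (F x)) r))"
      using d[of "s(0 := Node (F x) r)" "F x" r] by auto
    show ?thesis using exec.Seq[OF t(2) u(2)] t(1) u(1)
      by (intro exI[of _ "t + u"]) auto
  qed
  then show ?thesis unfolding computes_within_def by blast
qed

text \<open>A saved copy of the input lies below the working entry, so that \<open>x\<close>
  survives the first program. \<open>?a2\<close> exchanges result and copy, \<open>?a3\<close> joins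
  the two results; the constant counts the three assignments.\<close>

lemma computes_within_pair:
  assumes "computes_within F T" "computes_within G U"
  shows "computes_within (\<lambda>x. Node (F x) (G x)) (\<lambda>x. T x + U x + 3)"
proof -
  obtain c where c: "\<And>s x r. s 0 = Node x r \<Longrightarrow> \<exists>t\<le>T x. exec c s t (s(0 := Node (F x) r))"
    using assms(1) unfolding computes_within_def by blast
  obtain d where d: "\<And>s x r. s 0 = Node x r \<Longrightarrow> \<exists>t\<le>U x. exec d s t (s(0 := Node (G x) r))"
    using assms(2) unfolding computes_within_def by blast
  let ?a1 = "Assign 0 (NodeE (Fst (Var 0)) (Var 0))"
  let ?a2 = "Assign 0 (NodeE (Fst (Snd (Var 0))) (NodeE (Fst (Var 0)) (Snd (Snd (Var 0)))))"
  let ?a3 = "Assign 0 (NodeE (NodeE (Fst (Snd (Var 0))) (Fst (Var 0))) (Snd (Snd (Var 0))))"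
  let ?p = "Seq ?a1 (Seq c (Seq ?a2 (Seq d ?a3)))"
  have "\<exists>t\<le>T x + U x + 3. exec ?p s t (s(0 := Node (Node (F x) (G x)) r))"
    if s: "s 0 = Node x r" for s :: state and x r
  proof -
    let ?s1 = "s(0 := Node x (Node x r))"
    let ?s2 = "s(0 := Node (F x) (Node x r))"
    let ?s3 = "s(0 := Node x (Node (F x) r))"
    let ?s4 = "s(0 := Node (G x) (Node (F x) r))"
    have e1: "exec ?a1 s 1 ?s1" using exec.Assign[of 0 _ s] s by (metis eval_expr.simps(1,3,4) tree_fst.simps(2))
    obtain t where t: "t \<le> T x" "exec c ?s1 t ?s2" using c[of ?s1 x "Node x r"] by auto
    have e2: "exec ?a2 ?s2 1 ?s3"
      using exec.Assign[of 0 "NodeE (Fst (Snd (Var 0))) (NodeE (Fst (Var 0)) (Snd (Snd (Var 0))))" ?s2] by simp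
    obtain u where u: "u \<le> U x" "exec d ?s3 u ?s4" using d[of ?s3 x "Node (F x) r"] by auto
    have e3: "exec ?a3 ?s4 1 (s(0 := Node (Node (F x) (G x)) r))"
      using exec.Assign[of 0 "NodeE (NodeE (Fst (Snd (Var 0))) (Fst (Var 0))) (Snd (Snd (Var 0)))" ?s4] by simp
    have "exec ?p s (1 + (t + (1 + (u + 1)))) (s(0 := Node (Node (F x) (G x)) r))"
      by (intro exec.Seq[OF e1] exec.Seq[OF t(2)] exec.Seq[OF e2] exec.Seq[OF u(2)] e3)
    then show ?thesis using t(1) u(1) by (intro exI[of _ "1 + (t + (1 + (u + 1)))"]) auto
  qed
  then show ?thesis unfolding computes_within_def by blast
qed

text \<open>The test consumes one copy of the input and the chosen branch runs on the other.
  Charging both branches keeps the bound a plain sum.\<close>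

lemma computes_within_if:
  assumes "computes_within B S" "computes_within F T" "computes_within G U"
  shows "computes_within (\<lambda>x. if B x \<noteq> Leaf then F x else G x) (\<lambda>x. S x + T x + U x + 3)"
proof -
  obtain b where b: "\<And>s x r. s 0 = Node x r \<Longrightarrow> \<exists>t\<le>S x. exec b s t (s(0 := Node (B x) r))"
    using assms(1) unfolding computes_within_def by blast
  obtain c where c: "\<And>s x r. s 0 = Node x r \<Longrightarrow> \<exists>t\<le>T x. exec c s t (s(0 := Node (F x) r))"
    using assms(2) unfolding computes_within_def by blast
  obtain d where d: "\<And>s x r. s 0 = Node x r \<Longrightarrow> \<exists>t\<le>U x. exec d s t (s(0 := Node (G x) r))"
    using assms(3) unfolding computes_within_def by blast
  let ?a1 = "Assign 0 (NodeE (Fst (Var 0)) (Var 0))"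
  let ?a2 = "Assign 0 (Snd (Var 0))"
  let ?q = "Cond (Fst (Var 0)) (Seq ?a2 c) (Seq ?a2 d)"
  let ?p = "Seq ?a1 (Seq b ?q)"
  have "\<exists>t\<le>S x + T x + U x + 3. exec ?p s t (s(0 := Node (if B x \<noteq> Leaf then F x else G x) r))"
    if s: "s 0 = Node x r" for s :: state and x r
  proof -
    let ?s1 = "s(0 := Node x (Node x r))"
    let ?s2 = "s(0 := Node (B x) (Node x r))"
    let ?s3 = "s(0 := Node x r)"
    have e1: "exec ?a1 s 1 ?s1" using exec.Assign[of 0 _ s] s by (metis eval_expr.simps(1,3,4) tree_fst.simps(2))
    obtain t where t: "t \<le> S x" "exec b ?s1 t ?s2" using b[of ?s1 x "Node x r"] by auto
    have e2: "exec ?a2 ?s2 1 ?s3" using exec.Assign[of 0 "Snd (Var 0)" ?s2] by simp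
    have "\<exists>u\<le>T x + U x + 2. exec ?q ?s2 u (s(0 := Node (if B x \<noteq> Leaf then F x else G x) r))"
    proof (cases "B x = Leaf")
      case True
      obtain u where u: "u \<le> U x" "exec d ?s3 u (s(0 := Node (G x) r))" using d[of ?s3 x r] by auto
      have "exec ?q ?s2 (Suc (1 + u)) (s(0 := Node (G x) r))"
        using True by (intro exec.CondFalse exec.Seq[OF e2 u(2)]) simp
      then show ?thesis using True u(1) by (intro exI[of _ "Suc (1 + u)"]) simp
    next
      case False
      obtain u where u: "u \<le> T x" "exec c ?s3 u (s(0 := Node (F x) r))" using c[of ?s3 x r] by auto
      have "exec ?q ?s2 (Suc (1 + u)) (s(0 := Node (F x) r))"
        using False by (intro exec.CondTrue exec.Seq[OF e2 u(2)]) simp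
      then show ?thesis using False u(1) by (intro exI[of _ "Suc (1 + u)"]) simp
    qed
    then obtain u where u: "u \<le> T x + U x + 2"
      "exec ?q ?s2 u (s(0 := Node (if B x \<noteq> Leaf then F x else G x) r))" by blast
    show ?thesis using exec.Seq[OF e1 exec.Seq[OF t(2) u(2)]] t(1) u(1)
      by (intro exI[of _ "1 + (t + u)"]) auto
  qed
  then show ?thesis unfolding computes_within_def by blast
qed

text \<open>Of the 3 extra units per item, one pays for the loop test and two for the assignments
  around the step; the final 1 is the failing test.\<close>

fun fold_time :: "(tree \<Rightarrow> tree) \<Rightarrow> (tree \<Rightarrow> nat) \<Rightarrow> tree \<Rightarrow> tree list \<Rightarrow> nat" where
  "fold_time G T a [] = 1"
| "fold_time G T a (y # ys) = T (Node a y) + 3 + fold_time G T (G (Node a y)) ys"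

lemma computes_within_fold:
  assumes "computes_within G T"
  shows "computes_within (\<lambda>x. foldl (\<lambda>a y. G (Node a y)) (tree_fst x) (items (tree_snd x)))
           (\<lambda>x. fold_time G T (tree_fst x) (items (tree_snd x)) + 2)"
proof -
  obtain c where c: "\<And>s x r. s 0 = Node x r \<Longrightarrow> \<exists>t\<le>T x. exec c s t (s(0 := Node (G x) r))"
    using assms unfolding computes_within_def by blast
  let ?V = "Var 0"
  \<comment> \<open>At the loop test the top entry is \<open>Node a l\<close>, with accumulator
    \<open>a\<close> and remaining list \<open>l\<close>. \<open>?e1\<close> parks the tail of
    \<open>l\<close> below \<open>Node a y\<close>, where \<open>c\<close> leaves it alone, and
    \<open>?e2\<close> brings it back.\<close>
  let ?e1 = "NodeE (NodeE (Fst (Fst ?V)) (Fst (Snd (Fst ?V)))) (NodeE (Snd (Snd (Fst ?V))) (Snd ?V))"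
  let ?e2 = "NodeE (NodeE (Fst ?V) (Fst (Snd ?V))) (Snd (Snd ?V))"
  \<comment> \<open>Rebuilding the pair from its projections covers the input \<open>Leaf\<close>,
    which is read as \<open>Node Leaf Leaf\<close>.\<close>
  let ?e0 = "NodeE (NodeE (Fst (Fst ?V)) (Snd (Fst ?V))) (Snd ?V)"
  let ?e3 = "NodeE (Fst (Fst ?V)) (Snd ?V)"
  let ?body = "Seq (Assign 0 ?e1) (Seq c (Assign 0 ?e2))"
  let ?loop = "While (Snd (Fst ?V)) ?body"
  let ?f = "\<lambda>a y. G (Node a y)"
  have loop: "\<exists>t\<le>fold_time G T a (items l).
      exec ?loop s t (s(0 := Node (Node (foldl ?f a (items l)) Leaf) r))"
    if "s 0 = Node (Node a l) r" for s :: state and a l r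
    using that
  proof (induction l arbitrary: s a)
    case Leaf
    then have "s(0 := Node (Node a Leaf) r) = s" by auto
    then show ?case using exec.WhileFalse[of "Snd (Fst ?V)" s ?body] Leaf by auto
  next
    case (Node y l)
    let ?s1 = "s(0 := Node (Node a y) (Node l r))"
    let ?s2 = "s(0 := Node (G (Node a y)) (Node l r))"
    let ?s3 = "s(0 := Node (Node (G (Node a y)) l) r)"
    have e1: "exec (Assign 0 ?e1) s 1 ?s1" using exec.Assign[of 0 ?e1 s] Node.prems by simp
    obtain t where t: "t \<le> T (Node a y)" "exec c ?s1 t ?s2" using c[of ?s1 "Node a y" "Node l r"] by auto
    have e2: "exec (Assign 0 ?e2) ?s2 1 ?s3" using exec.Assign[of 0 ?e2 ?s2] by simp
    have b: "exec ?body s (1 + (t + 1)) ?s3" by (intro exec.Seq[OF e1] exec.Seq[OF t(2)] e2)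
    obtain u where u: "u \<le> fold_time G T (G (Node a y)) (items l)"
      "exec ?loop ?s3 u (?s3(0 := Node (Node (foldl ?f (G (Node a y)) (items l)) Leaf) r))"
      using Node.IH(2)[of ?s3 "G (Node a y)", OF fun_upd_same] by blast
    have "exec ?loop s (Suc ((1 + (t + 1)) + u))
        (?s3(0 := Node (Node (foldl ?f (G (Node a y)) (items l)) Leaf) r))"
      using Node.prems by (intro exec.WhileTrue[OF _ b u(2)]) simp
    then have "exec ?loop s (Suc ((1 + (t + 1)) + u))
        (s(0 := Node (Node (foldl ?f a (items (Node y l))) Leaf) r))"
      unfolding fun_upd_upd items.simps foldl_Cons .
    moreover have "Suc ((1 + (t + 1)) + u) \<le> fold_time G T a (items (Node y l))"
      using t(1) u(1) by simp
    ultimately show ?case by blast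
  qed
  let ?p = "Seq (Assign 0 ?e0) (Seq ?loop (Assign 0 ?e3))"
  have "\<exists>t\<le>fold_time G T (tree_fst x) (items (tree_snd x)) + 2.
      exec ?p s t (s(0 := Node (foldl ?f (tree_fst x) (items (tree_snd x))) r))"
    if s: "s 0 = Node x r" for s :: state and x r
  proof -
    let ?s1 = "s(0 := Node (Node (tree_fst x) (tree_snd x)) r)"
    let ?res = "foldl ?f (tree_fst x) (items (tree_snd x))"
    let ?s2 = "s(0 := Node (Node ?res Leaf) r)"
    have e0: "exec (Assign 0 ?e0) s 1 ?s1" using exec.Assign[of 0 ?e0 s] s by simp
    obtain t where t: "t \<le> fold_time G T (tree_fst x) (items (tree_snd x))" "exec ?loop ?s1 t ?s2"
      using loop[of ?s1 "tree_fst x" "tree_snd x" r] by auto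
    have e3: "exec (Assign 0 ?e3) ?s2 1 (s(0 := Node ?res r))" using exec.Assign[of 0 ?e3 ?s2] by simp
    have "exec ?p s (1 + (t + 1)) (s(0 := Node ?res r))"
      by (intro exec.Seq[OF e0] exec.Seq[OF t(2)] e3)
    then show ?thesis using t(1) by (intro exI[of _ "1 + (t + 1)"]) auto
  qed
  then show ?thesis unfolding computes_within_def by blast
qed

lemma computes_within_runs:
  assumes "computes_within F T"
  shows "\<exists>c. \<forall>x. \<exists>t\<le>T x + 2. runs c x t (F x)"
proof -
  obtain c where c: "\<And>s x r. s 0 = Node x r \<Longrightarrow> \<exists>t\<le>T x. exec c s t (s(0 := Node (F x) r))"
    using assms unfolding computes_within_def by blast
  let ?p = "Seq (Assign 0 (NodeE (Var 0) LeafE)) (Seq c (Assign 0 (Fst (Var 0))))"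
  have "\<exists>t\<le>T x + 2. runs ?p x t (F x)" for x
  proof -
    let ?s = "(\<lambda>_. Leaf)(0 := x) :: state"
    let ?s1 = "?s(0 := Node x Leaf)"
    let ?s2 = "?s1(0 := Node (F x) Leaf)"
    have e1: "exec (Assign 0 (NodeE (Var 0) LeafE)) ?s 1 ?s1"
      using exec.Assign[of 0 "NodeE (Var 0) LeafE" ?s] by simp
    obtain t where t: "t \<le> T x" "exec c ?s1 t ?s2" using c[of ?s1 x Leaf] by auto
    have e2: "exec (Assign 0 (Fst (Var 0))) ?s2 1 (?s2(0 := F x))"
      using exec.Assign[of 0 "Fst (Var 0)" ?s2] by simp
    have "exec ?p ?s (1 + (t + 1)) (?s2(0 := F x))"
      by (intro exec.Seq[OF e1] exec.Seq[OF t(2)] e2)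
    then have "runs ?p x (1 + (t + 1)) (F x)" unfolding runs_def by force
    then show ?thesis using t(1) by (intro exI[of _ "1 + (t + 1)"]) simp
  qed
  then show ?thesis by blast
qed

lemma computes_within_id: "computes_within (\<lambda>x. x) (\<lambda>_. 1)"
  by (rule computes_within_assign[where e = "Var 0"]) simp

lemma computes_within_fst: "computes_within tree_fst (\<lambda>_. 1)"
  by (rule computes_within_assign[where e = "NodeE (Fst (Fst (Var 0))) (Snd (Var 0))"]) simp

lemma computes_within_snd: "computes_within tree_snd (\<lambda>_. 1)"
  by (rule computes_within_assign[where e = "NodeE (Snd (Fst (Var 0))) (Snd (Var 0))"]) simp

lemma computes_within_const: "computes_within (\<lambda>_. u) (\<lambda>_. 1)"
proof -
  have "\<exists>e. \<forall>s. eval_expr e s = u"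
  proof (induction u)
    case Leaf show ?case by (intro exI[of _ LeafE]) simp
  next
    case (Node a b)
    then obtain e f where "\<forall>s. eval_expr e s = a" "\<forall>s. eval_expr f s = b" by blast
    then show ?case by (intro exI[of _ "NodeE e f"]) simp
  qed
  then obtain e where "\<And>s. eval_expr e s = u" by blast
  then show ?thesis by (intro computes_within_assign[where e = "NodeE e (Snd (Var 0))"]) simp
qed

section \<open>Closure properties of polynomial-time tree functions\<close>

lemma poly_nat_mono: "m \<le> n \<Longrightarrow> poly (p :: nat poly) m \<le> poly p n"
  by (induction p) (auto intro: add_mono mult_mono)

text \<open>Running time does not bound the output: pairing a tree with itself doubles its size in
  one step. The size bound is what makes composition possible.\<close>

definition polytime :: "(tree \<Rightarrow> tree) \<Rightarrow> bool" where
  "polytime F \<longleftrightarrow> (\<exists>p :: nat poly. computes_within F (\<lambda>x. poly p (tree_size x)) \<and>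
     (\<forall>x. tree_size (F x) \<le> poly p (tree_size x)))"

lemma polytime_I:
  assumes "computes_within F T" "\<And>x. T x \<le> poly p (tree_size x)" "\<And>x. tree_size (F x) \<le> poly q (tree_size x)"
  shows "polytime F"
  unfolding polytime_def
proof (intro exI[of _ "p + q"] conjI allI)
  show "computes_within F (\<lambda>x. poly (p + q) (tree_size x))"
    using assms(1) by (rule computes_within_mono) (use assms(2) in \<open>simp add: trans_le_add1\<close>)
  show "tree_size (F x) \<le> poly (p + q) (tree_size x)" for x
    using assms(3)[of x] by simp
qed

lemma polytime_E:
  assumes "polytime F"
  obtains p :: "nat poly" where "computes_within F (\<lambda>x. poly p (tree_size x))"
    "\<And>x. tree_size (F x) \<le> poly p (tree_size x)"
  using assms unfolding polytime_def by blast

lemma polytime_id: "polytime (\<lambda>x. x)"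
  by (rule polytime_I[OF computes_within_id, where p = 1 and q = "[:0, 1:]"]) auto

lemma polytime_const: "polytime (\<lambda>_. u)"
  by (rule polytime_I[OF computes_within_const, where p = 1 and q = "[:tree_size u:]"]) auto

lemma polytime_compose:
  assumes "polytime F" "polytime G"
  shows "polytime (\<lambda>x. G (F x))"
proof -
  obtain p where p: "computes_within F (\<lambda>x. poly p (tree_size x))" "\<And>x. tree_size (F x) \<le> poly p (tree_size x)"
    by (rule polytime_E[OF assms(1)]) blast
  obtain q where q: "computes_within G (\<lambda>x. poly q (tree_size x))" "\<And>x. tree_size (G x) \<le> poly q (tree_size x)"
    by (rule polytime_E[OF assms(2)]) blast
  have le: "poly q (tree_size (F x)) \<le> poly (pcompose q p) (tree_size x)" for x
    using poly_nat_mono[OF p(2)] by (simp add: poly_pcompose)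
  show ?thesis
    by (rule polytime_I[OF computes_within_compose[OF p(1) q(1)], where p = "p + pcompose q p" and q = "pcompose q p"])
      (use le q(2) in \<open>auto intro: order_trans\<close>)
qed

lemma polytime_fst: "polytime f \<Longrightarrow> polytime (\<lambda>x. tree_fst (f x))"
  by (erule polytime_compose, rule polytime_I[OF computes_within_fst, where p = 1 and q = "[:0, 1:]"])
    (auto simp: tree_size_fst_le)

lemma polytime_snd: "polytime f \<Longrightarrow> polytime (\<lambda>x. tree_snd (f x))"
  by (erule polytime_compose, rule polytime_I[OF computes_within_snd, where p = 1 and q = "[:0, 1:]"])
    (auto simp: tree_size_snd_le)

lemma polytime_Node:
  assumes "polytime f" "polytime g"
  shows "polytime (\<lambda>x. Node (f x) (g x))"
proof -
  obtain p where p: "computes_within f (\<lambda>x. poly p (tree_size x))" "\<And>x. tree_size (f x) \<le> poly p (tree_size x)"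
    by (rule polytime_E[OF assms(1)]) blast
  obtain q where q: "computes_within g (\<lambda>x. poly q (tree_size x))" "\<And>x. tree_size (g x) \<le> poly q (tree_size x)"
    by (rule polytime_E[OF assms(2)]) blast
  show ?thesis
    by (rule polytime_I[OF computes_within_pair[OF p(1) q(1)], where p = "p + q + 3" and q = "p + q + 1"])
      (use p(2) q(2) in \<open>auto intro: add_mono\<close>)
qed

lemma polytime_if_Leaf:
  assumes "polytime b" "polytime f" "polytime g"
  shows "polytime (\<lambda>x. if b x \<noteq> Leaf then f x else g x)"
proof -
  obtain o' where o: "computes_within b (\<lambda>x. poly o' (tree_size x))" by (rule polytime_E[OF assms(1)]) blast
  obtain p where p: "computes_within f (\<lambda>x. poly p (tree_size x))" "\<And>x. tree_size (f x) \<le> poly p (tree_size x)"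
    by (rule polytime_E[OF assms(2)]) blast
  obtain q where q: "computes_within g (\<lambda>x. poly q (tree_size x))" "\<And>x. tree_size (g x) \<le> poly q (tree_size x)"
    by (rule polytime_E[OF assms(3)]) blast
  show ?thesis
    by (rule polytime_I[OF computes_within_if[OF o p(1) q(1)], where p = "o' + p + q + 3" and q = "p + q"])
      (use p(2) q(2) in \<open>auto intro: trans_le_add1 trans_le_add2\<close>)
qed

lemma fold_time_le:
  assumes "\<And>ys y zs. us = ys @ y # zs \<Longrightarrow> T (Node (foldl (\<lambda>a y. G (Node a y)) a ys) y) \<le> B"
  shows "fold_time G T a us \<le> length us * (B + 3) + 1"
  using assms
proof (induction us arbitrary: a)
  case (Cons u us)
  have "fold_time G T (G (Node a u)) us \<le> length us * (B + 3) + 1"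
  proof (rule Cons.IH)
    fix ys y zs assume "us = ys @ y # zs"
    then show "T (Node (foldl (\<lambda>a y. G (Node a y)) (G (Node a u)) ys) y) \<le> B"
      using Cons.prems[of "u # ys" y zs] by simp
  qed
  moreover have "T (Node a u) \<le> B" using Cons.prems[of "[]"] by simp
  ultimately show ?case by simp
qed simp

text \<open>The accumulator carries the environment \<open>x\<close> along.\<close>

lemma foldl_with_environment:
  "foldl (\<lambda>a y. Node (tree_fst a) (g (tree_fst a) (tree_snd a) y)) (Node x a) ys
     = Node x (foldl (g x) a ys)"
  by (induction ys arbitrary: a) auto

text \<open>The accumulator bound \<open>B\<close> is arbitrary and chosen after \<open>p\<close>.
  So polynomial \<open>B\<close> gives polynomial time, and the same statement still applies to
  exponential \<open>B\<close>, as for word lists and powers. The prefixes \<open>ys\<close>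
  describe the intermediate accumulators.\<close>

lemma computes_within_foldl:
  assumes g: "polytime (\<lambda>z. g (tree_fst (tree_fst z)) (tree_snd (tree_fst z)) (tree_snd z))"
    and i: "polytime i" and h: "polytime h"
  shows "\<exists>p :: nat poly. \<forall>B. (\<forall>x ys zs. items (h x) = ys @ zs \<longrightarrow>
      tree_size (foldl (g x) (i x) ys) \<le> B (tree_size x)) \<longrightarrow>
    computes_within (\<lambda>x. foldl (g x) (i x) (items (h x))) (\<lambda>x. poly p (tree_size x + B (tree_size x)))"
proof -
  let ?G = "\<lambda>z. Node (tree_fst (tree_fst z))
     (g (tree_fst (tree_fst z)) (tree_snd (tree_fst z)) (tree_snd z))"
  have "polytime ?G" by (intro polytime_Node polytime_fst polytime_id g)
  then obtain p where p: "computes_within ?G (\<lambda>x. poly p (tree_size x))" by (rule polytime_E) blast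
  let ?I = "\<lambda>x. Node (Node x (i x)) (h x)"
  have "polytime ?I" by (intro polytime_Node polytime_id i h)
  then obtain q where q: "computes_within ?I (\<lambda>x. poly q (tree_size x))" "\<And>x. tree_size (?I x) \<le> poly q (tree_size x)"
    by (rule polytime_E) blast
  \<comment> \<open>At \<open>tree_size x + B (tree_size x)\<close>, \<open>?st\<close> bounds the
    size of the argument \<open>Node (Node x a) y\<close> of a step: its summands pay for the
    accumulator, the item, and the environment with two nodes.\<close>
  let ?st = "[:0, 1:] + q + [:2, 1:]"
  let ?r = "q + q * (pcompose p ?st + 3) + 4"
  have "computes_within (\<lambda>x. foldl (g x) (i x) (items (h x))) (\<lambda>x. poly ?r (tree_size x + B (tree_size x)))"
    if B: "\<And>x ys zs. items (h x) = ys @ zs \<Longrightarrow> tree_size (foldl (g x) (i x) ys) \<le> B (tree_size x)" for B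
  proof -
    let ?T = "\<lambda>x. poly p (tree_size x)"
    have foldG: "foldl (\<lambda>a y. ?G (Node a y)) (Node x a) ys = Node x (foldl (g x) a ys)" for x a ys
      using foldl_with_environment[of g x a ys] by simp
    have len: "length (items (h x)) \<le> poly q (tree_size x + B (tree_size x))" for x
    proof -
      have "length (items (h x)) \<le> tree_size (?I x)"
        using length_items_le[of "h x"] by simp
      also have "\<dots> \<le> poly q (tree_size x)" by (rule q(2))
      also have "\<dots> \<le> poly q (tree_size x + B (tree_size x))" by (rule poly_nat_mono) simp
      finally show ?thesis .
    qed
    have time: "fold_time ?G ?T (Node x (i x)) (items (h x))
        \<le> poly (q * (pcompose p ?st + 3) + 1) (tree_size x + B (tree_size x))" for x
    proof -
      let ?m = "tree_size x + B (tree_size x)"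
      have "fold_time ?G ?T (Node x (i x)) (items (h x))
          \<le> length (items (h x)) * (poly (pcompose p ?st) ?m + 3) + 1"
      proof (rule fold_time_le)
        fix ys y zs assume *: "items (h x) = ys @ y # zs"
        have "tree_size y \<le> tree_size (h x)" using * tree_size_item_le[of y "h x"] by simp
        also have "\<dots> \<le> tree_size (?I x)" by simp
        also have "\<dots> \<le> poly q ?m" using q(2)[of x] poly_nat_mono[of "tree_size x" ?m q] by simp
        finally have "tree_size y \<le> poly q ?m" .
        moreover have "tree_size (foldl (g x) (i x) ys) \<le> ?m" using B[OF *] by simp
        ultimately have "tree_size (Node (Node x (foldl (g x) (i x) ys)) y) \<le> poly ?st ?m" by simp
        then show "poly p (tree_size (Node (foldl (\<lambda>a y. ?G (Node a y)) (Node x (i x)) ys) y))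
            \<le> poly (pcompose p ?st) ?m"
          unfolding foldG poly_pcompose by (rule poly_nat_mono)
      qed
      also have "\<dots> \<le> poly q ?m * (poly (pcompose p ?st) ?m + 3) + 1"
        using len[of x] by (intro add_right_mono mult_right_mono) auto
      finally show ?thesis by simp
    qed
    have "computes_within (\<lambda>x. tree_snd (foldl (\<lambda>a y. ?G (Node a y)) (tree_fst (?I x)) (items (tree_snd (?I x)))))
      (\<lambda>x. (poly q (tree_size x) + (fold_time ?G ?T (tree_fst (?I x)) (items (tree_snd (?I x))) + 2)) + 1)"
      by (rule computes_within_compose[OF computes_within_compose[OF q(1) computes_within_fold[OF p]] computes_within_snd])
    then have "computes_within (\<lambda>x. foldl (g x) (i x) (items (h x)))
      (\<lambda>x. (poly q (tree_size x) + (fold_time ?G ?T (Node x (i x)) (items (h x)) + 2)) + 1)"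
      unfolding tree_fst.simps tree_snd.simps foldG[unfolded tree_fst.simps tree_snd.simps] .
    then show ?thesis
    proof (rule computes_within_mono)
      fix x
      let ?m = "tree_size x + B (tree_size x)"
      have "poly q (tree_size x) \<le> poly q ?m" by (rule poly_nat_mono) simp
      then show "(poly q (tree_size x) + (fold_time ?G ?T (Node x (i x)) (items (h x)) + 2)) + 1
          \<le> poly ?r ?m"
        using time[of x] by simp
    qed
  qed
  then show ?thesis by blast
qed

lemma polytime_foldl:
  assumes "polytime (\<lambda>z. g (tree_fst (tree_fst z)) (tree_snd (tree_fst z)) (tree_snd z))" "polytime i" "polytime h"
    and B: "\<And>x ys zs. items (h x) = ys @ zs \<Longrightarrow> tree_size (foldl (g x) (i x) ys) \<le> poly b (tree_size x)"
  shows "polytime (\<lambda>x. foldl (g x) (i x) (items (h x)))"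
proof -
  obtain p where "\<And>B. (\<forall>x ys zs. items (h x) = ys @ zs \<longrightarrow>
      tree_size (foldl (g x) (i x) ys) \<le> B (tree_size x)) \<Longrightarrow>
    computes_within (\<lambda>x. foldl (g x) (i x) (items (h x))) (\<lambda>x. poly p (tree_size x + B (tree_size x)))"
    using computes_within_foldl[of g, OF assms(1,2,3)] by blast
  from this[of "poly b"] B
  have "computes_within (\<lambda>x. foldl (g x) (i x) (items (h x))) (\<lambda>x. poly p (tree_size x + poly b (tree_size x)))" by blast
  \<comment> \<open>The empty suffix turns the bound on intermediate accumulators into a bound on
    the result.\<close>
  then show ?thesis
    by (rule polytime_I[where p = "pcompose p ([:0, 1:] + b)" and q = b])
      (use B[of _ "items (h _)" "[]"] in \<open>auto simp: poly_pcompose\<close>)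
qed

section \<open>Polynomial-time list functions\<close>

definition polytime_nat :: "(tree \<Rightarrow> nat) \<Rightarrow> bool" where
  "polytime_nat h \<longleftrightarrow> polytime (\<lambda>x. enc_nat (h x))"

definition polytime_pred :: "(tree \<Rightarrow> bool) \<Rightarrow> bool" where
  "polytime_pred P \<longleftrightarrow> polytime (\<lambda>x. enc_bool (P x))"

lemma polytime_enc_nat: "polytime_nat h \<Longrightarrow> polytime (\<lambda>x. enc_nat (h x))"
  by (simp add: polytime_nat_def)

lemma polytime_enc_bool: "polytime_pred P \<Longrightarrow> polytime (\<lambda>x. enc_bool (P x))"
  by (simp add: polytime_pred_def)

lemma polytime_size_bound:
  assumes "polytime F"
  obtains p :: "nat poly" where "\<And>x. tree_size (F x) \<le> poly p (tree_size x)"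
  using assms unfolding polytime_def by blast

lemma tree_size_rev_append:
  "tree_size (enc_list (rev ys @ items b)) = tree_size b + (\<Sum>y\<leftarrow>ys. 1 + tree_size y)"
  by (induction ys) (auto simp: tree_size_enc_list tree_size_items[of b])

lemma sum_list_prefix_le:
  assumes "items t = ys @ zs"
  shows "(\<Sum>y\<leftarrow>ys. 1 + tree_size y) \<le> tree_size t"
  by (simp add: tree_size_items[of t] assms)

text \<open>Pushing items one by one onto an accumulator reverses them; append is obtained by
  reversing first.\<close>

lemma polytime_rev_append:
  assumes "polytime f" "polytime g"
  shows "polytime (\<lambda>x. enc_list (rev (items (f x)) @ items (g x)))"
proof -
  obtain p where p: "\<And>x. tree_size (f x) \<le> poly p (tree_size x)" by (rule polytime_size_bound[OF assms(1)]) blast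
  obtain q where q: "\<And>x. tree_size (g x) \<le> poly q (tree_size x)" by (rule polytime_size_bound[OF assms(2)]) blast
  have fold: "foldl (\<lambda>a y. Node y a) b ys = enc_list (rev ys @ items b)" for b ys
    by (induction ys arbitrary: b) auto
  have "polytime (\<lambda>x. foldl (\<lambda>a y. Node y a) (g x) (items (f x)))"
  proof (rule polytime_foldl[where g = "\<lambda>_ a y. Node y a", OF _ assms(2,1), where b = "p + q"])
    show "polytime (\<lambda>z. Node (tree_snd z) (tree_snd (tree_fst z)))"
      by (intro polytime_Node polytime_snd polytime_fst polytime_id)
    fix x ys zs assume "items (f x) = ys @ zs"
    then show "tree_size (foldl (\<lambda>a y. Node y a) (g x) ys) \<le> poly (p + q) (tree_size x)"
      using sum_list_prefix_le[of "f x" ys zs] p[of x] q[of x]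
      by (simp add: fold tree_size_rev_append)
  qed
  then show ?thesis by (simp add: fold)
qed

lemma polytime_rev: "polytime f \<Longrightarrow> polytime (\<lambda>x. enc_list (rev (items (f x))))"
  using polytime_rev_append[OF _ polytime_const[of Leaf]] by simp

lemma polytime_append:
  assumes "polytime f" "polytime g"
  shows "polytime (\<lambda>x. enc_list (items (f x) @ items (g x)))"
  using polytime_rev_append[OF polytime_rev[OF assms(1)] assms(2)] by simp

lemma tree_size_enc_list_concat:
  "tree_size (enc_list (concat (map (\<lambda>y. items (g y)) ys))) \<le> 1 + (\<Sum>y\<leftarrow>ys. tree_size (g y))"
proof (induction ys)
  case (Cons y ys)
  then show ?case using tree_size_items[of "g y"] by (simp add: tree_size_enc_list)
qed simp

text \<open>The workhorse for bounded constructions: filters, sums and existential quantifiers are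
  derived from it. The fold prepends reversed pieces, so its result is reversed once at the
  end.\<close>

lemma polytime_concat_map:
  assumes g: "polytime (\<lambda>z. g (tree_fst z) (tree_snd z))" and h: "polytime h"
  shows "polytime (\<lambda>x. enc_list (concat (map (\<lambda>y. items (g x y)) (items (h x)))))"
proof -
  obtain p where p: "\<And>z. tree_size (g (tree_fst z) (tree_snd z)) \<le> poly p (tree_size z)"
    by (rule polytime_size_bound[OF g]) blast
  obtain q where q: "\<And>x. tree_size (h x) \<le> poly q (tree_size x)" by (rule polytime_size_bound[OF h]) blast
  let ?step = "\<lambda>x a y. enc_list (rev (items (g x y)) @ items a)"
  have fold: "foldl (?step x) Leaf ys = enc_list (rev (concat (map (\<lambda>y. items (g x y)) ys)))" for x ys
    by (induction ys rule: rev_induct) auto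
  have size_rev: "tree_size (enc_list (rev ys)) = tree_size (enc_list ys)" for ys
    by (induction ys) (auto simp: tree_size_enc_list)
  let ?b = "1 + q * pcompose p ([:1, 1:] + q)"
  have "polytime (\<lambda>z. g (tree_fst (Node (tree_fst (tree_fst z)) (tree_snd z)))
      (tree_snd (Node (tree_fst (tree_fst z)) (tree_snd z))))"
    by (rule polytime_compose[OF _ g]) (intro polytime_Node polytime_fst polytime_snd polytime_id)
  then have g': "polytime (\<lambda>z. g (tree_fst (tree_fst z)) (tree_snd z))" by simp
  have "polytime (\<lambda>x. foldl (?step x) Leaf (items (h x)))"
  proof (rule polytime_foldl[where g = ?step, OF _ polytime_const h, where b = ?b])
    show "polytime (\<lambda>z. enc_list (rev (items (g (tree_fst (tree_fst z)) (tree_snd z))) @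
        items (tree_snd (tree_fst z))))"
      by (intro polytime_rev_append g' polytime_snd polytime_fst polytime_id)
    fix x ys zs assume ys: "items (h x) = ys @ zs"
    have "tree_size (foldl (?step x) Leaf ys) \<le> 1 + (\<Sum>y\<leftarrow>ys. tree_size (g x y))"
      unfolding fold size_rev by (rule tree_size_enc_list_concat)
    also have "(\<Sum>y\<leftarrow>ys. tree_size (g x y)) \<le> (\<Sum>y\<leftarrow>ys. poly (pcompose p ([:1, 1:] + q)) (tree_size x))"
    proof (rule sum_list_mono)
      fix y assume "y \<in> set ys"
      then have "tree_size y \<le> tree_size (h x)" using ys tree_size_item_le[of y "h x"] by simp
      then have "tree_size (Node x y) \<le> poly ([:1, 1:] + q) (tree_size x)" using q[of x] by simp
      then show "tree_size (g x y) \<le> poly (pcompose p ([:1, 1:] + q)) (tree_size x)"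
        using order_trans[OF p[of "Node x y"] poly_nat_mono] unfolding poly_pcompose by simp
    qed
    also have "\<dots> = length ys * poly (pcompose p ([:1, 1:] + q)) (tree_size x)"
      by (simp add: sum_list_triv)
    also have "\<dots> \<le> poly q (tree_size x) * poly (pcompose p ([:1, 1:] + q)) (tree_size x)"
      using length_items_le[of "h x"] ys q[of x] by (intro mult_right_mono) auto
    finally show "tree_size (foldl (?step x) Leaf ys) \<le> poly ?b (tree_size x)" by simp
  qed
  then show ?thesis using polytime_rev[of "\<lambda>x. foldl (?step x) Leaf (items (h x))"] by (simp add: fold)
qed

lemma polytime_nat_nat_of:
  assumes "polytime f"
  shows "polytime_nat (\<lambda>x. nat_of (f x))"
proof -
  obtain p where p: "\<And>x. tree_size (f x) \<le> poly p (tree_size x)" by (rule polytime_size_bound[OF assms(1)]) blast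
  have fold: "foldl (\<lambda>a y. Node Leaf a) Leaf ys = enc_nat (length ys)" for ys :: "tree list"
    by (induction ys rule: rev_induct) auto
  have "polytime (\<lambda>x. foldl (\<lambda>a y. Node Leaf a) Leaf (items (f x)))"
  proof (rule polytime_foldl[where g = "\<lambda>_ a y. Node Leaf a", OF _ polytime_const assms, where b = "2 * p + 1"])
    show "polytime (\<lambda>z. Node Leaf (tree_snd (tree_fst z)))"
      by (intro polytime_Node polytime_snd polytime_fst polytime_id polytime_const)
    fix x ys zs assume "items (f x) = ys @ zs"
    then show "tree_size (foldl (\<lambda>a y. Node Leaf a) Leaf ys) \<le> poly (2 * p + 1) (tree_size x)"
      using length_items_le[of "f x"] p[of x] by (simp add: fold)
  qed
  then show ?thesis by (simp add: fold polytime_nat_def nat_of_def)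
qed

text \<open>A unary number drives the loop, and \<open>tree_snd\<close> removes one item per round.
  It fixes \<open>Leaf\<close>, so running past the end is harmless.\<close>

lemma polytime_drop:
  assumes "polytime f" "polytime_nat n"
  shows "polytime (\<lambda>x. enc_list (drop (n x) (items (f x))))"
proof -
  obtain p where p: "\<And>x. tree_size (f x) \<le> poly p (tree_size x)" by (rule polytime_size_bound[OF assms(1)]) blast
  have fold: "foldl (\<lambda>a y. tree_snd a) b ys = enc_list (drop (length ys) (items b))" for b and ys :: "tree list"
  proof (induction ys arbitrary: b)
    case (Cons y ys) then show ?case by (cases b) auto
  qed simp
  have size: "tree_size (enc_list (drop m xs)) \<le> tree_size (enc_list xs)" for m xs
    by (induction xs arbitrary: m) (auto simp: drop_Cons' intro: le_SucI trans_le_add2)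
  have "polytime (\<lambda>x. foldl (\<lambda>a y. tree_snd a) (f x) (items (enc_nat (n x))))"
  proof (rule polytime_foldl[where g = "\<lambda>_ a y. tree_snd a", OF _ assms(1) assms(2)[unfolded polytime_nat_def], where b = p])
    show "polytime (\<lambda>z. tree_snd (tree_snd (tree_fst z)))"
      by (intro polytime_snd polytime_fst polytime_id)
    fix x ys zs assume "items (enc_nat (n x)) = ys @ zs"
    show "tree_size (foldl (\<lambda>a y. tree_snd a) (f x) ys) \<le> poly p (tree_size x)"
      using order_trans[OF size[of "length ys" "items (f x)"]] p[of x] by (simp add: fold)
  qed
  then show ?thesis by (simp add: fold)
qed

definition item :: "nat \<Rightarrow> tree \<Rightarrow> tree" where
  "item n t = tree_fst (enc_list (drop n (items t)))"

lemma item_eq: "item n t = (if n < length (items t) then items t ! n else Leaf)"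
  unfolding item_def by (auto simp flip: Cons_nth_drop_Suc)

lemma item_enc_list: "item n (enc_list xs) = (if n < length xs then xs ! n else Leaf)"
  by (simp add: item_eq)

lemma polytime_item: "polytime_nat n \<Longrightarrow> polytime f \<Longrightarrow> polytime (\<lambda>x. item (n x) (f x))"
  unfolding item_def by (intro polytime_fst polytime_drop)

lemma polytime_upt:
  assumes "polytime_nat n"
  shows "polytime (\<lambda>x. enc_list (map enc_nat [0..<n x]))"
proof -
  obtain p where p: "\<And>x. tree_size (enc_nat (n x)) \<le> poly p (tree_size x)"
    by (rule polytime_size_bound[OF assms[unfolded polytime_nat_def]]) blast
  \<comment> \<open>The accumulator is the descending list of the numbers produced so far, so its
    length is the next number.\<close>
  let ?step = "\<lambda>a (y :: tree). Node (enc_nat (nat_of a)) a"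
  have fold: "foldl ?step Leaf ys = enc_list (map enc_nat (rev [0..<length ys]))" for ys
    by (induction ys rule: rev_induct) (auto simp: nat_of_def)
  have size: "tree_size (enc_list (map enc_nat (rev [0..<m]))) \<le> 1 + m * (2 * m + 2)" for m
    by (induction m) auto
  have "polytime (\<lambda>x. foldl ?step Leaf (items (enc_nat (n x))))"
  proof (rule polytime_foldl[where g = "\<lambda>_. ?step", OF _ polytime_const assms[unfolded polytime_nat_def], where b = "1 + p * (2 * p + 2)"])
    show "polytime (\<lambda>z. Node (enc_nat (nat_of (tree_snd (tree_fst z)))) (tree_snd (tree_fst z)))"
      by (intro polytime_Node polytime_enc_nat polytime_nat_nat_of polytime_snd polytime_fst polytime_id)
    fix x ys zs assume "items (enc_nat (n x)) = ys @ zs"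
    then have "length ys \<le> n x"
      by (metis items_enc_nat length_append length_replicate le_add1)
    then have le: "length ys \<le> poly p (tree_size x)" using p[of x] by simp
    have "tree_size (foldl ?step Leaf ys) \<le> 1 + length ys * (2 * length ys + 2)"
      unfolding fold by (rule size)
    also have "\<dots> \<le> 1 + poly p (tree_size x) * (2 * poly p (tree_size x) + 2)"
      using le by (intro add_mono mult_mono) auto
    finally show "tree_size (foldl ?step Leaf ys) \<le> poly (1 + p * (2 * p + 2)) (tree_size x)" by simp
  qed
  then show ?thesis using polytime_rev[of "\<lambda>x. foldl ?step Leaf (items (enc_nat (n x)))"]
    by (simp add: fold flip: rev_map)
qed

section \<open>Predicates and unary arithmetic in polynomial time\<close>

lemma polytime_if:
  assumes "polytime_pred P" "polytime f" "polytime g"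
  shows "polytime (\<lambda>x. if P x then f x else g x)"
proof -
  have "enc_bool b \<noteq> Leaf \<longleftrightarrow> b" for b by (cases b) auto
  then show ?thesis using polytime_if_Leaf[OF assms(1)[unfolded polytime_pred_def] assms(2,3)] by simp
qed

lemma polytime_nat_if: "polytime_pred P \<Longrightarrow> polytime_nat f \<Longrightarrow> polytime_nat g \<Longrightarrow> polytime_nat (\<lambda>x. if P x then f x else g x)"
  unfolding polytime_nat_def if_distrib[of enc_nat] by (rule polytime_if)

lemma polytime_pred_const: "polytime_pred (\<lambda>_. b)"
  unfolding polytime_pred_def by (rule polytime_const)

lemma polytime_pred_not_Leaf: 
  assumes "polytime f"
  shows "polytime_pred (\<lambda>x. f x \<noteq> Leaf)"
proof -
  have "enc_bool (f x \<noteq> Leaf) = (if f x \<noteq> Leaf then enc_bool True else enc_bool False)" for x by simp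
  then show ?thesis unfolding polytime_pred_def
    using polytime_if_Leaf[OF assms polytime_const[of "enc_bool True"] polytime_const[of "enc_bool False"]] by simp
qed

lemma polytime_pred_not:
  assumes "polytime_pred P" shows "polytime_pred (\<lambda>x. \<not> P x)"
proof -
  have "enc_bool (\<not> P x) = (if P x then enc_bool False else enc_bool True)" for x by simp
  then show ?thesis unfolding polytime_pred_def using polytime_if[OF assms polytime_const[of "enc_bool False"] polytime_const[of "enc_bool True"]] by simp
qed

lemma polytime_pred_conj:
  assumes "polytime_pred P" "polytime_pred Q" shows "polytime_pred (\<lambda>x. P x \<and> Q x)"
proof -
  have "enc_bool (P x \<and> Q x) = (if P x then enc_bool (Q x) else enc_bool False)" for x by simp
  then show ?thesis unfolding polytime_pred_def using polytime_if[OF assms(1) assms(2)[unfolded polytime_pred_def] polytime_const[of "enc_bool False"]] by simp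
qed

lemma polytime_pred_disj:
  assumes "polytime_pred P" "polytime_pred Q" shows "polytime_pred (\<lambda>x. P x \<or> Q x)"
proof -
  have "polytime_pred (\<lambda>x. \<not> (\<not> P x \<and> \<not> Q x))" by (intro polytime_pred_not polytime_pred_conj assms)
  then show ?thesis by simp
qed

lemma polytime_pred_imp:
  assumes "polytime_pred P" "polytime_pred Q" shows "polytime_pred (\<lambda>x. P x \<longrightarrow> Q x)"
  unfolding imp_conv_disj by (intro polytime_pred_disj polytime_pred_not assms)

lemma enc_list_eq_Leaf_iff: "enc_list xs = Leaf \<longleftrightarrow> xs = []"
  by (cases xs) auto

lemma less_iff_drop: "m < n \<longleftrightarrow> enc_list (drop m (items (enc_nat n))) \<noteq> Leaf"
  unfolding enc_list_eq_Leaf_iff by (simp add: not_le)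

lemma polytime_pred_less:
  assumes "polytime_nat m" "polytime_nat n" shows "polytime_pred (\<lambda>x. m x < n x)"
  using polytime_pred_not_Leaf[OF polytime_drop[OF polytime_enc_nat[OF assms(2)] assms(1)]] unfolding less_iff_drop .

lemma polytime_pred_le:
  assumes "polytime_nat m" "polytime_nat n" shows "polytime_pred (\<lambda>x. m x \<le> n x)"
  unfolding not_less[symmetric] by (intro polytime_pred_not polytime_pred_less assms)

lemma polytime_pred_eq:
  assumes "polytime_nat m" "polytime_nat n" shows "polytime_pred (\<lambda>x. m x = n x)"
  unfolding eq_iff by (intro polytime_pred_conj polytime_pred_le assms)

lemma polytime_nat_const: "polytime_nat (\<lambda>_. c)"
  unfolding polytime_nat_def by (rule polytime_const)

lemma polytime_nat_Suc:
  assumes "polytime_nat m" shows "polytime_nat (\<lambda>x. Suc (m x))"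
  unfolding polytime_nat_def enc_nat.simps by (intro polytime_Node polytime_const assms[unfolded polytime_nat_def])

text \<open>Unary addition is concatenation, so a bounded sum is a concatenated map. The summand
  finds its index in the second component of a pair and its environment in the first.\<close>

lemma polytime_nat_sum:
  assumes h: "polytime_nat (\<lambda>z. h (tree_fst z) (nat_of (tree_snd z)))" and n: "polytime_nat n"
  shows "polytime_nat (\<lambda>x. \<Sum>i<n x. h x i)"
proof -
  have eq: "enc_list (concat (map (\<lambda>y. items (enc_nat (h x (nat_of y))))
      (items (enc_list (map enc_nat [0..<m]))))) = enc_nat (\<Sum>i<m. h x i)" for x m
    by (induction m) (auto simp: enc_nat_eq_enc_list[of "sum _ _"] enc_nat_eq_enc_list[of "_ + _"] replicate_add comp_def)
  show ?thesis
    using polytime_concat_map[where g = "\<lambda>x y. enc_nat (h x (nat_of y))", OF h[unfolded polytime_nat_def] polytime_upt[OF n]]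
    unfolding eq polytime_nat_def .
qed

lemma polytime_nat_add:
  assumes "polytime_nat m" "polytime_nat n" shows "polytime_nat (\<lambda>x. m x + n x)"
proof -
  have "enc_nat (m x + n x) = enc_list (items (enc_nat (m x)) @ items (enc_nat (n x)))" for x
    by (simp add: enc_nat_eq_enc_list replicate_add)
  then show ?thesis unfolding polytime_nat_def
    using polytime_append[OF assms[unfolded polytime_nat_def]] by simp
qed

lemma polytime_nat_mult:
  assumes "polytime_nat m" "polytime_nat n" shows "polytime_nat (\<lambda>x. m x * n x)"
proof -
  have "polytime_nat (\<lambda>x. \<Sum>i<m x. n x)"
    by (rule polytime_nat_sum[OF _ assms(1)])
      (use polytime_compose[OF polytime_fst[OF polytime_id] assms(2)[unfolded polytime_nat_def]] in \<open>simp add: polytime_nat_def\<close>)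
  then show ?thesis by simp
qed

lemma polytime_nat_of_bool:
  assumes "polytime_pred P" shows "polytime_nat (\<lambda>x. of_bool (P x))"
  using polytime_nat_if[OF assms polytime_nat_const[of 1] polytime_nat_const[of 0]] by (simp add: of_bool_def)

text \<open>Singletons for accepted indices and empty lists for the others turn map and filter into
  one concatenation.\<close>

lemma polytime_map_filter_upt:
  assumes P: "polytime_pred (\<lambda>z. P (tree_fst z) (nat_of (tree_snd z)))"
    and g: "polytime (\<lambda>z. g (tree_fst z) (nat_of (tree_snd z)))" and n: "polytime_nat n"
  shows "polytime (\<lambda>x. enc_list (map (g x) (filter (P x) [0..<n x])))"
proof -
  let ?g = "\<lambda>x y. if P x (nat_of y) then Node (g x (nat_of y)) Leaf else Leaf"
  have eq: "concat (map (\<lambda>y. items (?g x y)) (items (enc_list (map enc_nat [0..<m]))))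
      = map (g x) (filter (P x) [0..<m])" for x m
    by (induction m) (auto simp: comp_def)
  have "polytime (\<lambda>x. enc_list (concat (map (\<lambda>y. items (?g x y)) (items (enc_list (map enc_nat [0..<n x]))))))"
    by (intro polytime_concat_map polytime_upt n polytime_if P polytime_Node g polytime_const)
  then show ?thesis unfolding eq .
qed

lemma polytime_pred_ex_items:
  assumes P: "polytime_pred (\<lambda>z. P (tree_fst z) (tree_snd z))" and h: "polytime h"
  shows "polytime_pred (\<lambda>x. \<exists>y\<in>set (items (h x)). P x y)"
proof -
  let ?g = "\<lambda>x y. if P x y then Node Leaf Leaf else Leaf"
  have eq: "enc_list (concat (map (\<lambda>y. items (?g x y)) ys)) \<noteq> Leaf \<longleftrightarrow> (\<exists>y\<in>set ys. P x y)" for x ys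
    by (induction ys) auto
  have "polytime_pred (\<lambda>x. enc_list (concat (map (\<lambda>y. items (?g x y)) (items (h x)))) \<noteq> Leaf)"
    by (intro polytime_pred_not_Leaf polytime_concat_map h polytime_if P polytime_Node polytime_const)
  then show ?thesis unfolding eq .
qed

lemma polytime_pred_ex:
  assumes P: "polytime_pred (\<lambda>z. P (tree_fst z) (nat_of (tree_snd z)))" and n: "polytime_nat n"
  shows "polytime_pred (\<lambda>x. \<exists>i<n x. P x i)"
proof -
  have "(\<exists>i<n x. P x i) \<longleftrightarrow> (\<exists>y\<in>set (items (enc_list (map enc_nat [0..<n x]))). P x (nat_of y))" for x
    by auto
  then show ?thesis using polytime_pred_ex_items[where P = "\<lambda>x y. P x (nat_of y)", OF P polytime_upt[OF n]] by simp
qed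

lemma polytime_pred_all:
  assumes P: "polytime_pred (\<lambda>z. P (tree_fst z) (nat_of (tree_snd z)))" and n: "polytime_nat n"
  shows "polytime_pred (\<lambda>x. \<forall>i<n x. P x i)"
  using polytime_pred_not[OF polytime_pred_ex[where P = "\<lambda>x i. \<not> P x i", OF polytime_pred_not[OF P] n]] by simp

text \<open>Binders become pairs: each quantifier or sum moves its environment to
  \<open>tree_fst\<close> and its index to \<open>tree_snd\<close>. Hence \<open>intro\<close> can
  follow the syntax of a definition, nested binders included.\<close>

lemmas polytime_intros = polytime_id polytime_const polytime_fst polytime_snd polytime_Node polytime_if polytime_enc_nat polytime_enc_bool polytime_item
  polytime_map_filter_upt polytime_nat_nat_of polytime_nat_const polytime_nat_Suc polytime_nat_add polytime_nat_mult polytime_nat_sum polytime_nat_of_bool polytime_nat_if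
  polytime_pred_not polytime_pred_conj polytime_pred_disj polytime_pred_imp polytime_pred_less polytime_pred_le polytime_pred_eq polytime_pred_ex polytime_pred_all polytime_pred_ex_items polytime_pred_const

section \<open>Induced matchings in graphs with few four-cycles\<close>

text \<open>Greedy choice: each chosen element rules out itself and at most \<open>d\<close> others,
  so it costs \<open>d + 1\<close> elements of \<open>S\<close>.\<close>

lemma exists_independent_subset:
  assumes "finite S" "(d + 1) * m \<le> card S"
    and "\<And>x. x \<in> S \<Longrightarrow> card {y \<in> S. y \<noteq> x \<and> R x y} \<le> d"
    and "\<And>x y. R x y \<Longrightarrow> R y x"
  shows "\<exists>I\<subseteq>S. card I = m \<and> (\<forall>x\<in>I. \<forall>y\<in>I. x \<noteq> y \<longrightarrow> \<not> R x y)"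
  using assms(1-3)
proof (induction m arbitrary: S)
  case 0
  then show ?case by (intro exI[of _ "{}"]) auto
next
  case (Suc m)
  then have "S \<noteq> {}" by auto
  then obtain x where x: "x \<in> S" by blast
  let ?N = "{y \<in> S. y \<noteq> x \<and> R x y}"
  let ?S = "S - insert x ?N"
  have "card (insert x ?N) \<le> d + 1"
    using Suc.prems(1) Suc.prems(3)[OF x] by (simp add: card_insert_if)
  then have "card S \<le> card ?S + (d + 1)"
    using Suc.prems(1) diff_card_le_card_Diff[of "insert x ?N" S] by simp
  then have "(d + 1) * m \<le> card ?S" using Suc.prems(2) by simp
  moreover have "card {y \<in> ?S. y \<noteq> z \<and> R z y} \<le> d" if "z \<in> ?S" for z
  proof -
    have "card {y \<in> ?S. y \<noteq> z \<and> R z y} \<le> card {y \<in> S. y \<noteq> z \<and> R z y}"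
      using Suc.prems(1) by (intro card_mono) auto
    also have "\<dots> \<le> d" using Suc.prems(3) that by blast
    finally show ?thesis .
  qed
  ultimately obtain I where I: "I \<subseteq> ?S" "card I = m" "\<forall>x\<in>I. \<forall>y\<in>I. x \<noteq> y \<longrightarrow> \<not> R x y"
    using Suc.IH[of ?S] Suc.prems(1) by (auto simp del: insert_iff)
  have "finite I" using I(1) Suc.prems(1) by (meson finite_Diff finite_subset)
  then have "card (insert x I) = Suc m" using I(1,2) by (subst card_insert_disjoint) auto
  moreover have "\<forall>u\<in>insert x I. \<forall>v\<in>insert x I. u \<noteq> v \<longrightarrow> \<not> R u v"
    using I(1,3) assms(4) by blast
  ultimately show ?case using I(1) x by (intro exI[of _ "insert x I"]) auto
qed

lemma card_le_1I: "(\<And>x y. x \<in> A \<Longrightarrow> y \<in> A \<Longrightarrow> x = y) \<Longrightarrow> card A \<le> 1"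
proof (cases "A = {}")
  case False
  assume *: "\<And>x y. x \<in> A \<Longrightarrow> y \<in> A \<Longrightarrow> x = y"
  obtain a where "a \<in> A" using False by blast
  then have "A = {a}" using * by blast
  then show ?thesis by simp
qed simp

text \<open>A relation instead of an edge set lets the same lemmas apply to a graph and to its
  reduction.\<close>

locale adjacency =
  fixes V :: "'a set" and adj :: "'a \<Rightarrow> 'a \<Rightarrow> bool"
  assumes finite_V: "finite V"
    and adj_V: "adj a b \<Longrightarrow> a \<in> V"
    and adj_sym: "adj a b \<Longrightarrow> adj b a"
    and adj_irrefl: "\<not> adj a a"
begin

text \<open>Every 4-cycle is counted eight times.\<close>

definition quads :: "('a \<times> 'a \<times> 'a \<times> 'a) set" where
  "quads = {(a, b, c, d). a \<noteq> c \<and> b \<noteq> d \<and> adj a b \<and> adj b c \<and> adj c d \<and> adj d a}"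

definition arcs :: "('a \<times> 'a) set" where
  "arcs = {(a, b). adj a b}"

definition clash :: "'a \<times> 'a \<Rightarrow> 'a \<times> 'a \<Rightarrow> bool" where
  "clash e f \<longleftrightarrow> (\<exists>x\<in>{fst e, snd e}. \<exists>y\<in>{fst f, snd f}. x = y \<or> adj x y)"

text \<open>An arc clashes with its reversal, so pairwise nonclashing arcs use every edge in at most
  one direction and amount to an induced matching.\<close>

definition has_induced :: "nat \<Rightarrow> bool" where
  "has_induced k \<longleftrightarrow> (\<exists>I\<subseteq>arcs. card I = k \<and> (\<forall>e\<in>I. \<forall>f\<in>I. e \<noteq> f \<longrightarrow> \<not> clash e f))"

lemma finite_quads: "finite quads"
  by (rule finite_subset[of _ "V \<times> V \<times> V \<times> V"]) (auto simp: quads_def finite_V intro: adj_V)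

lemma finite_arcs: "finite arcs"
  by (rule finite_subset[of _ "V \<times> V"]) (auto simp: arcs_def finite_V intro: adj_V adj_sym)

lemma finite_neighbours: "finite {u. adj v u}"
  by (rule finite_subset[OF _ finite_V]) (auto intro: adj_V adj_sym)

text \<open>Outside the 4-cycles, either some neighbourhood is large, and it induces a graph of maximum
  degree one, or all degrees are small and a greedy choice succeeds.\<close>

lemma independent_set:
  assumes S: "S \<subseteq> V" and card: "card quads + 2 * m * m \<le> card S"
  shows "\<exists>I\<subseteq>S. card I = m \<and> (\<forall>x\<in>I. \<forall>y\<in>I. x \<noteq> y \<longrightarrow> \<not> adj x y)"
proof (cases "m = 0")
  case True then show ?thesis by (intro exI[of _ "{}"]) auto
next
  case False
  \<comment> \<open>\<open>quads\<close> is closed under rotation, so the second coordinates are all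
    vertices on 4-cycles.\<close>
  define B where "B = (\<lambda>(a, b, c, d). b) ` quads"
  have B: "card B \<le> card quads" unfolding B_def by (rule card_image_le[OF finite_quads])
  have finB: "finite B" unfolding B_def using finite_quads by simp
  define S' where "S' = S - B"
  have finS: "finite S'" unfolding S'_def using S finite_V finite_subset by blast
  have "card S - card B \<le> card S'" unfolding S'_def by (rule diff_card_le_card_Diff[OF finB])
  then have cardS': "2 * m * m \<le> card S'" using B card by linarith
  have "\<exists>I\<subseteq>S'. card I = m \<and> (\<forall>x\<in>I. \<forall>y\<in>I. x \<noteq> y \<longrightarrow> \<not> adj x y)"
  proof (cases "\<exists>x\<in>S'. 2 * m \<le> card {y \<in> S'. adj x y}")
    case True
    then obtain x where x: "x \<in> S'" "2 * m \<le> card {y \<in> S'. adj x y}" by blast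
    let ?N = "{y \<in> S'. adj x y}"
    have "\<exists>I\<subseteq>?N. card I = m \<and> (\<forall>x\<in>I. \<forall>y\<in>I. x \<noteq> y \<longrightarrow> \<not> adj x y)"
    proof (rule exists_independent_subset[where d = 1])
      fix u assume u: "u \<in> ?N"
      show "card {y \<in> ?N. y \<noteq> u \<and> adj u y} \<le> 1"
      proof (rule card_le_1I, rule ccontr)
        fix y z assume yz: "y \<in> {y \<in> ?N. y \<noteq> u \<and> adj u y}" "z \<in> {y \<in> ?N. y \<noteq> u \<and> adj u y}" "y \<noteq> z"
        \<comment> \<open>Two neighbours \<open>y\<close>, \<open>z\<close> of \<open>u\<close>
          inside the neighbourhood of \<open>x\<close> close a 4-cycle, whose vertices
          \<open>B\<close> has taken out.\<close>
        then have "(x, y, u, z) \<in> quads"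
          using u adj_irrefl by (auto simp: quads_def intro: adj_sym)
        then have "y \<in> B" unfolding B_def by force
        then show False using yz unfolding S'_def by blast
      qed
    qed (use finS x in \<open>auto intro: adj_sym\<close>)
    then show ?thesis by blast
  next
    case False
    show ?thesis
    \<comment> \<open>Each choice costs \<open>2 * m\<close> vertices here, which is the origin of
      the term \<open>2 * m * m\<close>.\<close>
    proof (rule exists_independent_subset[where d = "2 * m - 1"])
      show "(2 * m - 1 + 1) * m \<le> card S'" using cardS' \<open>m \<noteq> 0\<close> by simp
      fix x assume "x \<in> S'"
      then have "card {y \<in> S'. adj x y} \<le> 2 * m - 1" using False by force
      moreover have "{y \<in> S'. y \<noteq> x \<and> adj x y} = {y \<in> S'. adj x y}" using adj_irrefl by auto
      ultimately show "card {y \<in> S'. y \<noteq> x \<and> adj x y} \<le> 2 * m - 1" by simp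
    qed (use finS in \<open>auto intro: adj_sym\<close>)
  qed
  then show ?thesis unfolding S'_def by blast
qed

text \<open>Discarding the few neighbours of \<open>v\<close> that lie on a 4-cycle with \<open>v\<close>, every other neighbour \<open>u\<close>
  has a private second neighbour \<open>f u\<close>.  Two edges \<open>{u, f u}\<close> can only clash if the two vertices \<open>u\<close>
  or the two vertices \<open>f u\<close> are adjacent.\<close>

lemma has_induced_if_high_degree:
  assumes pendant: "card {u. adj v u \<and> (\<forall>w. adj u w \<longrightarrow> w = v)} \<le> 1"
    and deg: "1 + 2 * card quads + 8 * k * k \<le> card {u. adj v u}"
  shows "has_induced k"
proof -
  define B where "B = (\<lambda>(a, b, c, d). b) ` quads"
  have B: "card B \<le> card quads" unfolding B_def by (rule card_image_le[OF finite_quads])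
  have finB: "finite B" unfolding B_def using finite_quads by simp
  define P where "P = {u. adj v u \<and> (\<forall>w. adj u w \<longrightarrow> w = v)}"
  have finP: "finite P" unfolding P_def using finite_neighbours[of v] by (rule rev_finite_subset) auto
  define A where "A = {u. adj v u} - (B \<union> P)"
  have "card (B \<union> P) \<le> card quads + 1"
    using card_Un_le[of B P] B pendant unfolding P_def by linarith
  moreover have "card {u. adj v u} - card (B \<union> P) \<le> card A"
    unfolding A_def using finB finP by (intro diff_card_le_card_Diff) auto
  \<comment> \<open>The assumed degree pays 1 for \<open>P\<close> and \<open>card quads\<close> for
    \<open>B\<close>, and leaves the \<open>card quads + 8 * k * k\<close> that
    \<open>independent_set\<close> requires for \<open>2 * k\<close> vertices.\<close>
  ultimately have cardA: "card quads + 2 * (2 * k) * (2 * k) \<le> card A" using deg by simp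
  have "\<forall>u\<in>A. \<exists>w. adj u w \<and> w \<noteq> v" unfolding A_def P_def by blast
  then obtain f where f: "\<And>u. u \<in> A \<Longrightarrow> adj u (f u)" "\<And>u. u \<in> A \<Longrightarrow> f u \<noteq> v" by metis
  \<comment> \<open>A common neighbour \<open>w\<close> of \<open>u\<close> and \<open>u'\<close>
    other than \<open>v\<close> closes the 4-cycle \<open>v, u, w, u'\<close>, which puts
    \<open>u\<close> into \<open>B\<close>.\<close>
  have common: "\<not> adj u' w" if "u \<in> A" "u' \<in> A" "u \<noteq> u'" "w \<noteq> v" "adj u w" for u u' w
  proof
    assume "adj u' w"
    then have "(v, u, w, u') \<in> quads" using that unfolding quads_def A_def by (auto intro: adj_sym)
    then have "u \<in> B" unfolding B_def by force
    then show False using that(1) unfolding A_def by blast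
  qed
  have inj: "inj_on f A" using common f by (metis inj_onI)
  have "f ` A \<subseteq> V" using f(1) adj_sym adj_V by blast
  moreover have "card (f ` A) = card A" using inj by (rule card_image)
  \<comment> \<open>Twice \<open>k\<close> vertices are taken because adjacencies among the first
    neighbours may halve the choice afterwards.\<close>
  ultimately obtain T where T: "T \<subseteq> f ` A" "card T = 2 * k"
      "\<And>x y. x \<in> T \<Longrightarrow> y \<in> T \<Longrightarrow> x \<noteq> y \<Longrightarrow> \<not> adj x y"
    using independent_set[of "f ` A" "2 * k"] cardA by metis
  obtain D where D: "D \<subseteq> A" "T = f ` D" using T(1) by (meson subset_imageE)
  have injD: "inj_on f D" using inj D(1) inj_on_subset by blast
  have cardD: "card D = 2 * k" using T(2) D(2) card_image[OF injD] by simp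
  have finD: "finite D" using D(1) unfolding A_def using finite_neighbours[of v] by (meson finite_Diff finite_subset)
  have "\<exists>I\<subseteq>D. card I = k \<and> (\<forall>x\<in>I. \<forall>y\<in>I. x \<noteq> y \<longrightarrow> \<not> adj x y)"
  proof (rule exists_independent_subset[where d = 1])
    fix u assume u: "u \<in> D"
    then have "u \<noteq> v" using D(1) adj_irrefl unfolding A_def by auto
    show "card {y \<in> D. y \<noteq> u \<and> adj u y} \<le> 1"
    proof (rule card_le_1I, rule ccontr)
      fix y z assume "y \<in> {y \<in> D. y \<noteq> u \<and> adj u y}" "z \<in> {y \<in> D. y \<noteq> u \<and> adj u y}" "y \<noteq> z"
      \<comment> \<open>Two neighbours \<open>y\<close>, \<open>z\<close> of \<open>u\<close> in
        \<open>D\<close> would have the common neighbour \<open>u\<close> besides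
        \<open>v\<close>.\<close>
      then show False using common[of y z u] \<open>u \<noteq> v\<close> D(1) adj_sym by blast
    qed
  qed (use finD cardD in \<open>auto intro: adj_sym\<close>)
  then obtain I where I: "I \<subseteq> D" "card I = k" "\<And>x y. x \<in> I \<Longrightarrow> y \<in> I \<Longrightarrow> x \<noteq> y \<Longrightarrow> \<not> adj x y" by metis
  have no_clash: "\<not> clash (u, f u) (u', f u')" if "u \<in> I" "u' \<in> I" "u \<noteq> u'" for u u'
  proof -
    have A: "u \<in> A" "u' \<in> A" using that I(1) D(1) by auto
    have "\<not> adj u u'" "\<not> adj u' u" using I(3) that by auto
    moreover have "u \<noteq> f u'" "f u \<noteq> u'" using calculation f(1)[OF A(1)] f(1)[OF A(2)] by auto
    moreover have "f u \<noteq> f u'" using inj A that(3) by (auto dest: inj_onD)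
    moreover have "\<not> adj (f u) (f u')" using T(3) \<open>f u \<noteq> f u'\<close> D(2) I(1) that by blast
    moreover have "\<not> adj u (f u')" using common[OF A(2) A(1)] f A that(3) by metis
    moreover have "\<not> adj (f u) u'" using common[OF A] f A that(3) adj_sym by metis
    ultimately show ?thesis using that(3) unfolding clash_def by auto
  qed
  show ?thesis unfolding has_induced_def
  proof (intro exI[of _ "(\<lambda>u. (u, f u)) ` I"] conjI)
    show "(\<lambda>u. (u, f u)) ` I \<subseteq> arcs" using I(1) D(1) f(1) unfolding arcs_def by auto
    show "card ((\<lambda>u. (u, f u)) ` I) = k" using I(2) by (subst card_image) (auto intro: inj_onI)
    show "\<forall>e\<in>(\<lambda>u. (u, f u)) ` I. \<forall>f\<in>(\<lambda>u. (u, f u)) ` I. e \<noteq> f \<longrightarrow> \<not> clash e f"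
      using no_clash by auto
  qed
qed

text \<open>An arc that clashes with \<open>(a, b)\<close> has an end adjacent to \<open>a\<close>
  or \<open>b\<close>; this includes the ends \<open>a\<close> and \<open>b\<close>, which are
  adjacent to each other. At most \<open>2 * D\<close> such vertices start at most
  \<open>2 * D * D\<close> arcs, and the reversed arcs give the other half of
  \<open>4 * D * D\<close>.\<close>

lemma has_induced_if_many_arcs_bounded_degree:
  assumes deg: "\<And>v. card {u. adj v u} \<le> D" and arcs: "(4 * D * D + 1) * k \<le> card arcs"
  shows "has_induced k"
  unfolding has_induced_def
proof (rule exists_independent_subset[OF finite_arcs, where d = "4 * D * D"])
  show "(4 * D * D + 1) * k \<le> card arcs" by (rule arcs)
  show "clash e f \<Longrightarrow> clash f e" for e f unfolding clash_def by (blast intro: adj_sym)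
  fix e assume "e \<in> arcs"
  then obtain a b where e: "e = (a, b)" "adj a b" unfolding arcs_def by blast
  let ?X = "{u. adj a u} \<union> {u. adj b u}"
  let ?Y = "SIGMA x:?X. {u. adj x u}"
  have finX: "finite ?X" using finite_neighbours by blast
  have finY: "finite ?Y" using finX finite_neighbours by blast
  have "card ?X \<le> 2 * D" using card_Un_le[of "{u. adj a u}" "{u. adj b u}"] deg[of a] deg[of b] by linarith
  have "card ?Y = (\<Sum>x\<in>?X. card {u. adj x u})"
    by (rule card_SigmaI[OF finX]) (use finite_neighbours in blast)
  also have "\<dots> \<le> card ?X * D" using deg sum_bounded_above[of ?X] by (metis of_nat_id)
  also have "\<dots> \<le> 2 * D * D" using \<open>card ?X \<le> 2 * D\<close> by (intro mult_right_mono) auto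
  finally have cardY: "card ?Y \<le> 2 * D * D" .
  have "{f \<in> arcs. f \<noteq> e \<and> clash e f} \<subseteq> ?Y \<union> prod.swap ` ?Y"
  proof
    fix f assume f: "f \<in> {f \<in> arcs. f \<noteq> e \<and> clash e f}"
    obtain c d where cd: "f = (c, d)" by (cases f)
    have "adj c d" "adj d c" using f cd adj_sym unfolding arcs_def by auto
    moreover have "c \<in> ?X \<or> d \<in> ?X"
      using f cd e adj_sym[OF e(2)] unfolding clash_def by auto
    ultimately show "f \<in> ?Y \<union> prod.swap ` ?Y" unfolding cd by force
  qed
  then have "card {f \<in> arcs. f \<noteq> e \<and> clash e f} \<le> card (?Y \<union> prod.swap ` ?Y)"
    by (rule card_mono[rotated]) (use finY in blast)
  also have "\<dots> \<le> card ?Y + card (prod.swap ` ?Y)" by (rule card_Un_le)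
  also have "card (prod.swap ` ?Y) \<le> card ?Y" by (rule card_image_le[OF finY])
  finally show "card {f \<in> arcs. f \<noteq> e \<and> clash e f} \<le> 4 * D * D" using cardY by linarith
qed

text \<open>Either some degree exceeds \<open>D\<close> or all are at most \<open>D\<close>. Since
  \<open>1 \<le> k\<close> makes \<open>D\<close> positive, \<open>5 * D * D\<close> absorbs the
  \<open>+ 1\<close> of the greedy bound.\<close>

lemma has_induced_if_many_arcs:
  assumes pendant: "\<And>v. card {u. adj v u \<and> (\<forall>w. adj u w \<longrightarrow> w = v)} \<le> 1"
    and k: "1 \<le> k" and D: "D = 2 * card quads + 8 * k * k" and arcs: "5 * D * D * k \<le> card arcs"
  shows "has_induced k"
proof (cases "\<exists>v. 1 + D \<le> card {u. adj v u}")
  case True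
  then show ?thesis using has_induced_if_high_degree[OF pendant] D by auto
next
  case False
  have "1 \<le> D" using D k by (cases k) auto
  then have "1 * 1 \<le> D * D" using mult_le_mono by blast
  then have "4 * D * D + 1 \<le> 5 * D * D" by simp
  then have "(4 * D * D + 1) * k \<le> 5 * D * D * k" by (rule mult_right_mono) simp
  then have "(4 * D * D + 1) * k \<le> card arcs" using arcs by (rule order_trans)
  moreover have "card {u. adj v u} \<le> D" for v using False by (metis not_less_eq_eq plus_1_eq_Suc)
  ultimately show ?thesis by (intro has_induced_if_many_arcs_bounded_degree)
qed

end

section \<open>From nonclashing arcs to matchings, and transport of matchings along
  embeddings\<close>

lemma cycle_edges_subset_iff:
  "cycle_edges p \<subseteq> E \<longleftrightarrow> (\<forall>i<length p. {p ! i, p ! (Suc i mod length p)} \<in> E)"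
  unfolding cycle_edges_def by blast

text \<open>The first two edges of a cycle are distinct and share a vertex, which a matching
  forbids.\<close>

lemma acyclic_graph_matching:
  assumes "matching E M" "M' \<subseteq> M"
  shows "acyclic_graph M'"
  unfolding acyclic_graph_def
proof
  assume "\<exists>p. is_cycle M' p"
  then obtain p where p: "3 \<le> length p" "distinct p"
    and edges: "\<And>i. i < length p \<Longrightarrow> {p ! i, p ! (Suc i mod length p)} \<in> M'"
    unfolding is_cycle_def cycle_edges_subset_iff by blast
  have len: "0 < length p" "1 < length p" "2 < length p" using p(1) by linarith+
  have "{p ! 0, p ! 1} \<in> M" "{p ! 1, p ! 2} \<in> M"
    using edges[OF len(1)] edges[OF len(2)] len assms(2) by (auto simp: numeral_2_eq_2)
  moreover have "p ! 0 \<noteq> p ! 1" "p ! 0 \<noteq> p ! 2"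
    using nth_eq_iff_index_eq[OF p(2) len(1) len(2)] nth_eq_iff_index_eq[OF p(2) len(1) len(3)] by simp_all
  then have "{p ! 0, p ! 1} \<noteq> {p ! 1, p ! 2}" by (auto simp: doubleton_eq_iff)
  ultimately have "{p ! 0, p ! 1} \<inter> {p ! 1, p ! 2} = {}"
    using assms(1) unfolding matching_def by meson
  then show False by auto
qed

lemma (in adjacency) matching_if_has_induced:
  assumes "has_induced k" and E: "E = {{a, b} | a b. adj a b}"
  shows "\<exists>M. acyclic_matching E M \<and> induced_matching E M \<and> card M = k"
proof -
  obtain I where I: "I \<subseteq> arcs" "card I = k" "\<And>e f. e \<in> I \<Longrightarrow> f \<in> I \<Longrightarrow> e \<noteq> f \<Longrightarrow> \<not> clash e f"
    using assms(1) unfolding has_induced_def by metis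
  let ?s = "\<lambda>(a, b). {a, b}"
  define M where "M = ?s ` I"
  have disj: "?s e \<inter> ?s f = {}" if "e \<in> I" "f \<in> I" "e \<noteq> f" for e f
    using I(3)[OF that] unfolding clash_def by (cases e; cases f) auto
  have inj: "inj_on ?s I"
  proof (rule inj_onI, rule ccontr)
    fix e f assume "e \<in> I" "f \<in> I" "?s e = ?s f" "e \<noteq> f"
    then show False using disj[of e f] by (cases e; cases f) auto
  qed
  have "matching E M" unfolding matching_def
  proof (intro conjI ballI impI)
    show "M \<subseteq> E" unfolding M_def E using I(1) unfolding arcs_def by auto
    fix e f assume "e \<in> M" "f \<in> M" "e \<noteq> f"
    then obtain e' f' where "e = ?s e'" "f = ?s f'" "e' \<in> I" "f' \<in> I" unfolding M_def by blast
    moreover from this have "e' \<noteq> f'" using \<open>e \<noteq> f\<close> by auto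
    ultimately show "e \<inter> f = {}" using disj[of e' f'] by simp
  qed
  \<comment> \<open>An edge between covered vertices makes the arcs covering its ends clash, so
    these are one and the same arc, with the edge as its underlying set.\<close>
  moreover have ind: "induced_edges E (\<Union>M) \<subseteq> M"
  proof
    fix e assume "e \<in> induced_edges E (\<Union>M)"
    then have e: "e \<in> E" "e \<subseteq> \<Union>M" unfolding induced_edges_def by simp_all
    from e(1) obtain a b where ab: "e = {a, b}" "adj a b" unfolding E by auto
    then have "a \<in> \<Union>(?s ` I)" "b \<in> \<Union>(?s ` I)" using e(2) unfolding M_def by simp_all
    then obtain f g where fg: "f \<in> I" "a \<in> ?s f" "g \<in> I" "b \<in> ?s g" by (elim UnionE imageE) simp
    have "clash f g" using fg ab(2) unfolding clash_def by (cases f; cases g) auto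
    then have "f = g" using I(3) fg by blast
    moreover have "a \<noteq> b" using ab(2) adj_irrefl by auto
    ultimately have "e = ?s f" using ab(1) fg by (cases f) auto
    then show "e \<in> M" unfolding M_def using fg(1) by blast
  qed
  moreover have "M \<subseteq> induced_edges E (\<Union>M)"
    using \<open>matching E M\<close> unfolding matching_def induced_edges_def by blast
  ultimately have "matching E M" "induced_edges E (\<Union>M) = M" by auto
  moreover have "card M = k" unfolding M_def using I(2) card_image[OF inj] by simp
  ultimately show ?thesis unfolding acyclic_matching_def induced_matching_def
    using acyclic_graph_matching[of E M M] by (intro exI[of _ M]) simp
qed

text \<open>An isomorphism between the subgraphs induced on \<open>S\<close> and on its image.
  Injectivity is asked on \<open>S\<close> only, later the vertices covered by a matching, because
  replacing removed vertices by representatives identifies twins elsewhere.\<close>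

locale embedding =
  fixes E :: "'a set set" and F :: "'b set set" and \<phi> :: "'a \<Rightarrow> 'b" and S :: "'a set"
  assumes card_E: "e \<in> E \<Longrightarrow> card e = 2" and card_F: "f \<in> F \<Longrightarrow> card f = 2"
    and inj: "inj_on \<phi> S"
    and edge_iff: "x \<in> S \<Longrightarrow> y \<in> S \<Longrightarrow> {x, y} \<in> E \<longleftrightarrow> {\<phi> x, \<phi> y} \<in> F"
begin

lemma induced_edges_image: "induced_edges F (\<phi> ` S) = (`) \<phi> ` induced_edges E S"
proof (intro set_eqI iffI)
  fix f assume "f \<in> induced_edges F (\<phi> ` S)"
  then have f: "f \<in> F" "f \<subseteq> \<phi> ` S" unfolding induced_edges_def by auto
  obtain a b where "f = {a, b}" using card_F[OF f(1)] by (auto simp: card_2_iff)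
  then obtain x y where xy: "x \<in> S" "y \<in> S" "f = {\<phi> x, \<phi> y}" using f(2) by auto
  then have "{x, y} \<in> induced_edges E S" using edge_iff f(1) unfolding induced_edges_def by auto
  moreover have "f = \<phi> ` {x, y}" using xy(3) by simp
  ultimately show "f \<in> (`) \<phi> ` induced_edges E S" by blast
next
  fix f assume "f \<in> (`) \<phi> ` induced_edges E S"
  then obtain e where e: "e \<in> E" "e \<subseteq> S" "f = \<phi> ` e" unfolding induced_edges_def by auto
  obtain a b where "e = {a, b}" using card_E[OF e(1)] by (auto simp: card_2_iff)
  then show "f \<in> induced_edges F (\<phi> ` S)" using e edge_iff[of a b] unfolding induced_edges_def by auto
qed

lemma acyclic_image:
  assumes "acyclic_graph (induced_edges E S)"
  shows "acyclic_graph (induced_edges F (\<phi> ` S))"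
  unfolding acyclic_graph_def
proof
  assume "\<exists>p. is_cycle (induced_edges F (\<phi> ` S)) p"
  then obtain p where p: "3 \<le> length p" "distinct p"
    "\<And>i. i < length p \<Longrightarrow> {p ! i, p ! (Suc i mod length p)} \<in> induced_edges F (\<phi> ` S)"
    unfolding is_cycle_def cycle_edges_subset_iff by blast
  have "p ! i \<in> \<phi> ` S" if "i < length p" for i using p(3)[OF that] unfolding induced_edges_def by auto
  then have sub: "set p \<subseteq> \<phi> ` S" by (auto simp: in_set_conv_nth)
  \<comment> \<open>The cycle is pulled back vertex by vertex along the inverse of
    \<open>\<phi>\<close> on \<open>S\<close>.\<close>
  define q where "q = map (inv_into S \<phi>) p"
  have len: "length q = length p" unfolding q_def by simp
  have q: "q ! i \<in> S" "\<phi> (q ! i) = p ! i" if "i < length p" for i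
    using sub that unfolding q_def by (auto simp: inv_into_into f_inv_into_f subset_iff)
  have "distinct q" unfolding q_def using p(2) inj_on_inv_into[OF sub] by (simp add: distinct_map)
  moreover have "{q ! i, q ! (Suc i mod length q)} \<in> induced_edges E S" if "i < length q" for i
  proof -
    have i: "i < length p" "Suc i mod length p < length p" using that len by (auto intro: mod_less_divisor)
    then have "{q ! i, q ! (Suc i mod length p)} \<in> E"
      using edge_iff[OF q(1)[OF i(1)] q(1)[OF i(2)]] q(2)[OF i(1)] q(2)[OF i(2)] p(3)[OF i(1)]
      unfolding induced_edges_def by simp
    then show ?thesis using q(1)[OF i(1)] q(1)[OF i(2)] len unfolding induced_edges_def by simp
  qed
  ultimately have "is_cycle (induced_edges E S) q"
    unfolding is_cycle_def cycle_edges_subset_iff using p(1) len by simp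
  then show False using assms unfolding acyclic_graph_def by blast
qed

lemma matching_image:
  assumes M: "matching E M" and S: "S = \<Union>M"
  shows "matching F ((`) \<phi> ` M)" "\<Union>((`) \<phi> ` M) = \<phi> ` S" "card ((`) \<phi> ` M) = card M"
proof -
  have inE: "M \<subseteq> E" using M unfolding matching_def by blast
  have sub: "e \<in> M \<Longrightarrow> e \<subseteq> S" for e using S by blast
  show "\<Union>((`) \<phi> ` M) = \<phi> ` S" unfolding S by blast
  have "M \<subseteq> induced_edges E S" using inE sub unfolding induced_edges_def by blast
  then have "(`) \<phi> ` M \<subseteq> induced_edges F (\<phi> ` S)" unfolding induced_edges_image by (rule image_mono)
  then have "(`) \<phi> ` M \<subseteq> F" unfolding induced_edges_def by blast
  moreover have "\<phi> ` e \<inter> \<phi> ` f = {}" if "e \<in> M" "f \<in> M" "\<phi> ` e \<noteq> \<phi> ` f" for e f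
  proof -
    have "e \<inter> f = {}" using M that unfolding matching_def by blast
    then show ?thesis using inj_on_image_Int[OF inj sub sub, OF that(1,2)] by simp
  qed
  ultimately show "matching F ((`) \<phi> ` M)" unfolding matching_def by blast
  have "inj_on ((`) \<phi>) M"
    using inj_on_image_eq_iff[OF inj sub sub] by (auto intro!: inj_onI)
  then show "card ((`) \<phi> ` M) = card M" by (rule card_image)
qed

lemma card_induced_edges_image: "card (induced_edges F (\<phi> ` S)) = card (induced_edges E S)"
proof -
  have "inj_on ((`) \<phi>) (induced_edges E S)"
  proof (rule inj_onI)
    fix e f assume "e \<in> induced_edges E S" "f \<in> induced_edges E S" "\<phi> ` e = \<phi> ` f"
    then show "e = f" using inj_on_image_eq_iff[OF inj] unfolding induced_edges_def by blast
  qed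
  then show ?thesis unfolding induced_edges_image by (rule card_image)
qed

lemma acyclic_matching_image:
  "acyclic_matching E M \<Longrightarrow> S = \<Union>M \<Longrightarrow> acyclic_matching F ((`) \<phi> ` M) \<and> card ((`) \<phi> ` M) = card M"
  using matching_image[of M] acyclic_image unfolding acyclic_matching_def by simp

lemma induced_matching_image:
  "induced_matching E M \<Longrightarrow> S = \<Union>M \<Longrightarrow> induced_matching F ((`) \<phi> ` M) \<and> card ((`) \<phi> ` M) = card M"
  using matching_image[of M] card_induced_edges_image unfolding induced_matching_def by simp

end

section \<open>The kernel\<close>

definition pendant :: "nat \<Rightarrow> (nat \<Rightarrow> nat \<Rightarrow> bool) \<Rightarrow> nat \<Rightarrow> nat \<Rightarrow> bool" where
  "pendant n adj v u \<longleftrightarrow> adj v u \<and> (\<forall>w<n. adj v w \<longrightarrow> w = u)"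

text \<open>Pendant vertices at the same neighbour are twins, and the one with the least number
  stays. Bounded quantifiers keep the condition within the scope of
  \<open>polytime_intros\<close>.\<close>

definition removed :: "nat \<Rightarrow> (nat \<Rightarrow> nat \<Rightarrow> bool) \<Rightarrow> nat \<Rightarrow> bool" where
  "removed n adj v \<longleftrightarrow> (\<exists>u<n. pendant n adj v u \<and> (\<exists>x<v. pendant n adj x u))"

definition reduced :: "nat \<Rightarrow> (nat \<Rightarrow> nat \<Rightarrow> bool) \<Rightarrow> nat \<Rightarrow> nat \<Rightarrow> bool" where
  "reduced n adj u v \<longleftrightarrow> adj u v \<and> \<not> removed n adj u \<and> \<not> removed n adj v"

text \<open>Vertices left without neighbours are discarded too, so that the number of arcs bounds
  the number of vertices.\<close>

definition kept :: "nat \<Rightarrow> (nat \<Rightarrow> nat \<Rightarrow> bool) \<Rightarrow> nat \<Rightarrow> bool" where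
  "kept n adj v \<longleftrightarrow> (\<exists>u<n. reduced n adj v u)"

definition quad_count :: "nat \<Rightarrow> (nat \<Rightarrow> nat \<Rightarrow> bool) \<Rightarrow> nat" where
  "quad_count n adj = (\<Sum>a<n. \<Sum>b<n. \<Sum>c<n. \<Sum>d<n.
     of_bool (a \<noteq> c \<and> b \<noteq> d \<and> adj a b \<and> adj b c \<and> adj c d \<and> adj d a))"

definition arc_count :: "nat \<Rightarrow> (nat \<Rightarrow> nat \<Rightarrow> bool) \<Rightarrow> nat" where
  "arc_count n adj = (\<Sum>u<n. \<Sum>v<n. of_bool (reduced n adj u v))"

text \<open>The \<open>D\<close> of \<open>has_induced_if_many_arcs\<close>, but with quadruples
  counted in the unreduced graph, which has at least as many.\<close>

definition degree_bound :: "nat \<Rightarrow> (nat \<Rightarrow> nat \<Rightarrow> bool) \<Rightarrow> nat \<Rightarrow> nat" where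
  "degree_bound n adj k = 2 * quad_count n adj + 8 * k * k"

definition small :: "nat \<Rightarrow> (nat \<Rightarrow> nat \<Rightarrow> bool) \<Rightarrow> nat \<Rightarrow> bool" where
  "small n adj k \<longleftrightarrow> arc_count n adj < 5 * degree_bound n adj k * degree_bound n adj k * k"

definition kept_list :: "nat \<Rightarrow> (nat \<Rightarrow> nat \<Rightarrow> bool) \<Rightarrow> nat list" where
  "kept_list n adj = filter (kept n adj) [0..<n]"

text \<open>Instances have vertex set \<open>{0..<n}\<close>, hence the renumbering by positions in
  \<open>kept_list\<close>.\<close>

definition kernel_edges :: "nat \<Rightarrow> (nat \<Rightarrow> nat \<Rightarrow> bool) \<Rightarrow> nat set set" where
  "kernel_edges n adj = (let W = kept_list n adj in
     {{a, b} | a b. a < length W \<and> b < length W \<and> adj (W ! a) (W ! b)})"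

text \<open>Large instances are replaced by a single edge with \<open>k = 1\<close>, a trivial yes-instance.\<close>

fun kernel :: "inst \<Rightarrow> inst" where
  "kernel ((n, E), k) = (let adj = \<lambda>u v. {u, v} \<in> E in
     if small n adj k then ((length (kept_list n adj), kernel_edges n adj), k)
     else ((2, {{0, 1}}), 1))"

text \<open>Positions outside the matrix read as the leaf, so indices out of range are never adjacent.\<close>

definition tree_adj :: "tree \<Rightarrow> nat \<Rightarrow> nat \<Rightarrow> bool" where
  "tree_adj A i j \<longleftrightarrow> item j (item i A) \<noteq> Leaf"

lemma polytime_pred_tree_adj: "polytime A \<Longrightarrow> polytime_nat i \<Longrightarrow> polytime_nat j \<Longrightarrow> polytime_pred (\<lambda>x. tree_adj (A x) (i x) (j x))"
  unfolding tree_adj_def by (intro polytime_pred_not_Leaf polytime_item)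

text \<open>Reading the matrix at kept rows and columns only already performs the
  renumbering.\<close>

definition kernel_tree :: "tree \<Rightarrow> tree" where
  "kernel_tree x = (if small (nat_of (tree_fst x)) (tree_adj (tree_fst x)) (nat_of (tree_snd x))
     then Node (enc_list (map (\<lambda>i. enc_list (map (\<lambda>j. enc_bool (tree_adj (tree_fst x) i j))
                 (kept_list (nat_of (tree_fst x)) (tree_adj (tree_fst x)))))
               (kept_list (nat_of (tree_fst x)) (tree_adj (tree_fst x)))))
            (enc_nat (nat_of (tree_snd x)))
     else enc_inst ((2, {{0, 1}}), 1))"

lemma polytime_kernel_tree: "polytime kernel_tree"
  unfolding kernel_tree_def[abs_def] small_def degree_bound_def quad_count_def arc_count_def
    kept_list_def kept_def reduced_def removed_def pendant_def
  by (intro polytime_intros polytime_pred_tree_adj)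

lemma cycle_edges_4: "cycle_edges [a, b, c, d] = {{a, b}, {b, c}, {c, d}, {d, a}}"
proof -
  have "{i. i < length [a, b, c, d]} = {0, 1, 2, 3}" by auto
  then have "cycle_edges [a, b, c, d] = (\<lambda>i. {[a, b, c, d] ! i, [a, b, c, d] ! (Suc i mod length [a, b, c, d])}) ` {0, 1, 2, 3}"
    unfolding cycle_edges_def setcompr_eq_image by (rule arg_cong)
  then show ?thesis by simp
qed

section \<open>The reduction of a fixed graph\<close>

locale graph_inst = adjacency "{..<n}" adj for n :: nat and adj :: "nat \<Rightarrow> nat \<Rightarrow> bool"
begin

lemma adj_less: "adj a b \<Longrightarrow> a < n" "adj a b \<Longrightarrow> b < n"
  using adj_V adj_sym by blast+

lemma pendant_iff: "pendant n adj v u \<longleftrightarrow> adj v u \<and> (\<forall>w. adj v w \<longrightarrow> w = u)"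
  unfolding pendant_def using adj_less by blast

lemma pendant_unique: "pendant n adj v u \<Longrightarrow> pendant n adj v u' \<Longrightarrow> u = u'"
  unfolding pendant_iff by blast

text \<open>The least pendant vertex at \<open>u\<close> survives: \<open>u\<close> is its only
  neighbour, so only a smaller pendant vertex at \<open>u\<close> could remove it.\<close>

lemma removed_representative:
  assumes "removed n adj v"
  shows "\<exists>x u. \<not> removed n adj x \<and> pendant n adj x u \<and> pendant n adj v u"
proof -
  obtain u where u: "pendant n adj v u" using assms unfolding removed_def by blast
  define x where "x = (LEAST x. pendant n adj x u)"
  have x: "pendant n adj x u" unfolding x_def by (rule LeastI[of "\<lambda>x. pendant n adj x u", OF u])
  have "\<not> removed n adj x"
  proof
    assume "removed n adj x"
    then obtain y where "y < x" "pendant n adj y u" using pendant_unique[OF x] unfolding removed_def by blast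
    then show False unfolding x_def by (blast dest: not_less_Least)
  qed
  then show ?thesis using x u by blast
qed

lemma reduced_adjacency: "adjacency {..<n} (reduced n adj)"
  by unfold_locales (auto simp: reduced_def adj_irrefl adj_less intro: adj_sym)

sublocale red: adjacency "{..<n}" "reduced n adj"
  by (rule reduced_adjacency)

text \<open>A vertex that loses a neighbour keeps a twin of it, so the reduction creates pendant
  vertices only when a star shrinks to a single edge. Two distinct pendant vertices at
  \<open>v\<close> were therefore pendant before, and the larger would have been removed.\<close>

lemma reduced_pendant: "card {u. reduced n adj v u \<and> (\<forall>w. reduced n adj u w \<longrightarrow> w = v)} \<le> 1"
proof (rule card_le_1I)
  let ?P = "{u. reduced n adj v u \<and> (\<forall>w. reduced n adj u w \<longrightarrow> w = v)}"
  have *: "pendant n adj u v" if u: "u \<in> ?P" and u': "u' \<in> ?P" "u \<noteq> u'" for u u'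
  proof (rule ccontr)
    assume "\<not> pendant n adj u v"
    then obtain w where w: "adj u w" "w \<noteq> v"
      using u adj_sym unfolding pendant_iff reduced_def by blast
    \<comment> \<open>The surviving twin \<open>x\<close> of \<open>w\<close> is still adjacent to
      \<open>u\<close>, hence equals \<open>v\<close>. Then \<open>u\<close> is the only neighbour
      of \<open>v\<close>, contradicting \<open>u'\<close>.\<close>
    then have "removed n adj w" using u unfolding reduced_def by blast
    then obtain x z where x: "\<not> removed n adj x" "pendant n adj x z" "pendant n adj w z"
      using removed_representative by blast
    have "z = u" using x(3) w(1) adj_sym unfolding pendant_iff by blast
    then have "reduced n adj u x" using x u adj_sym unfolding pendant_iff reduced_def by blast
    then have "x = v" using u by blast
    then have "u' = u" using x(2) u' \<open>z = u\<close> unfolding pendant_iff reduced_def by blast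
    then show False using u'(2) by simp
  qed
  fix u u' assume u: "u \<in> ?P" "u' \<in> ?P"
  show "u = u'"
  proof (rule ccontr)
    assume "u \<noteq> u'"
    then have p: "pendant n adj u v" "pendant n adj u' v" using *[OF u] *[OF u(2,1)] by auto
    then have "v < n" using adj_less unfolding pendant_iff by blast
    have "removed n adj u \<or> removed n adj u'"
      using p \<open>v < n\<close> \<open>u \<noteq> u'\<close> unfolding removed_def by (metis nat_neq_iff)
    then show False using u unfolding reduced_def by blast
  qed
qed

lemma quad_count_eq: "quad_count n adj = card quads"
proof -
  have "quad_count n adj = (\<Sum>(a, b, c, d)\<in>{..<n} \<times> {..<n} \<times> {..<n} \<times> {..<n}.
      of_bool (a \<noteq> c \<and> b \<noteq> d \<and> adj a b \<and> adj b c \<and> adj c d \<and> adj d a))"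
    unfolding quad_count_def by (simp add: sum.cartesian_product split_def del: sum_of_bool_eq)
  also have "\<dots> = (\<Sum>x\<in>{..<n} \<times> {..<n} \<times> {..<n} \<times> {..<n}. of_bool (x \<in> quads))"
    by (intro sum.cong) (auto simp: quads_def)
  also have "\<dots> = card (({..<n} \<times> {..<n} \<times> {..<n} \<times> {..<n}) \<inter> quads)"
    by (subst sum_of_bool_eq) auto
  also have "({..<n} \<times> {..<n} \<times> {..<n} \<times> {..<n}) \<inter> quads = quads"
    unfolding quads_def using adj_less by blast
  finally show ?thesis .
qed

lemma arc_count_eq: "arc_count n adj = card red.arcs"
proof -
  have "arc_count n adj = (\<Sum>x\<in>{..<n} \<times> {..<n}. of_bool (x \<in> red.arcs))"
    unfolding arc_count_def by (simp add: sum.cartesian_product split_def red.arcs_def del: sum_of_bool_eq)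
  also have "\<dots> = card (({..<n} \<times> {..<n}) \<inter> red.arcs)"
    by (subst sum_of_bool_eq) auto
  also have "({..<n} \<times> {..<n}) \<inter> red.arcs = red.arcs"
    unfolding red.arcs_def reduced_def using adj_less by blast
  finally show ?thesis .
qed

text \<open>The reduced graph is the subgraph induced on the unremoved vertices, so what does not
  clash there does not clash in the whole graph.\<close>

lemma has_induced_if_not_small:
  assumes "1 \<le> k" "\<not> small n adj k"
  shows "has_induced k"
proof -
  have "red.quads \<subseteq> quads" unfolding red.quads_def quads_def reduced_def by blast
  then have q: "card red.quads \<le> quad_count n adj"
    unfolding quad_count_eq by (rule card_mono[OF finite_quads])
  define D where "D = 2 * card red.quads + 8 * k * k"
  have "D \<le> degree_bound n adj k" unfolding D_def degree_bound_def using q by simp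
  then have "5 * D * D * k \<le> 5 * degree_bound n adj k * degree_bound n adj k * k"
    by (intro mult_le_mono) auto
  also have "\<dots> \<le> card red.arcs" using assms(2) unfolding small_def arc_count_eq by simp
  finally have "red.has_induced k"
    by (rule red.has_induced_if_many_arcs[OF reduced_pendant assms(1) D_def])
  then obtain I where I: "I \<subseteq> red.arcs" "card I = k"
      "\<forall>e\<in>I. \<forall>f\<in>I. e \<noteq> f \<longrightarrow> \<not> red.clash e f" unfolding red.has_induced_def by blast
  have not_removed: "\<not> removed n adj x" if "e \<in> I" "x \<in> {fst e, snd e}" for e x
    using that I(1) unfolding red.arcs_def reduced_def by auto
  have "red.clash e f" if e: "e \<in> I" and f: "f \<in> I" and c: "clash e f" for e f
  proof -
    obtain x y where xy: "x \<in> {fst e, snd e}" "y \<in> {fst f, snd f}" "x = y \<or> adj x y"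
      using c unfolding clash_def by blast
    then have "x = y \<or> reduced n adj x y"
      using not_removed[OF e] not_removed[OF f] unfolding reduced_def by blast
    then show ?thesis using xy(1,2) unfolding red.clash_def by blast
  qed
  then have "\<forall>e\<in>I. \<forall>f\<in>I. e \<noteq> f \<longrightarrow> \<not> clash e f" using I(3) by meson
  moreover have "red.arcs \<subseteq> arcs" unfolding red.arcs_def arcs_def reduced_def by auto
  then have "I \<subseteq> arcs" using I(1) by (rule order_trans[rotated])
  ultimately show ?thesis unfolding has_induced_def using I(2) by (intro exI[of _ I] conjI)
qed

definition edges :: "nat set set" where
  "edges = {{a, b} | a b. adj a b}"

lemma edges_iff: "{a, b} \<in> edges \<longleftrightarrow> adj a b"
  unfolding edges_def by (auto simp: doubleton_eq_iff intro: adj_sym)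

lemma finite_edges: "finite edges"
  by (rule finite_subset[of _ "Pow {..<n}"]) (auto simp: edges_def adj_less)

lemma card_edge: "e \<in> edges \<Longrightarrow> card e = 2"
  unfolding edges_def using adj_irrefl card_2_iff by blast

abbreviation W where "W \<equiv> kept_list n adj"

lemma distinct_kept_list: "distinct W"
  unfolding kept_list_def by simp

lemma set_kept_list: "set W = {v. kept n adj v}"
  unfolding kept_list_def kept_def reduced_def using adj_less by auto

lemma kernel_edges_iff: "{a, b} \<in> kernel_edges n adj \<longleftrightarrow> a < length W \<and> b < length W \<and> adj (W ! a) (W ! b)"
  unfolding kernel_edges_def Let_def by (auto simp: doubleton_eq_iff intro: adj_sym)

lemma kernel_edgeE:
  assumes "e \<in> kernel_edges n adj"
  obtains a b where "e = {a, b}" "a < length W" "b < length W" "adj (W ! a) (W ! b)"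
  using assms unfolding kernel_edges_def Let_def by blast

lemma card_kernel_edge: "e \<in> kernel_edges n adj \<Longrightarrow> card e = 2"
  by (erule kernel_edgeE) (use adj_irrefl card_2_iff in metis)

lemma embedding_from_kernel:
  assumes "matching (kernel_edges n adj) M"
  shows "embedding (kernel_edges n adj) edges ((!) W) (\<Union>M)"
proof
  have less: "x < length W" if x: "x \<in> \<Union>M" for x
  proof -
    obtain e where "e \<in> kernel_edges n adj" "x \<in> e" using assms x unfolding matching_def by blast
    then show ?thesis by (elim kernel_edgeE) auto
  qed
  show "inj_on ((!) W) (\<Union>M)"
    using less distinct_kept_list by (intro inj_onI) (simp add: nth_eq_iff_index_eq)
  show "{x, y} \<in> kernel_edges n adj \<longleftrightarrow> {W ! x, W ! y} \<in> edges" if "x \<in> \<Union>M" "y \<in> \<Union>M" for x y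
    using less that by (simp add: kernel_edges_iff edges_iff)
qed (auto simp: card_edge card_kernel_edge)

text \<open>\<open>rep\<close> moves a removed vertex to a surviving pendant vertex with the same
  neighbour and fixes all others. Twins have equal neighbourhoods, so adjacency is preserved both
  ways and only twins are identified.\<close>

lemma ex_representatives:
  "\<exists>rep. (\<forall>x y. adj (rep x) (rep y) \<longleftrightarrow> adj x y) \<and> (\<forall>x. \<not> removed n adj (rep x)) \<and>
     (\<forall>x y. rep x = rep y \<longrightarrow> x = y \<or> (\<exists>u. pendant n adj x u \<and> pendant n adj y u))"
proof -
  have "\<exists>x. if removed n adj v
      then \<not> removed n adj x \<and> (\<exists>u. pendant n adj x u \<and> pendant n adj v u) else x = v" for v
    using removed_representative[of v] by (cases "removed n adj v") auto
  then obtain rep where rep: "\<And>v. if removed n adj v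
      then \<not> removed n adj (rep v) \<and> (\<exists>u. pendant n adj (rep v) u \<and> pendant n adj v u) else rep v = v"
    by metis
  have not_removed: "\<not> removed n adj (rep v)" for v using rep[of v] by (metis (full_types))
  have eq: "rep v = v" if "\<not> removed n adj v" for v using rep[of v] that by simp
  have pend: "\<exists>u. pendant n adj (rep v) u \<and> pendant n adj v u" if "removed n adj v" for v
    using rep[of v] that by simp
  have centre: "\<not> pendant n adj u w" if "removed n adj v" "pendant n adj v u" for v u w
  proof -
    have "rep v \<noteq> v" using that(1) not_removed[of v] by auto
    moreover have "adj u v" "adj u (rep v)"
      using pend[OF that(1)] that(2) pendant_unique adj_sym unfolding pendant_iff by metis+
    ultimately show ?thesis unfolding pendant_iff by blast
  qed
  have mixed: "adj (rep x) y \<longleftrightarrow> adj x y" for x y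
  proof (cases "removed n adj x")
    case True
    then show ?thesis using pend[OF True] unfolding pendant_iff by metis
  qed (simp add: eq)
  have "adj (rep x) (rep y) \<longleftrightarrow> adj x y" for x y
    using mixed adj_sym by metis
  moreover have "x = y \<or> (\<exists>u. pendant n adj x u \<and> pendant n adj y u)" if "rep x = rep y" for x y
    using pend[of x] pend[of y] eq[of x] eq[of y] that pendant_unique by metis
  ultimately show ?thesis using not_removed by blast
qed

text \<open>Two covered twins would both be matched to their common neighbour, so \<open>rep\<close>
  is injective on the covered vertices. These have neighbours, so their representatives are
  kept.\<close>

lemma embedding_to_kernel:
  assumes M: "matching edges M"
  shows "\<exists>\<phi>. embedding edges (kernel_edges n adj) \<phi> (\<Union>M)"
proof -
  obtain rep where rep: "\<And>x y. adj (rep x) (rep y) \<longleftrightarrow> adj x y" "\<And>x. \<not> removed n adj (rep x)"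
     "\<And>x y. rep x = rep y \<Longrightarrow> x = y \<or> (\<exists>u. pendant n adj x u \<and> pendant n adj y u)"
    using ex_representatives by metis
  have partner: "\<exists>y. {x, y} \<in> M \<and> adj x y" if x: "x \<in> \<Union>M" for x
  proof -
    obtain e where e: "e \<in> M" "x \<in> e" using x by blast
    then have "e \<in> edges" using M unfolding matching_def by auto
    then obtain a b where ab: "e = {a, b}" "adj a b" unfolding edges_def by auto
    then have "{a, b} \<in> M" "{b, a} \<in> M" "adj b a" using e(1) adj_sym by (simp_all add: insert_commute)
    then show ?thesis using e(2) ab by auto
  qed
  have inj: "inj_on rep (\<Union>M)"
  proof (rule inj_onI, rule ccontr)
    fix x y assume xy: "x \<in> \<Union>M" "y \<in> \<Union>M" "rep x = rep y" "x \<noteq> y"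
    then obtain u where u: "pendant n adj x u" "pendant n adj y u" using rep(3) by blast
    then have "{x, u} \<in> M" "{y, u} \<in> M"
      using partner[OF xy(1)] partner[OF xy(2)] unfolding pendant_iff by blast+
    moreover have "{x, u} \<noteq> {y, u}" using xy(4) by (auto simp: doubleton_eq_iff)
    ultimately have "{x, u} \<inter> {y, u} = {}" using M unfolding matching_def by meson
    then show False by auto
  qed
  have rep_W: "rep x \<in> set W" if x: "x \<in> \<Union>M" for x
  proof -
    obtain y where "adj x y" using partner[OF x] by blast
    then have "reduced n adj (rep x) (rep y)" using rep(1,2) unfolding reduced_def by blast
    then show ?thesis unfolding set_kept_list kept_def using adj_less rep(1) \<open>adj x y\<close> by blast
  qed
  define idx where "idx v = (SOME i. i < length W \<and> W ! i = v)" for v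
  have idx: "idx v < length W" "W ! idx v = v" if "v \<in> set W" for v
  proof -
    have "\<exists>i. i < length W \<and> W ! i = v" using that by (simp add: in_set_conv_nth)
    from someI_ex[OF this] show "idx v < length W" "W ! idx v = v" unfolding idx_def by auto
  qed
  have "embedding edges (kernel_edges n adj) (idx \<circ> rep) (\<Union>M)"
  proof
    show "inj_on (idx \<circ> rep) (\<Union>M)"
    proof (rule inj_onI)
      fix x y assume xy: "x \<in> \<Union>M" "y \<in> \<Union>M" "(idx \<circ> rep) x = (idx \<circ> rep) y"
      then have "rep x = rep y" using idx(2)[OF rep_W] by (metis comp_apply)
      then show "x = y" using inj xy by (auto dest: inj_onD)
    qed
    show "{x, y} \<in> edges \<longleftrightarrow> {(idx \<circ> rep) x, (idx \<circ> rep) y} \<in> kernel_edges n adj"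
      if "x \<in> \<Union>M" "y \<in> \<Union>M" for x y
      using idx[OF rep_W[OF that(1)]] idx[OF rep_W[OF that(2)]]
      by (simp add: kernel_edges_iff edges_iff rep(1))
  qed (auto simp: card_edge card_kernel_edge)
  then show ?thesis by blast
qed

lemma acyclic_matching_kernel_iff:
  "(\<exists>M. acyclic_matching (kernel_edges n adj) M \<and> card M = k)
     \<longleftrightarrow> (\<exists>M. acyclic_matching edges M \<and> card M = k)"
proof
  assume "\<exists>M. acyclic_matching (kernel_edges n adj) M \<and> card M = k"
  then obtain M where M: "acyclic_matching (kernel_edges n adj) M" "card M = k" by blast
  then have "embedding (kernel_edges n adj) edges ((!) W) (\<Union>M)"
    by (intro embedding_from_kernel) (simp add: acyclic_matching_def)
  from embedding.acyclic_matching_image[OF this M(1) refl] M(2)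
  show "\<exists>M. acyclic_matching edges M \<and> card M = k" by blast
next
  assume "\<exists>M. acyclic_matching edges M \<and> card M = k"
  then obtain M where M: "acyclic_matching edges M" "card M = k" by blast
  then obtain \<phi> where "embedding edges (kernel_edges n adj) \<phi> (\<Union>M)"
    using embedding_to_kernel unfolding acyclic_matching_def by blast
  from embedding.acyclic_matching_image[OF this M(1) refl] M(2)
  show "\<exists>M. acyclic_matching (kernel_edges n adj) M \<and> card M = k" by blast
qed

lemma induced_matching_kernel_iff:
  "(\<exists>M. induced_matching (kernel_edges n adj) M \<and> card M = k)
     \<longleftrightarrow> (\<exists>M. induced_matching edges M \<and> card M = k)"
proof
  assume "\<exists>M. induced_matching (kernel_edges n adj) M \<and> card M = k"
  then obtain M where M: "induced_matching (kernel_edges n adj) M" "card M = k" by blast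
  then have "embedding (kernel_edges n adj) edges ((!) W) (\<Union>M)"
    by (intro embedding_from_kernel) (simp add: induced_matching_def)
  from embedding.induced_matching_image[OF this M(1) refl] M(2)
  show "\<exists>M. induced_matching edges M \<and> card M = k" by blast
next
  assume "\<exists>M. induced_matching edges M \<and> card M = k"
  then obtain M where M: "induced_matching edges M" "card M = k" by blast
  then obtain \<phi> where "embedding edges (kernel_edges n adj) \<phi> (\<Union>M)"
    using embedding_to_kernel unfolding induced_matching_def by blast
  from embedding.induced_matching_image[OF this M(1) refl] M(2)
  show "\<exists>M. induced_matching (kernel_edges n adj) M \<and> card M = k" by blast
qed

text \<open>The entries of a quadruple are vertices of one 4-cycle, which allows at most
  \<open>4 ^ 4\<close> quadruples per cycle. The exact factor 8 would improve only a
  constant.\<close>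

lemma card_quads_le: "card quads \<le> 256 * c4 edges"
proof -
  define C where "C = {cycle_edges p | p. is_cycle edges p \<and> length p = 4}"
  have "C \<subseteq> Pow edges" unfolding C_def is_cycle_def by blast
  then have finC: "finite C" using finite_edges by (meson finite_Pow_iff finite_subset)
  let ?T = "\<lambda>X. \<Union>X \<times> \<Union>X \<times> \<Union>X \<times> \<Union>X"
  have X: "finite (\<Union>X) \<and> card (\<Union>X) \<le> 4" if XC: "X \<in> C" for X :: "nat set set"
  proof -
    obtain p where p: "X = cycle_edges p" "length p = 4" using XC unfolding C_def by blast
    then have "Suc i mod length p < length p" for i by simp
    then have "\<Union>X \<subseteq> set p" unfolding p(1) cycle_edges_def by (auto simp del: mod_Suc_le_divisor)
    then show ?thesis using card_mono[of "set p" "\<Union>X"] card_length[of p] p(2)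
      by (auto intro: finite_subset)
  qed
  have "quads \<subseteq> (\<Union>X\<in>C. ?T X)"
  proof
    fix x assume "x \<in> quads"
    then obtain a b c d where x: "x = (a, b, c, d)" and "a \<noteq> c" "b \<noteq> d"
      and adj: "adj a b" "adj b c" "adj c d" "adj d a" unfolding quads_def by auto
    then have d: "distinct [a, b, c, d]" using adj_irrefl by auto
    note ce = cycle_edges_4[of a b c d]
    have "is_cycle edges [a, b, c, d]" unfolding is_cycle_def using d adj ce by (simp add: edges_iff)
    then have "cycle_edges [a, b, c, d] \<in> C"
      unfolding C_def by (intro CollectI exI[of _ "[a, b, c, d]"]) simp
    moreover have U: "\<Union>(cycle_edges [a, b, c, d]) = {a, b, c, d}" unfolding ce by auto
    have "x \<in> ?T (cycle_edges [a, b, c, d])" unfolding U x by simp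
    ultimately show "x \<in> (\<Union>X\<in>C. ?T X)" by (rule UN_I)
  qed
  then have "card quads \<le> card (\<Union>X\<in>C. ?T X)"
    by (rule card_mono[rotated]) (use finC X in auto)
  also have "\<dots> \<le> (\<Sum>X\<in>C. card (?T X))" by (rule card_UN_le[OF finC])
  also have "\<dots> \<le> (\<Sum>X\<in>C. 256)"
  proof (rule sum_mono)
    fix X assume "X \<in> C"
    then have "card (\<Union>X) \<le> 4" using X by blast
    then have "card (\<Union>X) * (card (\<Union>X) * (card (\<Union>X) * card (\<Union>X))) \<le> 4 * (4 * (4 * 4))"
      by (intro mult_le_mono)
    then show "card (?T X) \<le> 256" by (simp add: card_cartesian_product)
  qed
  finally show ?thesis unfolding c4_def C_def[symmetric] by simp
qed

text \<open>The constant is \<open>5 * 512\<^sup>2\<close>.\<close>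

lemma arc_bound:
  assumes "1 \<le> k" "small n adj k"
  shows "arc_count n adj \<le> 1310720 * (k * (k\<^sup>2 + c4 edges) ^ 2)"
proof -
  \<comment> \<open>\<open>512 = 2 * 256\<close> comes from the quadruples; \<open>8 * k * k\<close>
    is enlarged to the same factor.\<close>
  have "degree_bound n adj k \<le> 512 * (k\<^sup>2 + c4 edges)"
    unfolding degree_bound_def quad_count_eq using card_quads_le by (simp add: power2_eq_square)
  then have "5 * degree_bound n adj k * degree_bound n adj k * k
      \<le> 5 * (512 * (k\<^sup>2 + c4 edges)) * (512 * (k\<^sup>2 + c4 edges)) * k"
    by (intro mult_le_mono) auto
  also have "\<dots> = 1310720 * (k * (k\<^sup>2 + c4 edges) ^ 2)"
    by (simp add: power2_eq_square algebra_simps)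
  finally show ?thesis using assms(2) unfolding small_def by linarith
qed

lemma length_kept_list_le: "length W \<le> arc_count n adj"
proof -
  have "set W \<subseteq> fst ` red.arcs" unfolding set_kept_list kept_def red.arcs_def by force
  then have "card (set W) \<le> card red.arcs"
    using card_mono[of "fst ` red.arcs"] card_image_le[of red.arcs fst] red.finite_arcs
    by (meson finite_imageI order_trans)
  then show ?thesis unfolding arc_count_eq using distinct_card[OF distinct_kept_list] by simp
qed

text \<open>Sending an arc to the positions of its ends reaches every kernel edge;
  \<open>SOME\<close> inverts indexing into the distinct list \<open>W\<close>.\<close>

lemma card_kernel_edges_le: "card (kernel_edges n adj) \<le> arc_count n adj"
proof -
  have "kernel_edges n adj \<subseteq> (\<lambda>(u, v). {(SOME i. i < length W \<and> W ! i = u), (SOME i. i < length W \<and> W ! i = v)}) ` red.arcs"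
  proof
    fix e assume "e \<in> kernel_edges n adj"
    then obtain a b where ab: "e = {a, b}" "a < length W" "b < length W" "adj (W ! a) (W ! b)"
      by (rule kernel_edgeE)
    have idx: "(SOME i. i < length W \<and> W ! i = W ! a) = a" if "a < length W" for a
      using that distinct_kept_list by (intro some_equality) (auto simp: nth_eq_iff_index_eq)
    have "kept n adj (W ! a)" "kept n adj (W ! b)" using ab nth_mem set_kept_list by blast+
    then have "(W ! a, W ! b) \<in> red.arcs"
      using ab(4) unfolding red.arcs_def reduced_def kept_def by blast
    then show "e \<in> (\<lambda>(u, v). {(SOME i. i < length W \<and> W ! i = u), (SOME i. i < length W \<and> W ! i = v)}) ` red.arcs"
      using idx[OF ab(2)] idx[OF ab(3)] ab(1) by (intro image_eqI[of _ _ "(W ! a, W ! b)"]) auto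
  qed
  then show ?thesis unfolding arc_count_eq using red.finite_arcs
    by (meson card_image_le card_mono finite_imageI order_trans)
qed

end

section \<open>The kernel on instances and encodings\<close>

lemma graph_inst_of_valid:
  assumes "valid_inst ((n, E), k)"
  shows "graph_inst n (\<lambda>u v. {u, v} \<in> E)"
proof
  show "\<not> {a, a} \<in> E" for a using assms by (auto simp: simple_graph_def)
  show "{a, b} \<in> E \<Longrightarrow> a \<in> {..<n}" for a b using assms by (auto simp: simple_graph_def)
  show "{a, b} \<in> E \<Longrightarrow> {b, a} \<in> E" for a b by (simp add: insert_commute)
qed simp

lemma edges_of_valid:
  assumes "valid_inst ((n, E), k)"
  shows "graph_inst.edges (\<lambda>u v. {u, v} \<in> E) = E"
proof -
  interpret graph_inst n "\<lambda>u v. {u, v} \<in> E" by (rule graph_inst_of_valid[OF assms])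
  have "\<exists>a b. e = {a, b}" if "e \<in> E" for e
  proof -
    have "card e = 2" using assms that by (simp add: simple_graph_def)
    then show ?thesis by (meson card_2_iff)
  qed
  then show ?thesis unfolding edges_def by auto metis
qed

lemma nat_of_enc_graph: "nat_of (enc_graph (n, E)) = n"
  by (simp add: nat_of_def)

lemma tree_adj_enc_graph:
  assumes "valid_inst ((n, E), k)"
  shows "tree_adj (enc_graph (n, E)) = (\<lambda>u v. {u, v} \<in> E)"
proof (intro ext)
  fix u v
  interpret graph_inst n "\<lambda>u v. {u, v} \<in> E" by (rule graph_inst_of_valid[OF assms])
  have b: "enc_bool P \<noteq> Leaf \<longleftrightarrow> P" for P by (cases P) auto
  show "tree_adj (enc_graph (n, E)) u v = ({u, v} \<in> E)"
  proof (cases "u < n \<and> v < n")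
    case True
    then show ?thesis by (simp add: tree_adj_def item_enc_list b)
  next
    case False
    moreover have "item v Leaf = Leaf" by (simp add: item_eq)
    ultimately show ?thesis using adj_less[of u v] by (auto simp: tree_adj_def item_enc_list)
  qed
qed

lemma kernel_tree_enc_inst:
  assumes "valid_inst x"
  shows "kernel_tree (enc_inst x) = enc_inst (kernel x)"
proof -
  obtain n E k where x: "x = ((n, E), k)" by (cases x) auto
  have valid: "valid_inst ((n, E), k)" using assms x by simp
  interpret graph_inst n "\<lambda>u v. {u, v} \<in> E" by (rule graph_inst_of_valid[OF valid])
  let ?adj = "\<lambda>u v. {u, v} \<in> E"
  have map_W: "map f W = map (\<lambda>i. f (W ! i)) [0..<length W]" for f :: "nat \<Rightarrow> tree"
    by (metis (no_types, lifting) map_nth map_map comp_apply map_cong)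
  have "enc_graph (length W, kernel_edges n ?adj)
      = enc_list (map (\<lambda>i. enc_list (map (\<lambda>j. enc_bool ({i, j} \<in> E)) W)) W)"
    unfolding map_W by (simp add: kernel_edges_iff cong: map_cong)
  then show ?thesis
    by (simp add: x kernel_tree_def nat_of_enc_graph tree_adj_enc_graph[OF valid] Let_def
        del: enc_graph.simps)
qed

lemma kernel_valid:
  assumes "valid_inst x"
  shows "valid_inst (kernel x)"
proof -
  obtain n E k where x: "x = ((n, E), k)" by (cases x) auto
  have valid: "valid_inst ((n, E), k)" using assms x by simp
  interpret graph_inst n "\<lambda>u v. {u, v} \<in> E" by (rule graph_inst_of_valid[OF valid])
  have "e \<subseteq> {0..<length W}" if "e \<in> kernel_edges n (\<lambda>u v. {u, v} \<in> E)" for e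
    using that by (elim kernel_edgeE) auto
  then show ?thesis using valid
    by (auto simp: x Let_def simple_graph_def card_kernel_edge)
qed

lemma yes_inst: "acyclic_matching {{0, 1 :: nat}} {{0, 1}}" "induced_matching {{0, 1 :: nat}} {{0, 1}}"
proof -
  have m: "matching {{0, 1 :: nat}} {{0, 1}}" by (simp add: matching_def)
  have i: "induced_edges {{0, 1 :: nat}} (\<Union>{{0, 1}}) = {{0, 1}}" by (auto simp: induced_edges_def)
  show "acyclic_matching {{0, 1 :: nat}} {{0, 1}}"
    unfolding acyclic_matching_def i using m acyclic_graph_matching[OF m order_refl] by simp
  show "induced_matching {{0, 1 :: nat}} {{0, 1}}"
    unfolding induced_matching_def i using m by simp
qed

lemma kernel_correct:
  assumes "valid_inst x"
  shows "Acyclic_Matching (kernel x) \<longleftrightarrow> Acyclic_Matching x"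
    and "Induced_Matching (kernel x) \<longleftrightarrow> Induced_Matching x"
proof -
  obtain n E k where x: "x = ((n, E), k)" by (cases x) auto
  have valid: "valid_inst ((n, E), k)" using assms x by simp
  then have k: "1 \<le> k" by simp
  interpret graph_inst n "\<lambda>u v. {u, v} \<in> E" by (rule graph_inst_of_valid[OF valid])
  note E = edges_of_valid[OF valid]
  have "(Acyclic_Matching (kernel x) \<longleftrightarrow> Acyclic_Matching x) \<and>
      (Induced_Matching (kernel x) \<longleftrightarrow> Induced_Matching x)"
  proof (cases "small n (\<lambda>u v. {u, v} \<in> E) k")
    case True
    then show ?thesis
      using acyclic_matching_kernel_iff[of k, unfolded E] induced_matching_kernel_iff[of k, unfolded E]
      by (simp add: x Let_def)
  next
    case False
    obtain M where M: "acyclic_matching E M" "induced_matching E M" "card M = k"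
      using matching_if_has_induced[OF has_induced_if_not_small[OF k False] edges_def, unfolded E] by blast
    have kx: "kernel x = ((2, {{0, 1}}), 1)" using False by (simp add: x)
    have "Acyclic_Matching x" "Induced_Matching x" unfolding x using M by auto
    moreover have "Acyclic_Matching (kernel x)" "Induced_Matching (kernel x)"
      unfolding kx Acyclic_Matching.simps Induced_Matching.simps
      using yes_inst by (auto intro!: exI[of _ "{{0, 1}}"])
    ultimately show ?thesis by simp
  qed
  then show "Acyclic_Matching (kernel x) \<longleftrightarrow> Acyclic_Matching x"
    "Induced_Matching (kernel x) \<longleftrightarrow> Induced_Matching x" by auto
qed

lemma kernel_num_edges:
  assumes valid: "valid_inst ((n, E), k)"
  shows "num_edges (kernel ((n, E), k)) \<le> 1310720 * (k * (k\<^sup>2 + c4 E) ^ 4)"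
proof -
  have k: "1 \<le> k" using valid by simp
  interpret graph_inst n "\<lambda>u v. {u, v} \<in> E" by (rule graph_inst_of_valid[OF valid])
  note E = edges_of_valid[OF valid]
  have "1 \<le> k\<^sup>2" using k by simp
  then have ge1: "1 \<le> k\<^sup>2 + c4 E" by simp
  show ?thesis
  proof (cases "small n (\<lambda>u v. {u, v} \<in> E) k")
    case True
    have "num_edges (kernel ((n, E), k)) \<le> arc_count n (\<lambda>u v. {u, v} \<in> E)"
      using card_kernel_edges_le True by (simp add: Let_def)
    also have "\<dots> \<le> 1310720 * (k * (k\<^sup>2 + c4 E) ^ 2)" using arc_bound[OF k True] unfolding E .
    also have "\<dots> \<le> 1310720 * (k * (k\<^sup>2 + c4 E) ^ 4)"
      using ge1 by (intro mult_le_mono le_refl power_increasing) auto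
    finally show ?thesis .
  next
    case False
    \<comment> \<open>The trivial yes-instance has one edge, so it suffices that the right-hand side
      is positive.\<close>
    have "1 \<le> (k\<^sup>2 + c4 E) ^ 4" using ge1 by (rule one_le_power)
    then have "1 * 1 \<le> k * (k\<^sup>2 + c4 E) ^ 4" using k by (intro mult_le_mono)
    then show ?thesis using False by simp
  qed
qed

lemma tree_size_enc_graph: "tree_size (enc_graph (n, E)) \<le> 1 + n * (2 + 4 * n)"
proof -
  have b: "tree_size (enc_bool P) \<le> 3" for P by (cases P) auto
  have row: "tree_size (enc_list (map (\<lambda>j. enc_bool ({i, j} \<in> E)) [0..<n])) \<le> 1 + 4 * n" for i
  proof -
    have "(\<Sum>j\<leftarrow>[0..<n]. 1 + tree_size (enc_bool ({i, j} \<in> E))) \<le> (\<Sum>j\<leftarrow>[0..<n]. 4)"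
      using b by (intro sum_list_mono) (simp add: order_trans[OF add_left_mono])
    then show ?thesis by (simp add: tree_size_enc_list comp_def sum_list_triv)
  qed
  have "(\<Sum>i\<leftarrow>[0..<n]. 1 + tree_size (enc_list (map (\<lambda>j. enc_bool ({i, j} \<in> E)) [0..<n])))
      \<le> (\<Sum>i\<leftarrow>[0..<n]. 2 + 4 * n)"
    using row by (intro sum_list_mono) simp
  then show ?thesis by (simp add: tree_size_enc_list[of "map _ _"] comp_def sum_list_triv)
qed

lemma kernel_size:
  "\<exists>p :: nat poly. \<forall>x. valid_inst x \<longrightarrow>
     tree_size (enc_inst (kernel x)) \<le> poly p (fst (param_k_c4 x) + snd (param_k_c4 x))"
proof -
  let ?X = "[:0, 1 :: nat:]"
  \<comment> \<open>With \<open>m = k + c4 E\<close>, the sum \<open>k\<^sup>2 + c4 E\<close> is at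
    most \<open>m\<^sup>2 + m\<close>; \<open>w\<close> bounds the number of vertices, and
    \<open>c\<close> below covers the trivial yes-instance.\<close>
  define w where "w = 1310720 * (?X * (?X ^ 2 + ?X) ^ 2)"
  define c where "c = tree_size (enc_inst ((2, {{0, 1}}), 1))"
  let ?p = "3 + w * (2 + 4 * w) + 2 * ?X + [:c:]"
  have "tree_size (enc_inst (kernel ((n, E), k))) \<le> poly ?p (k + c4 E)"
    if valid: "valid_inst ((n, E), k)" for n E k
  proof -
    have k: "1 \<le> k" using valid by simp
    interpret graph_inst n "\<lambda>u v. {u, v} \<in> E" by (rule graph_inst_of_valid[OF valid])
    note E = edges_of_valid[OF valid]
    define m where "m = k + c4 E"
    show ?thesis
    proof (cases "small n (\<lambda>u v. {u, v} \<in> E) k")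
      case True
      have "k\<^sup>2 \<le> m\<^sup>2" unfolding m_def by (intro power_mono) auto
      moreover have "c4 E \<le> m" unfolding m_def by simp
      ultimately have le: "k\<^sup>2 + c4 E \<le> m\<^sup>2 + m" by linarith
      have "length W \<le> arc_count n (\<lambda>u v. {u, v} \<in> E)" by (rule length_kept_list_le)
      also have "\<dots> \<le> 1310720 * (k * (k\<^sup>2 + c4 E) ^ 2)" using arc_bound[OF k True] unfolding E .
      also have "\<dots> \<le> 1310720 * (m * (m\<^sup>2 + m) ^ 2)"
        using le by (intro mult_le_mono power_mono) (auto simp: m_def)
      also have "\<dots> = poly w m" unfolding w_def by simp
      finally have w: "length W \<le> poly w m" .
      have "length W * (2 + 4 * length W) \<le> poly w m * (2 + 4 * poly w m)"
        using w by (intro mult_le_mono add_le_mono) auto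
      then have "tree_size (enc_inst (kernel ((n, E), k))) \<le> 3 + poly w m * (2 + 4 * poly w m) + 2 * m"
        using True tree_size_enc_graph[of "length W" "kernel_edges n (\<lambda>u v. {u, v} \<in> E)"]
        by (simp add: m_def Let_def del: enc_graph.simps)
      also have "\<dots> \<le> poly ?p m" by simp
      finally show ?thesis unfolding m_def .
    next
      case False
      then show ?thesis by (simp add: c_def del: enc_inst.simps)
    qed
  qed
  then show ?thesis by (intro exI[of _ ?p]) (auto simp del: enc_inst.simps kernel.simps valid_inst.simps)
qed

lemma poly_time_kernel: "poly_time kernel"
proof -
  obtain p where p: "computes_within kernel_tree (\<lambda>x. poly p (tree_size x))"
    "\<And>x. tree_size (kernel_tree x) \<le> poly p (tree_size x)"
    by (rule polytime_E[OF polytime_kernel_tree]) blast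
  obtain c where c: "\<And>x. \<exists>t\<le>poly p (tree_size x) + 2. runs c x t (kernel_tree x)"
    using computes_within_runs[OF p(1)] by blast
  have "\<exists>t. runs c (enc_inst x) t (enc_inst (kernel x)) \<and>
      t + tree_size (enc_inst (kernel x)) \<le> poly (2 * p + 2) (tree_size (enc_inst x))"
    if v: "valid_inst x" for x
  proof -
    obtain t where t: "t \<le> poly p (tree_size (enc_inst x)) + 2" "runs c (enc_inst x) t (kernel_tree (enc_inst x))"
      using c by blast
    then show ?thesis using p(2)[of "enc_inst x"] kernel_tree_enc_inst[OF v]
      by (intro exI[of _ t]) simp
  qed
  then show ?thesis unfolding poly_time_def by blast
qed

section \<open>Deciding by enumeration of words\<close>

text \<open>A matching of size \<open>k\<close> is coded by the word \<open>f 0, \<dots>, f (2 * k - 1)\<close> of its end vertices, edge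
  by edge.  Only these values of \<open>f\<close> matter.\<close>

definition matching_word :: "(nat \<Rightarrow> nat \<Rightarrow> bool) \<Rightarrow> nat \<Rightarrow> (nat \<Rightarrow> nat) \<Rightarrow> bool" where
  "matching_word adj k f \<longleftrightarrow> (\<forall>i<2 * k. \<forall>j<i. f i \<noteq> f j) \<and>
     (\<forall>i<k. adj (f (2 * i)) (f (Suc (2 * i))))"

text \<open>Confining the cycle to end vertices places it in the induced subgraph. The successor
  index is a case distinction rather than \<open>mod\<close>, so that \<open>polytime_nat_if\<close>
  applies.\<close>

definition cycle_word :: "(nat \<Rightarrow> nat \<Rightarrow> bool) \<Rightarrow> nat \<Rightarrow> (nat \<Rightarrow> nat) \<Rightarrow> nat \<Rightarrow> (nat \<Rightarrow> nat) \<Rightarrow> bool" where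
  "cycle_word adj k f l g \<longleftrightarrow> 3 \<le> l \<and> (\<forall>i<l. \<forall>j<i. g i \<noteq> g j) \<and>
     (\<forall>i<l. adj (g i) (g (if Suc i = l then 0 else Suc i)) \<and> (\<exists>j<2 * k. g i = f j))"

definition induced_word :: "(nat \<Rightarrow> nat \<Rightarrow> bool) \<Rightarrow> nat \<Rightarrow> (nat \<Rightarrow> nat) \<Rightarrow> bool" where
  "induced_word adj k f \<longleftrightarrow> (\<forall>i<2 * k. \<forall>j<2 * k. adj (f i) (f j) \<longrightarrow>
     (\<exists>h<k. i = 2 * h \<and> j = Suc (2 * h) \<or> j = 2 * h \<and> i = Suc (2 * h)))"

lemma ordered_distinct_iff:
  "(\<forall>i<l. \<forall>j<i. f i \<noteq> f j) \<longleftrightarrow> inj_on f {..<l :: nat}"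
proof
  assume *: "\<forall>i<l. \<forall>j<i. f i \<noteq> f j"
  show "inj_on f {..<l}"
  proof (rule inj_onI)
    fix i j assume "i \<in> {..<l}" "j \<in> {..<l}" "f i = f j"
    then show "i = j" using *[rule_format, of i j] *[rule_format, of j i] by (cases i j rule: linorder_cases) auto
  qed
next
  assume inj: "inj_on f {..<l}"
  show "\<forall>i<l. \<forall>j<i. f i \<noteq> f j"
  proof (intro allI impI notI)
    fix i j assume "i < l" "j < i" "f i = f j"
    then show False using inj_onD[OF inj, of i j] by simp
  qed
qed

lemma less_double_cases:
  assumes "i < 2 * (k :: nat)"
  obtains h where "h < k" "i = 2 * h" | h where "h < k" "i = Suc (2 * h)"
proof (cases "even i")
  case True
  then obtain h where "i = 2 * h" by (rule evenE)
  then show ?thesis using assms that(1)[of h] by simp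
next
  case False
  then obtain h where "i = 2 * h + 1" by (rule oddE)
  then show ?thesis using assms that(2)[of h] by simp
qed

text \<open>A decoded word reads as 0 beyond its end and agrees with the function it tabulates only
  in range. The congruence rules allow the passage between the two.\<close>

lemma matching_word_cong:
  assumes "\<And>i. i < 2 * k \<Longrightarrow> f i = f' i" "matching_word adj k f"
  shows "matching_word adj k f'"
proof -
  have "f' (2 * i) = f (2 * i)" "f' (Suc (2 * i)) = f (Suc (2 * i))" if "i < k" for i
    using assms(1)[of "2 * i"] assms(1)[of "Suc (2 * i)"] that by auto
  then show ?thesis using assms unfolding matching_word_def by auto
qed

lemma cycle_word_cong:
  assumes "\<And>i. i < l \<Longrightarrow> g i = g' i" "\<And>i. i < 2 * k \<Longrightarrow> f i = f' i" "cycle_word adj k f l g"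
  shows "cycle_word adj k f' l g'"
proof -
  have l: "3 \<le> l" using assms(3) unfolding cycle_word_def by blast
  have "g' (if Suc i = l then 0 else Suc i) = g (if Suc i = l then 0 else Suc i)" if "i < l" for i
    using assms(1)[of 0] assms(1)[of "Suc i"] that l by auto
  moreover have "(\<exists>j<2 * k. x = f' j) \<longleftrightarrow> (\<exists>j<2 * k. x = f j)" for x using assms(2) by auto
  moreover have "g' i = g i" if "i < l" for i using assms(1)[OF that] by simp
  ultimately show ?thesis using assms(3) unfolding cycle_word_def by auto
qed

lemma induced_word_cong:
  assumes "\<And>i. i < 2 * k \<Longrightarrow> f i = f' i" "induced_word adj k f"
  shows "induced_word adj k f'"
  using assms unfolding induced_word_def by metis

section \<open>Matchings and cycles of a fixed graph as words\<close>

context graph_inst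
begin

lemma matching_word_less:
  assumes "matching_word adj k f" "i < 2 * k"
  shows "f i < n"
  using assms(2)
proof (cases rule: less_double_cases)
  case (1 h) then show ?thesis using assms(1) adj_less unfolding matching_word_def by metis
next
  case (2 h) then show ?thesis using assms(1) adj_less unfolding matching_word_def by metis
qed

lemma cycle_word_less:
  assumes "cycle_word adj k f l g" "i < l"
  shows "g i < n"
  using assms adj_less unfolding cycle_word_def by blast

text \<open>Injectivity bounds the length, so that a search through finitely many words finds every
  cycle.\<close>

lemma cycle_word_length:
  assumes "cycle_word adj k f l g"
  shows "l \<le> n"
proof -
  have "inj_on g {..<l}" using assms ordered_distinct_iff unfolding cycle_word_def by blast
  moreover have "g ` {..<l} \<subseteq> {..<n}" using cycle_word_less[OF assms] by blast
  ultimately show ?thesis using card_inj_on_le[of g "{..<l}" "{..<n}"] by simp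
qed

definition word_matching :: "nat \<Rightarrow> (nat \<Rightarrow> nat) \<Rightarrow> nat set set" where
  "word_matching k f = (\<lambda>i. {f (2 * i), f (Suc (2 * i))}) ` {..<k}"

lemma Union_word_matching: "\<Union>(word_matching k f) = f ` {..<2 * k}"
proof (intro set_eqI iffI)
  fix x assume "x \<in> \<Union>(word_matching k f)"
  then obtain i where "i < k" "x = f (2 * i) \<or> x = f (Suc (2 * i))" unfolding word_matching_def by blast
  moreover from this(1) have "2 * i < 2 * k" "Suc (2 * i) < 2 * k" by auto
  ultimately show "x \<in> f ` {..<2 * k}" by blast
next
  fix x assume "x \<in> f ` {..<2 * k}"
  then obtain i where i: "i < 2 * k" "x = f i" by blast
  from i(1) show "x \<in> \<Union>(word_matching k f)"
    by (cases rule: less_double_cases) (auto simp: word_matching_def i(2))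
qed

lemma word_matching_disjoint:
  assumes "inj_on f {..<2 * k}" "i < k" "j < k" "i \<noteq> j"
  shows "{f (2 * i), f (Suc (2 * i))} \<inter> {f (2 * j), f (Suc (2 * j))} = {}"
proof -
  have neq: "f a \<noteq> f b" if "a < 2 * k" "b < 2 * k" "a \<noteq> b" for a b
    using assms(1) that by (auto dest: inj_onD)
  have "2 * i \<noteq> Suc (2 * j)" "Suc (2 * i) \<noteq> 2 * j" by presburger+
  then show ?thesis using assms(2-4) neq[of "2 * i" "2 * j"] neq[of "2 * i" "Suc (2 * j)"]
      neq[of "Suc (2 * i)" "2 * j"] neq[of "Suc (2 * i)" "Suc (2 * j)"] by simp
qed

lemma matching_word_matching:
  assumes "matching_word adj k f"
  shows "matching edges (word_matching k f)" "card (word_matching k f) = k"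
proof -
  have inj: "inj_on f {..<2 * k}" using assms ordered_distinct_iff unfolding matching_word_def by blast
  show "matching edges (word_matching k f)" unfolding matching_def
  proof (intro conjI ballI impI)
    show "word_matching k f \<subseteq> edges"
      using assms unfolding word_matching_def matching_word_def by (auto simp: edges_iff)
    fix e e' assume "e \<in> word_matching k f" "e' \<in> word_matching k f" "e \<noteq> e'"
    then obtain i j where ij: "i < k" "j < k" "e = {f (2 * i), f (Suc (2 * i))}"
      "e' = {f (2 * j), f (Suc (2 * j))}" unfolding word_matching_def by auto
    moreover from this \<open>e \<noteq> e'\<close> have "i \<noteq> j" by auto
    ultimately show "e \<inter> e' = {}" using word_matching_disjoint[OF inj] by simp
  qed
  have "inj_on (\<lambda>i. {f (2 * i), f (Suc (2 * i))}) {..<k}"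
  proof (rule inj_onI, rule ccontr)
    fix i j assume "i \<in> {..<k}" "j \<in> {..<k}" "i \<noteq> j"
      "{f (2 * i), f (Suc (2 * i))} = {f (2 * j), f (Suc (2 * j))}"
    then show False using word_matching_disjoint[OF inj, of i j] by simp
  qed
  then show "card (word_matching k f) = k" unfolding word_matching_def by (simp add: card_image)
qed

lemma ex_matching_word:
  assumes M: "matching edges M" and k: "card M = k"
  shows "\<exists>f. matching_word adj k f \<and> M = word_matching k f"
proof -
  have sub: "M \<subseteq> edges" using M unfolding matching_def by blast
  then have "finite M" using finite_edges finite_subset by blast
  then obtain e where e: "bij_betw e {..<k} M"
    using ex_bij_betw_nat_finite[of M] k by (auto simp: atLeast0LessThan)
  have "\<exists>a b. e i = {a, b} \<and> adj a b" if i: "i < k" for i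
  proof -
    have "e i \<in> edges" using e sub i unfolding bij_betw_def by blast
    then show ?thesis unfolding edges_def by blast
  qed
  then obtain a b where ab: "\<And>i. i < k \<Longrightarrow> e i = {a i, b i}" "\<And>i. i < k \<Longrightarrow> adj (a i) (b i)" by metis
  define f where "f i = (if even i then a (i div 2) else b (i div 2))" for i
  have f: "f (2 * i) = a i" "f (Suc (2 * i)) = b i" for i unfolding f_def by auto
  have disj: "e i \<inter> e j = {}" if "i < k" "j < k" "i \<noteq> j" for i j
  proof -
    have "e i \<noteq> e j" using e that unfolding bij_betw_def by (auto dest: inj_onD)
    moreover have "e i \<in> M" "e j \<in> M" using e that unfolding bij_betw_def by auto
    ultimately show ?thesis using M unfolding matching_def by blast
  qed
  have mem: "f i \<in> e (i div 2)" "i div 2 < k" if "i < 2 * k" for i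
  proof -
    show "i div 2 < k" using that by simp
    then show "f i \<in> e (i div 2)" using ab(1) unfolding f_def by simp
  qed
  have "inj_on f {..<2 * k}"
  proof (rule inj_onI)
    fix i j assume ij: "i \<in> {..<2 * k}" "j \<in> {..<2 * k}" "f i = f j"
    \<comment> \<open>Edges of different index are disjoint, so equal values come from the same
      edge; its two ends differ, so the parities agree as well.\<close>
    then have "i div 2 = j div 2" using mem[of i] mem[of j] disj[of "i div 2" "j div 2"] by auto
    moreover have "a (i div 2) \<noteq> b (i div 2)" using ab(2)[OF mem(2)] ij adj_irrefl by (metis lessThan_iff)
    ultimately have "even i \<longleftrightarrow> even j" using ij(3) unfolding f_def by (auto split: if_splits)
    then show "i = j" using \<open>i div 2 = j div 2\<close>
      by (metis bit_eq_rec)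
  qed
  then have "matching_word adj k f"
    unfolding matching_word_def ordered_distinct_iff using ab(2) f by simp
  moreover have "M = word_matching k f"
  proof -
    have "M = e ` {..<k}" using e unfolding bij_betw_def by simp
    also have "\<dots> = word_matching k f" unfolding word_matching_def
      by (rule image_cong) (auto simp: ab(1) f)
    finally show ?thesis .
  qed
  ultimately show ?thesis by blast
qed

lemma acyclic_iff_no_cycle_word:
  "acyclic_graph (induced_edges edges (f ` {..<2 * k})) \<longleftrightarrow> \<not> (\<exists>l g. cycle_word adj k f l g)"
proof -
  have mod: "Suc i mod l = (if Suc i = l then 0 else Suc i)" if "i < l" for i l :: nat
    using that by simp
  have "\<exists>l g. cycle_word adj k f l g" if "is_cycle (induced_edges edges (f ` {..<2 * k})) p" for p
  proof -
    have p: "3 \<le> length p" "distinct p"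
      "\<And>i. i < length p \<Longrightarrow> {p ! i, p ! (Suc i mod length p)} \<in> induced_edges edges (f ` {..<2 * k})"
      using that unfolding is_cycle_def cycle_edges_subset_iff by blast+
    have "inj_on ((!) p) {..<length p}" using p(2) by (simp add: inj_on_nth)
    moreover have "adj (p ! i) (p ! (if Suc i = length p then 0 else Suc i)) \<and> (\<exists>j<2 * k. p ! i = f j)"
      if i: "i < length p" for i
      using p(3)[OF i] unfolding mod[OF i] induced_edges_def mem_Collect_eq edges_iff by auto
    ultimately have "cycle_word adj k f (length p) ((!) p)"
      unfolding cycle_word_def ordered_distinct_iff using p(1) by blast
    then show ?thesis by blast
  qed
  moreover have "\<exists>p. is_cycle (induced_edges edges (f ` {..<2 * k})) p" if c: "cycle_word adj k f l g" for l g
  proof -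
    define p where "p = map g [0..<l]"
    have len: "length p = l" unfolding p_def by simp
    have nth: "p ! i = g i" if "i < l" for i using that unfolding p_def by simp
    have l: "3 \<le> l" and inj: "inj_on g {..<l}"
      and adj: "\<And>i. i < l \<Longrightarrow> adj (g i) (g (if Suc i = l then 0 else Suc i))"
      and mem: "\<And>i. i < l \<Longrightarrow> g i \<in> f ` {..<2 * k}"
      using c unfolding cycle_word_def ordered_distinct_iff by blast+
    have "distinct p" unfolding p_def using inj by (simp add: distinct_map atLeast0LessThan)
    moreover have "{p ! i, p ! (Suc i mod length p)} \<in> induced_edges edges (f ` {..<2 * k})"
      if i: "i < length p" for i
    proof -
      have i': "i < l" "(if Suc i = l then 0 else Suc i) < l" using i len by auto
      show ?thesis unfolding len mod[OF i'(1)] nth[OF i'(1)] nth[OF i'(2)] induced_edges_def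
        using adj[OF i'(1)] mem[OF i'(1)] mem[OF i'(2)] by (simp only: mem_Collect_eq edges_iff) simp
    qed
    ultimately have "is_cycle (induced_edges edges (f ` {..<2 * k})) p"
      unfolding is_cycle_def cycle_edges_subset_iff using l len by simp
    then show ?thesis by blast
  qed
  ultimately show ?thesis unfolding acyclic_graph_def by blast
qed

lemma ex_acyclic_matching_iff:
  "(\<exists>M. acyclic_matching edges M \<and> card M = k)
     \<longleftrightarrow> (\<exists>f. matching_word adj k f \<and> \<not> (\<exists>l g. cycle_word adj k f l g))"
proof
  assume "\<exists>M. acyclic_matching edges M \<and> card M = k"
  then obtain M where M: "matching edges M" "acyclic_graph (induced_edges edges (\<Union>M))" "card M = k"
    unfolding acyclic_matching_def by blast
  obtain f where f: "matching_word adj k f" "M = word_matching k f" using ex_matching_word[OF M(1,3)] by blast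
  then show "\<exists>f. matching_word adj k f \<and> \<not> (\<exists>l g. cycle_word adj k f l g)"
    using M(2) unfolding f(2) Union_word_matching acyclic_iff_no_cycle_word by blast
next
  assume "\<exists>f. matching_word adj k f \<and> \<not> (\<exists>l g. cycle_word adj k f l g)"
  then obtain f where f: "matching_word adj k f" "\<not> (\<exists>l g. cycle_word adj k f l g)" by blast
  then have "acyclic_matching edges (word_matching k f)"
    unfolding acyclic_matching_def Union_word_matching acyclic_iff_no_cycle_word
    using matching_word_matching(1) by blast
  then show "\<exists>M. acyclic_matching edges M \<and> card M = k" using matching_word_matching(2)[OF f(1)] by blast
qed

text \<open>The matching is contained in the finite set of induced edges, so equal cardinality means
  that no further edge is induced.\<close>

lemma induced_word_iff:
  assumes f: "matching_word adj k f"
  shows "card (induced_edges edges (\<Union>(word_matching k f))) = card (word_matching k f) \<longleftrightarrow> induced_word adj k f"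
proof -
  let ?M = "word_matching k f" and ?I = "induced_edges edges (\<Union>(word_matching k f))"
  have inj: "inj_on f {..<2 * k}" using f ordered_distinct_iff unfolding matching_word_def by blast
  have fin: "finite ?I" using finite_edges unfolding induced_edges_def by simp
  have "?M \<subseteq> edges" using matching_word_matching(1)[OF f] unfolding matching_def by blast
  then have sub: "?M \<subseteq> ?I" unfolding induced_edges_def by blast
  have "card ?I = card ?M \<longleftrightarrow> ?I \<subseteq> ?M"
    using sub fin card_subset_eq[OF fin sub] by auto
  also have "\<dots> \<longleftrightarrow> induced_word adj k f"
  proof
    assume I: "?I \<subseteq> ?M"
    show "induced_word adj k f" unfolding induced_word_def
    proof (intro allI impI)
      fix i j assume ij: "i < 2 * k" "j < 2 * k" "adj (f i) (f j)"
      then have "{f i, f j} \<in> ?I" unfolding induced_edges_def Union_word_matching by (simp add: edges_iff)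
      then have "{f i, f j} \<in> ?M" using I by blast
      then obtain h where h: "h < k" "{f i, f j} = {f (2 * h), f (Suc (2 * h))}"
        unfolding word_matching_def by blast
      have eq: "a = b" if "f a = f b" "a < 2 * k" "b < 2 * k" for a b
        using inj that by (auto dest: inj_onD)
      have "2 * h < 2 * k" "Suc (2 * h) < 2 * k" using h(1) by auto
      then show "\<exists>h<k. i = 2 * h \<and> j = Suc (2 * h) \<or> j = 2 * h \<and> i = Suc (2 * h)"
        using h(1) h(2)[unfolded doubleton_eq_iff] eq ij(1,2) by metis
    qed
  next
    assume w: "induced_word adj k f"
    show "?I \<subseteq> ?M"
    proof
      fix e assume "e \<in> ?I"
      then have e: "e \<in> edges" "e \<subseteq> f ` {..<2 * k}" unfolding induced_edges_def Union_word_matching by auto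
      obtain a b where ab: "e = {a, b}" "adj a b" using e(1) unfolding edges_def by blast
      then obtain i j where ij: "i < 2 * k" "j < 2 * k" "a = f i" "b = f j" using e(2) by auto
      then obtain h where "h < k" "i = 2 * h \<and> j = Suc (2 * h) \<or> j = 2 * h \<and> i = Suc (2 * h)"
        using w ab(2) unfolding induced_word_def by blast
      then show "e \<in> ?M" unfolding word_matching_def ab(1) ij(3,4) by (auto simp: insert_commute)
    qed
  qed
  finally show ?thesis .
qed

lemma ex_induced_matching_iff:
  "(\<exists>M. induced_matching edges M \<and> card M = k) \<longleftrightarrow> (\<exists>f. matching_word adj k f \<and> induced_word adj k f)"
proof
  assume "\<exists>M. induced_matching edges M \<and> card M = k"
  then obtain M where M: "matching edges M" "card (induced_edges edges (\<Union>M)) = card M" "card M = k"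
    unfolding induced_matching_def by blast
  obtain f where f: "matching_word adj k f" "M = word_matching k f" using ex_matching_word[OF M(1,3)] by blast
  then show "\<exists>f. matching_word adj k f \<and> induced_word adj k f"
    using M(2) induced_word_iff[OF f(1)] by blast
next
  assume "\<exists>f. matching_word adj k f \<and> induced_word adj k f"
  then obtain f where f: "matching_word adj k f" "induced_word adj k f" by blast
  then have "induced_matching edges (word_matching k f)"
    unfolding induced_matching_def using matching_word_matching(1) induced_word_iff by blast
  then show "\<exists>M. induced_matching edges M \<and> card M = k" using matching_word_matching(2)[OF f(1)] by blast
qed

end

text \<open>The trivial filter makes the inner list an instance of \<open>polytime_map_filter_upt\<close>.\<close>

definition extend_words :: "tree \<Rightarrow> tree \<Rightarrow> tree" where
  "extend_words x a = Node Leaf (enc_list (concat (map (\<lambda>w. items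
     (enc_list (map (\<lambda>i. Node (enc_nat i) w) (filter (\<lambda>_. True) [0..<nat_of (tree_fst x)])))) (items a))))"

text \<open>Matchings need words of length \<open>2 * k\<close>, cycles words of length up to
  \<open>n\<close>; the sum serves both. Every round also puts back the empty word, so shorter words
  persist.\<close>

definition words_tree :: "tree \<Rightarrow> tree" where
  "words_tree x = foldl (\<lambda>a _. extend_words x a) (Node Leaf Leaf)
     (items (enc_nat (nat_of (tree_fst x) + 2 * nat_of (tree_snd x))))"

lemma set_items_extend_words:
  "set (items (extend_words x a)) = insert Leaf
     {Node (enc_nat i) w | i w. i < nat_of (tree_fst x) \<and> w \<in> set (items a)}"
  unfolding extend_words_def by auto

lemma set_items_words:
  "set (items (foldl (\<lambda>a _. extend_words x a) (Node Leaf Leaf) ys))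
     = {enc_list (map enc_nat w) | w. length w \<le> length ys \<and> set w \<subseteq> {..<nat_of (tree_fst x)}}"
proof (induction ys rule: rev_induct)
  case Nil
  then show ?case by auto
next
  case (snoc y ys)
  have "{enc_list (map enc_nat w) | w. length w \<le> Suc (length ys) \<and> set w \<subseteq> {..<nat_of (tree_fst x)}}
      = insert Leaf {Node (enc_nat i) u | i u. i < nat_of (tree_fst x) \<and>
          u \<in> {enc_list (map enc_nat w) | w. length w \<le> length ys \<and> set w \<subseteq> {..<nat_of (tree_fst x)}}}"
    (is "?L = ?R")
  proof (intro set_eqI iffI)
    fix t assume "t \<in> ?L"
    then obtain w where w: "t = enc_list (map enc_nat w)" "length w \<le> Suc (length ys)"
      "set w \<subseteq> {..<nat_of (tree_fst x)}" by blast
    show "t \<in> ?R"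
    proof (cases w)
      case (Cons i u)
      then have "t = Node (enc_nat i) (enc_list (map enc_nat u))" "i < nat_of (tree_fst x)"
        "length u \<le> length ys" "set u \<subseteq> {..<nat_of (tree_fst x)}" using w by auto
      then show ?thesis by blast
    qed (use w in simp)
  next
    fix t assume "t \<in> ?R"
    then consider "t = Leaf" | i w where "t = Node (enc_nat i) (enc_list (map enc_nat w))"
      "i < nat_of (tree_fst x)" "length w \<le> length ys" "set w \<subseteq> {..<nat_of (tree_fst x)}" by blast
    then show "t \<in> ?L"
    proof cases
      case 1 then show ?thesis by (intro CollectI exI[of _ "[]"]) simp
    next
      case (2 i w) then show ?thesis by (intro CollectI exI[of _ "i # w"]) simp
    qed
  qed
  then show ?case using snoc by (simp add: set_items_extend_words)
qed

text \<open>Each word yields one longer word per vertex, and both the number and the growth are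
  linear in \<open>tree_size x\<close>. A bound without additive term iterates to a power.\<close>

lemma tree_size_extend_words:
  "tree_size (extend_words x a) \<le> 10 * tree_size x * tree_size x * tree_size a"
proof -
  define s where "s = tree_size x"
  define n where "n = nat_of (tree_fst x)"
  have s: "1 \<le> s" unfolding s_def by (rule tree_size_pos)
  have n: "n \<le> s" unfolding n_def s_def nat_of_def
    using length_items_le[of "tree_fst x"] tree_size_fst_le[of x] by (rule order_trans)
  have ss: "s \<le> s * s" using s by simp
  let ?g = "\<lambda>w. enc_list (map (\<lambda>i. Node (enc_nat i) w) (filter (\<lambda>_. True) [0..<n]))"
  have g: "tree_size (?g w) \<le> 7 * (s * s) * (1 + tree_size w)" for w
  proof -
    have "(\<Sum>i\<leftarrow>[0..<n]. 1 + tree_size (Node (enc_nat i) w)) \<le> (\<Sum>i\<leftarrow>[0..<n]. 3 + 2 * n + tree_size w)"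
      by (rule sum_list_mono) auto
    then have "tree_size (?g w) \<le> 1 + n * (3 + 2 * n + tree_size w)"
      by (simp add: tree_size_enc_list comp_def sum_list_triv)
    also have "\<dots> \<le> 1 + s * (3 + 2 * s + tree_size w)" using n by (intro add_le_mono mult_le_mono) auto
    also have "\<dots> = 1 + 3 * s + 2 * (s * s) + s * tree_size w" by (simp add: algebra_simps)
    also have "\<dots> \<le> s * s + 3 * (s * s) + 2 * (s * s) + (s * s) * tree_size w"
      using ss s by (intro add_le_mono mult_le_mono) auto
    also have "\<dots> \<le> 7 * (s * s) * (1 + tree_size w)" by (simp add: algebra_simps)
    finally show ?thesis .
  qed
  have "tree_size (extend_words x a) \<le> 3 + (\<Sum>w\<leftarrow>items a. tree_size (?g w))"
    unfolding extend_words_def n_def[symmetric]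
    using tree_size_enc_list_concat[of ?g "items a"] by simp
  also have "(\<Sum>w\<leftarrow>items a. tree_size (?g w)) \<le> (\<Sum>w\<leftarrow>items a. 7 * (s * s) * (1 + tree_size w))"
    by (rule sum_list_mono) (rule g)
  also have "\<dots> = 7 * (s * s) * (\<Sum>w\<leftarrow>items a. 1 + tree_size w)" by (rule sum_list_const_mult)
  also have "\<dots> \<le> 7 * (s * s) * tree_size a" by (intro mult_le_mono) (auto simp: tree_size_items[of a])
  \<comment> \<open>The 3 pays for the empty word in front and the end of the list; it is absorbed
    because the product is at least 1.\<close>
  also have "3 + 7 * (s * s) * tree_size a \<le> 10 * s * s * tree_size a"
  proof -
    have "1 * 1 * 1 \<le> s * s * tree_size a" using s tree_size_pos[of a] by (intro mult_le_mono)
    then show ?thesis by (simp add: algebra_simps)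
  qed
  finally show ?thesis unfolding s_def by simp
qed

text \<open>The factor 3 is the size of the initial list \<open>Node Leaf Leaf\<close>; the exponent
  \<open>3 * s\<close> bounds the number \<open>n + 2 * k\<close> of rounds.\<close>

definition words_bound :: "nat \<Rightarrow> nat" where
  "words_bound s = 3 * (10 * s * s) ^ (3 * s)"

lemma words_bound_mono:
  assumes "s \<le> t" shows "words_bound s \<le> words_bound t"
proof (cases "t = 0")
  case False
  have "(10 * s * s) ^ (3 * s) \<le> (10 * t * t) ^ (3 * s)"
    using assms by (intro power_mono mult_le_mono) auto
  also have "\<dots> \<le> (10 * t * t) ^ (3 * t)"
    using assms False by (intro power_increasing) auto
  finally show ?thesis unfolding words_bound_def by simp
qed (use assms in simp)

lemma tree_size_words:
  assumes "items (enc_nat (nat_of (tree_fst x) + 2 * nat_of (tree_snd x))) = ys @ zs"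
  shows "tree_size (foldl (\<lambda>a _. extend_words x a) (Node Leaf Leaf) ys) \<le> words_bound (tree_size x)"
proof -
  let ?s = "tree_size x"
  have s: "1 \<le> ?s" by (rule tree_size_pos)
  have "nat_of (tree_fst x) \<le> ?s" "nat_of (tree_snd x) \<le> ?s"
    using order_trans[OF length_items_le tree_size_fst_le] order_trans[OF length_items_le tree_size_snd_le]
    unfolding nat_of_def by auto
  moreover have "length ys \<le> nat_of (tree_fst x) + 2 * nat_of (tree_snd x)"
    using arg_cong[OF assms, of length] by simp
  ultimately have len: "length ys \<le> 3 * ?s" by linarith
  have "tree_size (foldl (\<lambda>a _. extend_words x a) (Node Leaf Leaf) ys) \<le> 3 * (10 * ?s * ?s) ^ length ys"
  proof (induction ys rule: rev_induct)
    case (snoc y ys)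
    have "tree_size (foldl (\<lambda>a _. extend_words x a) (Node Leaf Leaf) (ys @ [y]))
        \<le> 10 * ?s * ?s * tree_size (foldl (\<lambda>a _. extend_words x a) (Node Leaf Leaf) ys)"
      by (simp add: tree_size_extend_words)
    also have "\<dots> \<le> 10 * ?s * ?s * (3 * (10 * ?s * ?s) ^ length ys)"
      using snoc by (rule mult_le_mono2)
    finally show ?case by simp
  qed simp
  also have "\<dots> \<le> 3 * (10 * ?s * ?s) ^ (3 * ?s)"
    using len s by (intro mult_le_mono2 power_increasing) auto
  finally show ?thesis unfolding words_bound_def .
qed

lemma polytime_extend_words: "polytime (\<lambda>z. extend_words (tree_fst (tree_fst z)) (tree_snd (tree_fst z)))"
  unfolding extend_words_def by (intro polytime_intros polytime_concat_map)

lemma computes_within_words_tree: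
  "\<exists>p :: nat poly. computes_within words_tree (\<lambda>x. poly p (tree_size x + words_bound (tree_size x)))"
proof -
  have "polytime (\<lambda>_. Node Leaf Leaf)" "polytime (\<lambda>x. enc_nat (nat_of (tree_fst x) + 2 * nat_of (tree_snd x)))"
    by (intro polytime_intros)+
  from computes_within_foldl[where g = "\<lambda>x a _. extend_words x a", OF polytime_extend_words this] obtain p :: "nat poly"
    where p: "\<And>B. (\<forall>x ys zs. items (enc_nat (nat_of (tree_fst x) + 2 * nat_of (tree_snd x))) = ys @ zs \<longrightarrow>
      tree_size (foldl (\<lambda>a _. extend_words x a) (Node Leaf Leaf) ys) \<le> B (tree_size x)) \<Longrightarrow>
      computes_within words_tree (\<lambda>x. poly p (tree_size x + B (tree_size x)))"
    unfolding words_tree_def[abs_def] by blast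
  show ?thesis using p[of words_bound] tree_size_words by blast
qed

lemma tree_size_words_tree: "tree_size (words_tree x) \<le> words_bound (tree_size x)"
  unfolding words_tree_def using tree_size_words[of x _ "[]"] by simp

text \<open>The word list is part of \<open>z\<close>, so the search is polynomial in its input and
  the exponential cost is confined to producing the list. The same list supplies matchings and
  cycles.\<close>

definition decide_acyclic :: "tree \<Rightarrow> bool" where
  "decide_acyclic z \<longleftrightarrow> (\<exists>w\<in>set (items (tree_snd z)).
     nat_of w = 2 * nat_of (tree_snd (tree_fst z)) \<and>
     matching_word (tree_adj (tree_fst (tree_fst z))) (nat_of (tree_snd (tree_fst z))) (\<lambda>i. nat_of (item i w)) \<and>
     \<not> (\<exists>p\<in>set (items (tree_snd z)). cycle_word (tree_adj (tree_fst (tree_fst z)))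
          (nat_of (tree_snd (tree_fst z))) (\<lambda>i. nat_of (item i w)) (nat_of p) (\<lambda>i. nat_of (item i p))))"

definition decide_induced :: "tree \<Rightarrow> bool" where
  "decide_induced z \<longleftrightarrow> (\<exists>w\<in>set (items (tree_snd z)).
     nat_of w = 2 * nat_of (tree_snd (tree_fst z)) \<and>
     matching_word (tree_adj (tree_fst (tree_fst z))) (nat_of (tree_snd (tree_fst z))) (\<lambda>i. nat_of (item i w)) \<and>
     induced_word (tree_adj (tree_fst (tree_fst z))) (nat_of (tree_snd (tree_fst z))) (\<lambda>i. nat_of (item i w)))"

lemma polytime_pred_decide_acyclic: "polytime_pred decide_acyclic"
  unfolding decide_acyclic_def[abs_def] matching_word_def cycle_word_def
  by (intro polytime_intros polytime_pred_tree_adj)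

lemma polytime_pred_decide_induced: "polytime_pred decide_induced"
  unfolding decide_induced_def[abs_def] matching_word_def induced_word_def
  by (intro polytime_intros polytime_pred_tree_adj)

text \<open>Tabulating \<open>f\<close> on its first \<open>l\<close> values gives a listed word,
  and by \<open>cong\<close> the predicate cannot tell the two apart.\<close>

lemma ex_word_iff:
  assumes ws: "set (items ws) = {enc_list (map enc_nat w) | w. length w \<le> N \<and> set w \<subseteq> {..<n}}"
    and cong: "\<And>l f g. (\<And>i. i < l \<Longrightarrow> f i = g i) \<Longrightarrow> P l f \<Longrightarrow> P l g"
    and bounds: "\<And>l f i. P l f \<Longrightarrow> i < l \<Longrightarrow> f i < n" "\<And>l f. P l f \<Longrightarrow> l \<le> N"
  shows "(\<exists>w\<in>set (items ws). P (nat_of w) (\<lambda>i. nat_of (item i w))) \<longleftrightarrow> (\<exists>l f. P l f)"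
proof
  assume "\<exists>l f. P l f"
  then obtain l f where P: "P l f" by blast
  define w where "w = enc_list (map enc_nat (map f [0..<l]))"
  have "set (map f [0..<l]) \<subseteq> {..<n}" using bounds(1)[OF P] by auto
  then have "w \<in> set (items ws)" unfolding ws w_def using bounds(2)[OF P]
    by (intro CollectI exI[of _ "map f [0..<l]"]) simp
  moreover have "nat_of w = l" unfolding w_def nat_of_def by simp
  moreover have "P l (\<lambda>i. nat_of (item i w))"
    by (rule cong[OF _ P]) (simp add: w_def item_enc_list)
  ultimately show "\<exists>w\<in>set (items ws). P (nat_of w) (\<lambda>i. nat_of (item i w))" by auto
qed blast

lemma decide_correct:
  assumes "valid_inst x"
  shows "decide_acyclic (Node (enc_inst x) (words_tree (enc_inst x))) \<longleftrightarrow> Acyclic_Matching x"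
    and "decide_induced (Node (enc_inst x) (words_tree (enc_inst x))) \<longleftrightarrow> Induced_Matching x"
proof -
  obtain n E k where x: "x = ((n, E), k)" by (cases x) auto
  have valid: "valid_inst ((n, E), k)" using assms x by simp
  interpret graph_inst n "\<lambda>u v. {u, v} \<in> E" by (rule graph_inst_of_valid[OF valid])
  note E = edges_of_valid[OF valid]
  let ?adj = "\<lambda>u v. {u, v} \<in> E"
  define ws where "ws = words_tree (enc_inst x)"
  have ws: "set (items ws) = {enc_list (map enc_nat w) | w. length w \<le> n + 2 * k \<and> set w \<subseteq> {..<n}}"
    unfolding ws_def words_tree_def set_items_words by (simp add: x nat_of_enc_graph del: enc_graph.simps)
  have cyc: "(\<exists>p\<in>set (items ws). cycle_word ?adj k f (nat_of p) (\<lambda>i. nat_of (item i p)))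
      \<longleftrightarrow> (\<exists>l g. cycle_word ?adj k f l g)" for f
    by (rule ex_word_iff[OF ws, where P = "cycle_word ?adj k f"])
      (use cycle_word_cong cycle_word_less cycle_word_length in \<open>blast, blast, fastforce intro: trans_le_add1\<close>)
  have "decide_acyclic (Node (enc_inst x) ws) \<longleftrightarrow> (\<exists>w\<in>set (items ws). nat_of w = 2 * k \<and>
      matching_word ?adj k (\<lambda>i. nat_of (item i w)) \<and> \<not> (\<exists>l g. cycle_word ?adj k (\<lambda>i. nat_of (item i w)) l g))"
    unfolding decide_acyclic_def cyc[symmetric]
    by (simp add: x tree_adj_enc_graph[OF valid] del: enc_graph.simps)
  also have "\<dots> \<longleftrightarrow> (\<exists>l f. l = 2 * k \<and> matching_word ?adj k f \<and> \<not> (\<exists>l g. cycle_word ?adj k f l g))"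
  proof (rule ex_word_iff[OF ws, where P = "\<lambda>l f. l = 2 * k \<and> matching_word ?adj k f \<and>
      \<not> (\<exists>l g. cycle_word ?adj k f l g)"])
    fix l :: nat and f g :: "nat \<Rightarrow> nat"
    assume fg: "\<And>i. i < l \<Longrightarrow> f i = g i"
      and f: "l = 2 * k \<and> matching_word ?adj k f \<and> \<not> (\<exists>l g. cycle_word ?adj k f l g)"
    have eq: "i < 2 * k \<Longrightarrow> f i = g i" "i < 2 * k \<Longrightarrow> g i = f i" for i using fg f by simp_all
    have "matching_word ?adj k g" using matching_word_cong[of k f g, OF eq(1)] f by blast
    \<comment> \<open>The condition is negative, so the congruence is used backwards, from
      \<open>g\<close> to \<open>f\<close>.\<close>
    moreover have "\<not> cycle_word ?adj k g l h" for l h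
      using cycle_word_cong[of l h h k g f, OF refl eq(2)] f by blast
    ultimately show "l = 2 * k \<and> matching_word ?adj k g \<and> \<not> (\<exists>l h. cycle_word ?adj k g l h)"
      using f by blast
  qed (auto simp: matching_word_less)
  also have "\<dots> \<longleftrightarrow> Acyclic_Matching x"
    using ex_acyclic_matching_iff[of k] unfolding E x by simp
  finally show "decide_acyclic (Node (enc_inst x) (words_tree (enc_inst x))) \<longleftrightarrow> Acyclic_Matching x"
    unfolding ws_def .
  have "decide_induced (Node (enc_inst x) ws) \<longleftrightarrow> (\<exists>w\<in>set (items ws). nat_of w = 2 * k \<and>
      matching_word ?adj k (\<lambda>i. nat_of (item i w)) \<and> induced_word ?adj k (\<lambda>i. nat_of (item i w)))"
    unfolding decide_induced_def
    by (simp add: x tree_adj_enc_graph[OF valid] del: enc_graph.simps)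
  also have "\<dots> \<longleftrightarrow> (\<exists>l f. l = 2 * k \<and> matching_word ?adj k f \<and> induced_word ?adj k f)"
  proof (rule ex_word_iff[OF ws, where P = "\<lambda>l f. l = 2 * k \<and> matching_word ?adj k f \<and> induced_word ?adj k f"])
    fix l :: nat and f g :: "nat \<Rightarrow> nat"
    assume fg: "\<And>i. i < l \<Longrightarrow> f i = g i" and f: "l = 2 * k \<and> matching_word ?adj k f \<and> induced_word ?adj k f"
    then have eq: "i < 2 * k \<Longrightarrow> f i = g i" for i by simp
    show "l = 2 * k \<and> matching_word ?adj k g \<and> induced_word ?adj k g"
      using f matching_word_cong[of k f g, OF eq] induced_word_cong[of k f g, OF eq] by blast
  qed (auto simp: matching_word_less)
  also have "\<dots> \<longleftrightarrow> Induced_Matching x"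
    using ex_induced_matching_iff[of k] unfolding E x by simp
  finally show "decide_induced (Node (enc_inst x) (words_tree (enc_inst x))) \<longleftrightarrow> Induced_Matching x"
    unfolding ws_def .
qed

section \<open>Computing the parameter-dependent factor\<close>

lemma polytime_nat_poly: "polytime_nat h \<Longrightarrow> polytime_nat (\<lambda>x. poly p (h x))"
proof (induction p)
  case (pCons a p)
  have "polytime_nat (\<lambda>x. a + h x * poly p (h x))" by (intro polytime_nat_add polytime_nat_const polytime_nat_mult pCons)
  then show ?case by simp
qed (simp add: polytime_nat_const)

text \<open>In unary a power can be exponentially long, which rules out polynomial time; some time
  bound is enough, as \<open>computable\<close> asks for termination only.\<close>

lemma computes_within_power:
  assumes b: "polytime_nat b" and e: "polytime_nat e"
  shows "\<exists>T. computes_within (\<lambda>x. enc_nat (b x ^ e x)) T"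
proof -
  obtain p where p: "\<And>x. tree_size (enc_nat (b x)) \<le> poly p (tree_size x)"
    by (rule polytime_size_bound[OF b[unfolded polytime_nat_def]]) blast
  obtain q where q: "\<And>x. tree_size (enc_nat (e x)) \<le> poly q (tree_size x)"
    by (rule polytime_size_bound[OF e[unfolded polytime_nat_def]]) blast
  let ?step = "\<lambda>x a (y :: tree). enc_nat (nat_of a * b x)"
  have fold: "foldl (?step x) (enc_nat 1) ys = enc_nat (b x ^ length ys)" for x ys
    by (induction ys rule: rev_induct) (simp_all add: mult.commute)
  have "polytime (\<lambda>z. enc_nat (b (tree_fst (tree_fst z))))"
    using polytime_compose[OF polytime_fst[OF polytime_fst[OF polytime_id]] b[unfolded polytime_nat_def]] .
  then have b': "polytime_nat (\<lambda>z. b (tree_fst (tree_fst z)))" by (simp add: polytime_nat_def)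
  have step: "polytime (\<lambda>z. enc_nat (nat_of (tree_snd (tree_fst z)) * b (tree_fst (tree_fst z))))"
    by (intro polytime_enc_nat polytime_nat_mult polytime_nat_nat_of polytime_snd polytime_fst polytime_id b')
  let ?B = "\<lambda>s. 2 * (poly p s) ^ (poly q s) + 1"
  have bound: "tree_size (foldl (?step x) (enc_nat 1) ys) \<le> ?B (tree_size x)"
    if ys: "items (enc_nat (e x)) = ys @ zs" for x ys zs
  proof -
    have "length ys \<le> e x" using arg_cong[OF ys, of length] by simp
    then have len: "length ys \<le> poly q (tree_size x)" using q[of x] by simp
    have p1: "b x \<le> poly p (tree_size x)" "1 \<le> poly p (tree_size x)" using p[of x] by simp_all
    have "b x ^ length ys \<le> poly p (tree_size x) ^ length ys" using p1(1) by (rule power_mono) simp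
    also have "\<dots> \<le> poly p (tree_size x) ^ poly q (tree_size x)" using len p1(2) by (rule power_increasing)
    finally show ?thesis unfolding fold by simp
  qed
  obtain r where r: "\<And>B. (\<forall>x ys zs. items (enc_nat (e x)) = ys @ zs \<longrightarrow>
      tree_size (foldl (?step x) (enc_nat 1) ys) \<le> B (tree_size x)) \<Longrightarrow>
      computes_within (\<lambda>x. foldl (?step x) (enc_nat 1) (items (enc_nat (e x)))) (\<lambda>x. poly r (tree_size x + B (tree_size x)))"
    using computes_within_foldl[where g = ?step, OF step polytime_const[of "enc_nat 1"] polytime_enc_nat[OF e]] by blast
  have "computes_within (\<lambda>x. foldl (?step x) (enc_nat 1) (items (enc_nat (e x))))
      (\<lambda>x. poly r (tree_size x + ?B (tree_size x)))"
    by (rule r[of ?B]) (intro allI impI bound)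
  then have "computes_within (\<lambda>x. enc_nat (b x ^ e x)) (\<lambda>x. poly r (tree_size x + ?B (tree_size x)))"
    unfolding fold items_enc_nat length_replicate .
  then show ?thesis by (rule exI[where P = "computes_within (\<lambda>x. enc_nat (b x ^ e x))"])
qed

lemma computable_words_bound:
  fixes p q :: "nat poly"
  shows "computable (\<lambda>(a, b). Suc (poly p (poly q (a + b) + words_bound (poly q (a + b)))))"
proof -
  let ?F = "\<lambda>z. enc_nat (poly q (nat_of (tree_fst z) + nat_of (tree_snd z)))"
  \<comment> \<open>The factor 3 belongs to \<open>words_bound\<close>; the second component carries
    the bare power.\<close>
  let ?H = "\<lambda>z. enc_nat (Suc (poly p (nat_of (tree_fst z) + 3 * nat_of (tree_snd z))))"
  have polytime: "polytime ?F" "polytime ?H" by (intro polytime_intros polytime_nat_poly)+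
  obtain p1 where F: "computes_within ?F (\<lambda>x. poly p1 (tree_size x))" by (rule polytime_E[OF polytime(1)])
  obtain p2 where H: "computes_within ?H (\<lambda>x. poly p2 (tree_size x))" by (rule polytime_E[OF polytime(2)])
  have "polytime_nat (\<lambda>x. 10 * nat_of x * nat_of x)" "polytime_nat (\<lambda>x. 3 * nat_of x)" by (intro polytime_intros)+
  from computes_within_power[OF this] obtain R
    where R: "computes_within (\<lambda>x. enc_nat ((10 * nat_of x * nat_of x) ^ (3 * nat_of x))) R" by (rule exE)
  from computes_within_runs[OF computes_within_compose[OF F computes_within_compose[OF computes_within_pair[OF computes_within_id R] H]]] obtain c where c: "\<And>z. \<exists>t. runs c z t (?H (Node (?F z)
      (enc_nat ((10 * nat_of (?F z) * nat_of (?F z)) ^ (3 * nat_of (?F z))))))" by blast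
  have "\<exists>t. runs c (enc_nat_pair (a, b)) t
      (enc_nat (Suc (poly p (poly q (a + b) + words_bound (poly q (a + b))))))" for a b
    using c[of "enc_nat_pair (a, b)"] by (simp add: words_bound_def)
  then show ?thesis unfolding computable_def by auto
qed

text \<open>Kernelization is polynomial in the input, and the search depends on the size of the
  kernel alone. Monotonicity of \<open>words_bound\<close> replaces that size by its bound in the
  parameter.\<close>

lemma fpt_if_decided_by_words:
  assumes d: "polytime_pred d"
    and correct: "\<And>x. valid_inst x \<Longrightarrow> d (Node (enc_inst x) (words_tree (enc_inst x))) \<longleftrightarrow> Q x"
    and kernel: "\<And>x. valid_inst x \<Longrightarrow> Q (kernel x) \<longleftrightarrow> Q x"
  shows "fpt Q param_k_c4"
proof -
  obtain p1 where p1: "computes_within kernel_tree (\<lambda>x. poly p1 (tree_size x))" by (rule polytime_E[OF polytime_kernel_tree]) blast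
  obtain p2 where p2: "computes_within words_tree (\<lambda>x. poly p2 (tree_size x + words_bound (tree_size x)))"
    using computes_within_words_tree by blast
  obtain p3 where p3: "computes_within (\<lambda>z. enc_bool (d z)) (\<lambda>z. poly p3 (tree_size z))"
    by (rule polytime_E[OF d[unfolded polytime_pred_def]]) blast
  obtain q where q: "\<And>x. valid_inst x \<Longrightarrow>
      tree_size (enc_inst (kernel x)) \<le> poly q (fst (param_k_c4 x) + snd (param_k_c4 x))"
    using kernel_size by blast
  let ?D = "\<lambda>y. enc_bool (d (Node y (words_tree y)))"
  \<comment> \<open>The 4 pays for the identity and the pairing; \<open>[:1, 1:]\<close> adds the
    root joining the instance to its word list.\<close>
  let ?r = "4 + p2 + pcompose p3 [:1, 1:]"
  let ?B = "\<lambda>s. s + words_bound s"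
  have D: "computes_within ?D (\<lambda>y. poly ?r (?B (tree_size y)))"
  proof (rule computes_within_mono[OF computes_within_compose[OF computes_within_pair[OF computes_within_id p2] p3]])
    fix y
    have "tree_size (Node y (words_tree y)) \<le> 1 + ?B (tree_size y)" using tree_size_words_tree[of y] by simp
    then have "poly p3 (tree_size (Node y (words_tree y))) \<le> poly p3 (1 + ?B (tree_size y))"
      by (rule poly_nat_mono)
    then show "1 + poly p2 (tree_size y + words_bound (tree_size y)) + 3 +
        poly p3 (tree_size (Node y (words_tree y))) \<le> poly ?r (?B (tree_size y))"
      by (simp add: poly_pcompose del: tree_size.simps)
  qed
  obtain c where c: "\<And>x. \<exists>t\<le>poly p1 (tree_size x) + poly ?r (?B (tree_size (kernel_tree x))) + 2.
      runs c x t (?D (kernel_tree x))"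
    using computes_within_runs[OF computes_within_compose[OF p1 D]] by blast
  let ?f = "\<lambda>(a, b). Suc (poly ?r (poly q (a + b) + words_bound (poly q (a + b))))"
  have "\<exists>t. runs c (enc_inst x) t (enc_bool (Q x)) \<and>
      t \<le> ?f (param_k_c4 x) * poly (p1 + 3) (tree_size (enc_inst x))" if x: "valid_inst x" for x
  proof -
    obtain a b where ab: "param_k_c4 x = (a, b)" by (cases "param_k_c4 x")
    have "?D (kernel_tree (enc_inst x)) = enc_bool (Q x)"
      using correct[OF kernel_valid[OF x]] kernel[OF x] by (simp add: kernel_tree_enc_inst[OF x])
    then obtain t where t: "runs c (enc_inst x) t (enc_bool (Q x))"
      "t \<le> poly p1 (tree_size (enc_inst x)) + poly ?r (?B (tree_size (enc_inst (kernel x)))) + 2"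
      using c[of "enc_inst x"] kernel_tree_enc_inst[OF x] by auto
    let ?s = "tree_size (enc_inst (kernel x))" and ?P = "poly p1 (tree_size (enc_inst x))"
    have "?s \<le> poly q (a + b)" using q[OF x] ab by simp
    then have "?B ?s \<le> ?B (poly q (a + b))" by (intro add_le_mono words_bound_mono)
    then have "poly ?r (?B ?s) \<le> poly ?r (?B (poly q (a + b)))" by (rule poly_nat_mono)
    moreover define g where "g = poly ?r (?B (poly q (a + b)))"
    ultimately have "t \<le> ?P + g + 2" using t(2) by linarith
    \<comment> \<open>\<open>fpt\<close> asks for a product; \<open>Suc\<close> keeps the first
      factor positive when \<open>g\<close> vanishes.\<close>
    also have "\<dots> \<le> Suc g * (?P + 3)" by (simp add: algebra_simps)
    finally have "t \<le> ?f (param_k_c4 x) * poly (p1 + 3) (tree_size (enc_inst x))"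
      by (simp add: ab g_def)
    then show ?thesis using t(1) by blast
  qed
  moreover have "computable ?f" by (rule computable_words_bound)
  ultimately show ?thesis unfolding fpt_def by blast
qed

theorem theorem11:
  "\<forall>Q \<in> {Acyclic_Matching, Induced_Matching}.
     fpt Q param_k_c4 \<and>
     (\<exists>K. polynomial_kernel Q param_k_c4 K \<and>
        (\<exists>C::nat. \<forall>n E k. valid_inst ((n, E), k) \<longrightarrow>
           num_edges (K ((n, E), k)) \<le> C * (k * (k\<^sup>2 + c4 E) ^ 4)))"
proof -
  have "polynomial_kernel Q param_k_c4 kernel" if "\<And>x. valid_inst x \<Longrightarrow> Q (kernel x) \<longleftrightarrow> Q x" for Q
    unfolding polynomial_kernel_def using poly_time_kernel kernel_valid kernel_size that by blast
  then have "polynomial_kernel Acyclic_Matching param_k_c4 kernel"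
    "polynomial_kernel Induced_Matching param_k_c4 kernel"
    using kernel_correct by blast+
  moreover have "fpt Acyclic_Matching param_k_c4"
    by (rule fpt_if_decided_by_words[OF polytime_pred_decide_acyclic decide_correct(1) kernel_correct(1)])
  moreover have "fpt Induced_Matching param_k_c4"
    by (rule fpt_if_decided_by_words[OF polytime_pred_decide_induced decide_correct(2) kernel_correct(2)])
  moreover have "\<exists>C::nat. \<forall>n E k. valid_inst ((n, E), k) \<longrightarrow>
      num_edges (kernel ((n, E), k)) \<le> C * (k * (k\<^sup>2 + c4 E) ^ 4)"
    using kernel_num_edges by blast
  ultimately show ?thesis by blast
qed

end
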